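(* Let $\mathcal{C}$ be a generalized near-group fusion category of type $(G,\Gamma,k_1,\dots,k_n)$. Then one of the following holds. (1) If $(k_1,\dots,k_n)=(0,\dots,0)$, then $\mathcal{C}$ is a generalized Tambara–Yamagami fusion category. (2) If $(k_1,\dots,k_n)\neq(0,\dots,0)$, then $\mathcal{C}$ is an extension of a smaller generalized near-group fusion category with trivial universal grading.
   Context: Fusion categories are over an algebraically closed field $k$ of characteristic $0$. $\operatorname{Irr}(\mathcal{C})$ is the set of isomorphism classes of simple objects; $G=G(\mathcal{C})$ is the group of invertible simple objects. A generalized near-group fusion category is a non-pointed fusion category $\mathcal{C}$ such that $G$, acting by left tensor product, acts transitively on $\operatorname{Irr}(\mathcal{C})\setminus G=\{X_1,\dots,X_n\}$. It is of type $(G,\Gamma,k_1,\dots,k_n)$ if $\Gamma$ is the stabilizer of $X_1$ in $G$ and $X_1\otimes X_1^*=\bigoplus_{h\in\Gamma}h\oplus k_1X_1\oplus\cdots\oplus k_nX_n$, with $k_1,\dots,k_n$ non-negative integers. A generalized Tambara–Yamagami fusion category is a non-pointed fusion category in which the tensor product of any two non-invertible simple objects is a direct sum of invertible simple objects. $\mathcal{C}$ is an extension of $\mathcal{D}$ if for some finite group $H$ there is a faithful grading $\mathcal{C}=\bigoplus_{h\in H}\mathcal{C}_h$ (all $\mathcal{C}_h\ne0$, $\mathcal{C}_g\otimes\mathcal{C}_h\subseteq\mathcal{C}_{gh}$, $(\mathcal{C}_h)^*=\mathcal{C}_{h^{-1}}$) with $\mathcal{C}_e$ equivalent to $\mathcal{D}$.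 The universal grading of $\mathcal{C}$ is its canonical faithful grading with trivial component the adjoint subcategory $\mathcal{C}_{ad}$ (generated by the simple constituents of all $X\otimes X^*$, $X$ simple); its group is the universal grading group $\mathcal{U}(\mathcal{C})$, and the universal grading is trivial if $\mathcal{U}(\mathcal{C})$ is trivial.
   Formalization: "Smaller" is proved as: no more simple objects than C, and strictly fewer unless C itself already has trivial universal grading; strictly smaller is impossible in that case (e.g. the Fibonacci category, an extension only of itself). *)

theory Defs
  imports
    "HOL-Algebra.Group_Action"
    "HOL-Computational_Algebra.Polynomial"
begin

text \<open>
  The data of a \<open>'k\<close>-linear monoidal category: a set of objects, a set of arrows, and operations
  that are only meaningful on objects and on composable (parallel) arrows.  \<open>g \<cdot> f\<close> is \<open>g\<close> after
  \<open>f\<close>.  The associator is \<open>assoc X Y Z : (X \<otimes> Y) \<otimes> Z \<rightarrow> X \<otimes> (Y \<otimes> Z)\<close>, the unitors are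
  \<open>lunit X : 1 \<otimes> X \<rightarrow> X\<close> and \<open>runit X : X \<otimes> 1 \<rightarrow> X\<close>.
\<close>

record ('o, 'm, 'k) lin_mon_cat =
  obj :: "'o set"
  arr :: "'m set"
  src :: "'m \<Rightarrow> 'o"
  tgt :: "'m \<Rightarrow> 'o"
  ident :: "'o \<Rightarrow> 'm"
  cmp :: "'m \<Rightarrow> 'm \<Rightarrow> 'm"  (infixr "\<cdot>\<index>" 60)
  zero_arr :: "'o \<Rightarrow> 'o \<Rightarrow> 'm"
  plus_arr :: "'m \<Rightarrow> 'm \<Rightarrow> 'm"  (infixl "\<boxplus>\<index>" 55)
  scale_arr :: "'k \<Rightarrow> 'm \<Rightarrow> 'm"  (infixr "\<odot>\<^sub>m\<index>" 65)
  tensor_obj :: "'o \<Rightarrow> 'o \<Rightarrow> 'o"  (infixr "\<boxtimes>\<^sub>o\<index>" 70)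
  tensor_arr :: "'m \<Rightarrow> 'm \<Rightarrow> 'm"  (infixr "\<boxtimes>\<^sub>m\<index>" 70)
  unit_obj :: "'o"  ("\<I>\<index>")
  assoc :: "'o \<Rightarrow> 'o \<Rightarrow> 'o \<Rightarrow> 'm"
  lunit :: "'o \<Rightarrow> 'm"
  runit :: "'o \<Rightarrow> 'm"

context
  fixes C :: "('o, 'm, 'k) lin_mon_cat" (structure)
begin

definition hom_set :: "'o \<Rightarrow> 'o \<Rightarrow> 'm set" where
  "hom_set X Y = {f \<in> arr C. src C f = X \<and> tgt C f = Y}"

definition inverse_arrs :: "'m \<Rightarrow> 'm \<Rightarrow> bool" where
  "inverse_arrs f g \<longleftrightarrow>
     f \<in> arr C \<and> g \<in> hom_set (tgt C f) (src C f) \<and>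
     g \<cdot> f = ident C (src C f) \<and> f \<cdot> g = ident C (tgt C f)"

definition iso_arr :: "'m \<Rightarrow> bool" where
  "iso_arr f \<longleftrightarrow> (\<exists>g. inverse_arrs f g)"

definition inv_arr :: "'m \<Rightarrow> 'm" where
  "inv_arr f = (THE g. inverse_arrs f g)"

definition isomorphic :: "'o \<Rightarrow> 'o \<Rightarrow> bool" where
  "isomorphic X Y \<longleftrightarrow> X \<in> obj C \<and> Y \<in> obj C \<and> (\<exists>f \<in> hom_set X Y. iso_arr f)"

definition iso_class :: "'o \<Rightarrow> 'o set" where
  "iso_class X = {Y. isomorphic X Y}"

definition mono_arr :: "'m \<Rightarrow> bool" where
  "mono_arr m \<longleftrightarrow> m \<in> arr C \<and>
     (\<forall>X \<in> obj C. \<forall>f \<in> hom_set X (src C m). \<forall>g \<in> hom_set X (src C m).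
        m \<cdot> f = m \<cdot> g \<longrightarrow> f = g)"

definition epi_arr :: "'m \<Rightarrow> bool" where
  "epi_arr e \<longleftrightarrow> e \<in> arr C \<and>
     (\<forall>X \<in> obj C. \<forall>f \<in> hom_set (tgt C e) X. \<forall>g \<in> hom_set (tgt C e) X.
        f \<cdot> e = g \<cdot> e \<longrightarrow> f = g)"

definition zero_object :: "'o \<Rightarrow> bool" where
  "zero_object Z \<longleftrightarrow> Z \<in> obj C \<and>
     (\<forall>X \<in> obj C. (\<exists>!f. f \<in> hom_set X Z) \<and> (\<exists>!f. f \<in> hom_set Z X))"

definition is_kernel :: "'m \<Rightarrow> 'm \<Rightarrow> bool" where
  "is_kernel f i \<longleftrightarrow>
     f \<in> arr C \<and> i \<in> arr C \<and> tgt C i = src C f \<and> f \<cdot> i = zero_arr C (src C i) (tgt C f) \<and>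
     (\<forall>h \<in> arr C. tgt C h = src C f \<and> f \<cdot> h = zero_arr C (src C h) (tgt C f) \<longrightarrow>
        (\<exists>!u. u \<in> hom_set (src C h) (src C i) \<and> i \<cdot> u = h))"

definition is_cokernel :: "'m \<Rightarrow> 'm \<Rightarrow> bool" where
  "is_cokernel f p \<longleftrightarrow>
     f \<in> arr C \<and> p \<in> arr C \<and> src C p = tgt C f \<and> p \<cdot> f = zero_arr C (src C f) (tgt C p) \<and>
     (\<forall>h \<in> arr C. src C h = tgt C f \<and> h \<cdot> f = zero_arr C (src C f) (tgt C h) \<longrightarrow>
        (\<exists>!u. u \<in> hom_set (tgt C p) (tgt C h) \<and> u \<cdot> p = h))"

definition sum_arrs :: "'o \<Rightarrow> 'o \<Rightarrow> 'm list \<Rightarrow> 'm" where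
  "sum_arrs X Y fs = foldr (\<lambda>f g. f \<boxplus> g) fs (zero_arr C X Y)"

text \<open>\<open>S\<close> is a biproduct of the finite list \<open>Xs\<close>; for the empty list this says that \<open>S\<close> is zero.\<close>

definition is_direct_sum :: "'o \<Rightarrow> 'o list \<Rightarrow> bool" where
  "is_direct_sum S Xs \<longleftrightarrow> S \<in> obj C \<and> set Xs \<subseteq> obj C \<and>
     (\<exists>\<iota> \<pi>.
        (\<forall>i < length Xs. \<iota> i \<in> hom_set (Xs ! i) S \<and> \<pi> i \<in> hom_set S (Xs ! i)) \<and>
        (\<forall>i < length Xs. \<forall>j < length Xs.
           \<pi> i \<cdot> \<iota> j = (if i = j then ident C (Xs ! i) else zero_arr C (Xs ! j) (Xs ! i))) \<and>
        sum_arrs S S (map (\<lambda>i. \<iota> i \<cdot> \<pi> i) [0..<length Xs]) = ident C S)"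

definition simple_object :: "'o \<Rightarrow> bool" where
  "simple_object X \<longleftrightarrow> X \<in> obj C \<and> \<not> zero_object X \<and>
     (\<forall>m. mono_arr m \<and> tgt C m = X \<longrightarrow> zero_object (src C m) \<or> iso_arr m)"

definition constituent :: "'o \<Rightarrow> 'o \<Rightarrow> bool" where
  "constituent Y Z \<longleftrightarrow>
     (\<exists>Ys. (\<forall>W \<in> set Ys. simple_object W) \<and> Y \<in> set Ys \<and> is_direct_sum Z Ys)"

definition Irr :: "'o set set" where
  "Irr = iso_class ` {X. simple_object X}"

definition finite_dim_hom :: "'o \<Rightarrow> 'o \<Rightarrow> bool" where
  "finite_dim_hom X Y \<longleftrightarrow>
     (\<exists>bs. set bs \<subseteq> hom_set X Y \<and>
        (\<forall>f \<in> hom_set X Y. \<exists>c.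
           f = sum_arrs X Y (map (\<lambda>i. c i \<odot>\<^sub>m (bs ! i)) [0..<length bs])))"

text \<open>
  \<open>Y\<close> is a left dual \<open>X\<^sup>*\<close> of \<open>X\<close>, with evaluation \<open>X\<^sup>* \<otimes> X \<rightarrow> 1\<close> and coevaluation
  \<open>1 \<rightarrow> X \<otimes> X\<^sup>*\<close>; the two equations are the zigzag identities, with the unitors moved to the
  other side.
\<close>

definition left_dual :: "'o \<Rightarrow> 'o \<Rightarrow> bool" where
  "left_dual X Y \<longleftrightarrow> X \<in> obj C \<and> Y \<in> obj C \<and>
     (\<exists>ev \<in> hom_set (Y \<boxtimes>\<^sub>o X) \<I>. \<exists>coev \<in> hom_set \<I> (X \<boxtimes>\<^sub>o Y).
        runit C X \<cdot> (ident C X \<boxtimes>\<^sub>m ev) \<cdot> assoc C X Y X \<cdot> (coev \<boxtimes>\<^sub>m ident C X) = lunit C X \<and>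
        lunit C Y \<cdot> (ev \<boxtimes>\<^sub>m ident C Y) \<cdot> inv_arr (assoc C Y X Y) \<cdot> (ident C Y \<boxtimes>\<^sub>m coev) = runit C Y)"

text \<open>A choice of \<open>X\<^sup>*\<close>; left duals are unique up to isomorphism.\<close>

definition dual :: "'o \<Rightarrow> 'o" where
  "dual X = (SOME Y. left_dual X Y)"

definition invertible_object :: "'o \<Rightarrow> bool" where
  "invertible_object X \<longleftrightarrow> X \<in> obj C \<and>
     (\<exists>Y \<in> obj C. isomorphic (X \<boxtimes>\<^sub>o Y) \<I> \<and> isomorphic (Y \<boxtimes>\<^sub>o X) \<I>)"

definition class_tensor :: "'o set \<Rightarrow> 'o set \<Rightarrow> 'o set" where
  "class_tensor x y = {Z. \<exists>X \<in> x. \<exists>Y \<in> y. isomorphic (X \<boxtimes>\<^sub>o Y) Z}"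

definition invertible_group :: "'o set monoid" where
  "invertible_group =
     \<lparr>carrier = iso_class ` {X. simple_object X \<and> invertible_object X},
      monoid.mult = class_tensor, one = iso_class \<I>\<rparr>"

definition noninvertible_Irr :: "'o set set" where
  "noninvertible_Irr = Irr - carrier invertible_group"

text \<open>\<open>restrict\<close>, because \<open>BijGroup\<close> consists of extensional functions.\<close>

definition left_tensor_action :: "'o set \<Rightarrow> 'o set \<Rightarrow> 'o set" where
  "left_tensor_action g = restrict (class_tensor g) noninvertible_Irr"

definition full_sub :: "'o set \<Rightarrow> ('o, 'm, 'k) lin_mon_cat" where
  "full_sub S = C\<lparr>obj := obj C \<inter> S, arr := {f \<in> arr C. src C f \<in> S \<and> tgt C f \<in> S}\<rparr>"

text \<open>
  Full subcategories are given by their sets of objects.  Closure under subobjects and quotients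
  includes closure under isomorphism.
\<close>

definition abelian_subcategory :: "'o set \<Rightarrow> bool" where
  "abelian_subcategory S \<longleftrightarrow> S \<subseteq> obj C \<and>
     (\<forall>Z. zero_object Z \<longrightarrow> Z \<in> S) \<and>
     (\<forall>X \<in> S. \<forall>Y \<in> S. \<forall>Z. is_direct_sum Z [X, Y] \<longrightarrow> Z \<in> S) \<and>
     (\<forall>m. mono_arr m \<and> tgt C m \<in> S \<longrightarrow> src C m \<in> S) \<and>
     (\<forall>e. epi_arr e \<and> src C e \<in> S \<longrightarrow> tgt C e \<in> S)"

definition fusion_subcategory :: "'o set \<Rightarrow> bool" where
  "fusion_subcategory S \<longleftrightarrow> abelian_subcategory S \<and> \<I> \<in> S \<and>
     (\<forall>X \<in> S. \<forall>Y \<in> S. X \<boxtimes>\<^sub>o Y \<in> S) \<and>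
     (\<forall>X \<in> S. \<forall>Y. left_dual X Y \<longrightarrow> Y \<in> S)"

definition adjoint_subcategory :: "'o set" where
  "adjoint_subcategory =
     \<Inter> {S. fusion_subcategory S \<and>
          (\<forall>X Y. simple_object X \<and> constituent Y (X \<boxtimes>\<^sub>o dual X) \<longrightarrow> Y \<in> S)}"

end

locale small_category =
  fixes C :: "('o, 'm, 'k) lin_mon_cat" (structure)
  assumes src_obj: "f \<in> arr C \<Longrightarrow> src C f \<in> obj C"
    and tgt_obj: "f \<in> arr C \<Longrightarrow> tgt C f \<in> obj C"
    and ident_hom: "X \<in> obj C \<Longrightarrow> ident C X \<in> hom_set C X X"
    and cmp_hom: "\<lbrakk>f \<in> hom_set C X Y; g \<in> hom_set C Y Z\<rbrakk> \<Longrightarrow> g \<cdot> f \<in> hom_set C X Z"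
    and cmp_assoc: "\<lbrakk>f \<in> hom_set C W X; g \<in> hom_set C X Y; h \<in> hom_set C Y Z\<rbrakk>
        \<Longrightarrow> (h \<cdot> g) \<cdot> f = h \<cdot> (g \<cdot> f)"
    and cmp_ident_left: "f \<in> hom_set C X Y \<Longrightarrow> ident C Y \<cdot> f = f"
    and cmp_ident_right: "f \<in> hom_set C X Y \<Longrightarrow> f \<cdot> ident C X = f"

locale linear_category = small_category C
  for C :: "('o, 'm, 'k::field) lin_mon_cat" (structure) +
  assumes zero_hom: "\<lbrakk>X \<in> obj C; Y \<in> obj C\<rbrakk> \<Longrightarrow> zero_arr C X Y \<in> hom_set C X Y"
    and plus_hom: "\<lbrakk>f \<in> hom_set C X Y; g \<in> hom_set C X Y\<rbrakk> \<Longrightarrow> f \<boxplus> g \<in> hom_set C X Y"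
    and scale_hom: "f \<in> hom_set C X Y \<Longrightarrow> c \<odot>\<^sub>m f \<in> hom_set C X Y"
    and plus_assoc: "\<lbrakk>f \<in> hom_set C X Y; g \<in> hom_set C X Y; h \<in> hom_set C X Y\<rbrakk>
        \<Longrightarrow> (f \<boxplus> g) \<boxplus> h = f \<boxplus> (g \<boxplus> h)"
    and plus_comm: "\<lbrakk>f \<in> hom_set C X Y; g \<in> hom_set C X Y\<rbrakk> \<Longrightarrow> f \<boxplus> g = g \<boxplus> f"
    and plus_zero: "f \<in> hom_set C X Y \<Longrightarrow> f \<boxplus> zero_arr C X Y = f"
    and plus_inverse: "f \<in> hom_set C X Y \<Longrightarrow> \<exists>g \<in> hom_set C X Y. f \<boxplus> g = zero_arr C X Y"
    and scale_one: "f \<in> hom_set C X Y \<Longrightarrow> 1 \<odot>\<^sub>m f = f"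
    and scale_scale: "f \<in> hom_set C X Y \<Longrightarrow> a \<odot>\<^sub>m (b \<odot>\<^sub>m f) = (a * b) \<odot>\<^sub>m f"
    and scale_add_left: "f \<in> hom_set C X Y \<Longrightarrow> (a + b) \<odot>\<^sub>m f = (a \<odot>\<^sub>m f) \<boxplus> (b \<odot>\<^sub>m f)"
    and scale_add_right: "\<lbrakk>f \<in> hom_set C X Y; g \<in> hom_set C X Y\<rbrakk>
        \<Longrightarrow> a \<odot>\<^sub>m (f \<boxplus> g) = (a \<odot>\<^sub>m f) \<boxplus> (a \<odot>\<^sub>m g)"
    and cmp_plus_left: "\<lbrakk>f \<in> hom_set C X Y; g \<in> hom_set C Y Z; h \<in> hom_set C Y Z\<rbrakk>
        \<Longrightarrow> (g \<boxplus> h) \<cdot> f = (g \<cdot> f) \<boxplus> (h \<cdot> f)"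
    and cmp_plus_right: "\<lbrakk>f \<in> hom_set C X Y; g \<in> hom_set C X Y; h \<in> hom_set C Y Z\<rbrakk>
        \<Longrightarrow> h \<cdot> (f \<boxplus> g) = (h \<cdot> f) \<boxplus> (h \<cdot> g)"
    and cmp_scale_left: "\<lbrakk>f \<in> hom_set C X Y; g \<in> hom_set C Y Z\<rbrakk>
        \<Longrightarrow> (a \<odot>\<^sub>m g) \<cdot> f = a \<odot>\<^sub>m (g \<cdot> f)"
    and cmp_scale_right: "\<lbrakk>f \<in> hom_set C X Y; g \<in> hom_set C Y Z\<rbrakk>
        \<Longrightarrow> g \<cdot> (a \<odot>\<^sub>m f) = a \<odot>\<^sub>m (g \<cdot> f)"

locale linear_abelian_category = linear_category C
  for C :: "('o, 'm, 'k::field) lin_mon_cat" (structure) +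
  assumes zero_object_exists: "\<exists>Z. zero_object C Z"
    and biproduct_exists: "\<lbrakk>X \<in> obj C; Y \<in> obj C\<rbrakk> \<Longrightarrow> \<exists>S. is_direct_sum C S [X, Y]"
    and kernel_exists: "f \<in> arr C \<Longrightarrow> \<exists>i. is_kernel C f i"
    and cokernel_exists: "f \<in> arr C \<Longrightarrow> \<exists>p. is_cokernel C f p"
    and mono_is_kernel: "mono_arr C m \<Longrightarrow> \<exists>f. is_kernel C f m"
    and epi_is_cokernel: "epi_arr C e \<Longrightarrow> \<exists>f. is_cokernel C f e"

locale linear_monoidal_category = linear_category C
  for C :: "('o, 'm, 'k::field) lin_mon_cat" (structure) +
  assumes unit_obj: "\<I> \<in> obj C"
    and tensor_obj: "\<lbrakk>X \<in> obj C; Y \<in> obj C\<rbrakk> \<Longrightarrow> X \<boxtimes>\<^sub>o Y \<in> obj C"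
    and tensor_hom: "\<lbrakk>f \<in> hom_set C X X'; g \<in> hom_set C Y Y'\<rbrakk>
        \<Longrightarrow> f \<boxtimes>\<^sub>m g \<in> hom_set C (X \<boxtimes>\<^sub>o Y) (X' \<boxtimes>\<^sub>o Y')"
    and tensor_ident: "\<lbrakk>X \<in> obj C; Y \<in> obj C\<rbrakk>
        \<Longrightarrow> ident C X \<boxtimes>\<^sub>m ident C Y = ident C (X \<boxtimes>\<^sub>o Y)"
    and tensor_cmp: "\<lbrakk>f \<in> hom_set C X X'; f' \<in> hom_set C X' X'';
          g \<in> hom_set C Y Y'; g' \<in> hom_set C Y' Y''\<rbrakk>
        \<Longrightarrow> (f' \<cdot> f) \<boxtimes>\<^sub>m (g' \<cdot> g) = (f' \<boxtimes>\<^sub>m g') \<cdot> (f \<boxtimes>\<^sub>m g)"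
    and tensor_plus_left: "\<lbrakk>f \<in> hom_set C X X'; f' \<in> hom_set C X X'; g \<in> hom_set C Y Y'\<rbrakk>
        \<Longrightarrow> (f \<boxplus> f') \<boxtimes>\<^sub>m g = (f \<boxtimes>\<^sub>m g) \<boxplus> (f' \<boxtimes>\<^sub>m g)"
    and tensor_plus_right: "\<lbrakk>f \<in> hom_set C X X'; g \<in> hom_set C Y Y'; g' \<in> hom_set C Y Y'\<rbrakk>
        \<Longrightarrow> f \<boxtimes>\<^sub>m (g \<boxplus> g') = (f \<boxtimes>\<^sub>m g) \<boxplus> (f \<boxtimes>\<^sub>m g')"
    and tensor_scale_left: "\<lbrakk>f \<in> hom_set C X X'; g \<in> hom_set C Y Y'\<rbrakk>
        \<Longrightarrow> (a \<odot>\<^sub>m f) \<boxtimes>\<^sub>m g = a \<odot>\<^sub>m (f \<boxtimes>\<^sub>m g)"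
    and tensor_scale_right: "\<lbrakk>f \<in> hom_set C X X'; g \<in> hom_set C Y Y'\<rbrakk>
        \<Longrightarrow> f \<boxtimes>\<^sub>m (a \<odot>\<^sub>m g) = a \<odot>\<^sub>m (f \<boxtimes>\<^sub>m g)"
    and assoc_hom: "\<lbrakk>X \<in> obj C; Y \<in> obj C; Z \<in> obj C\<rbrakk>
        \<Longrightarrow> assoc C X Y Z \<in> hom_set C ((X \<boxtimes>\<^sub>o Y) \<boxtimes>\<^sub>o Z) (X \<boxtimes>\<^sub>o (Y \<boxtimes>\<^sub>o Z))"
    and assoc_iso: "\<lbrakk>X \<in> obj C; Y \<in> obj C; Z \<in> obj C\<rbrakk> \<Longrightarrow> iso_arr C (assoc C X Y Z)"
    and assoc_natural: "\<lbrakk>f \<in> hom_set C X X'; g \<in> hom_set C Y Y'; h \<in> hom_set C Z Z'\<rbrakk>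
        \<Longrightarrow> assoc C X' Y' Z' \<cdot> ((f \<boxtimes>\<^sub>m g) \<boxtimes>\<^sub>m h) = (f \<boxtimes>\<^sub>m (g \<boxtimes>\<^sub>m h)) \<cdot> assoc C X Y Z"
    and lunit_hom: "X \<in> obj C \<Longrightarrow> lunit C X \<in> hom_set C (\<I> \<boxtimes>\<^sub>o X) X"
    and lunit_iso: "X \<in> obj C \<Longrightarrow> iso_arr C (lunit C X)"
    and lunit_natural: "f \<in> hom_set C X Y
        \<Longrightarrow> lunit C Y \<cdot> (ident C \<I> \<boxtimes>\<^sub>m f) = f \<cdot> lunit C X"
    and runit_hom: "X \<in> obj C \<Longrightarrow> runit C X \<in> hom_set C (X \<boxtimes>\<^sub>o \<I>) X"
    and runit_iso: "X \<in> obj C \<Longrightarrow> iso_arr C (runit C X)"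
    and runit_natural: "f \<in> hom_set C X Y
        \<Longrightarrow> runit C Y \<cdot> (f \<boxtimes>\<^sub>m ident C \<I>) = f \<cdot> runit C X"
    and pentagon: "\<lbrakk>W \<in> obj C; X \<in> obj C; Y \<in> obj C; Z \<in> obj C\<rbrakk>
        \<Longrightarrow> (ident C W \<boxtimes>\<^sub>m assoc C X Y Z) \<cdot> assoc C W (X \<boxtimes>\<^sub>o Y) Z \<cdot> (assoc C W X Y \<boxtimes>\<^sub>m ident C Z)
          = assoc C W X (Y \<boxtimes>\<^sub>o Z) \<cdot> assoc C (W \<boxtimes>\<^sub>o X) Y Z"
    and triangle: "\<lbrakk>X \<in> obj C; Y \<in> obj C\<rbrakk>
        \<Longrightarrow> (ident C X \<boxtimes>\<^sub>m lunit C Y) \<cdot> assoc C X \<I> Y = runit C X \<boxtimes>\<^sub>m ident C Y"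

locale fusion_category = linear_abelian_category C + linear_monoidal_category C
  for C :: "('o, 'm, 'k::{alg_closed_field, field_char_0}) lin_mon_cat" (structure) +
  assumes left_dual_exists: "X \<in> obj C \<Longrightarrow> \<exists>Y. left_dual C X Y"
    and right_dual_exists: "X \<in> obj C \<Longrightarrow> \<exists>Y. left_dual C Y X"
    and semisimple: "X \<in> obj C \<Longrightarrow> \<exists>Xs. (\<forall>Y \<in> set Xs. simple_object C Y) \<and> is_direct_sum C X Xs"
    and hom_finite_dim: "\<lbrakk>X \<in> obj C; Y \<in> obj C\<rbrakk> \<Longrightarrow> finite_dim_hom C X Y"
    and finitely_many_simples: "finite (Irr C)"
    and unit_simple: "simple_object C \<I>"

text \<open>
  A \<open>'k\<close>-linear strong monoidal functor: \<open>F\<close> on objects and \<open>\<Phi>\<close> on arrows, with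
  \<open>J X Y : F X \<otimes> F Y \<rightarrow> F (X \<otimes> Y)\<close> and \<open>\<epsilon> : 1 \<rightarrow> F 1\<close>.
\<close>

locale tensor_functor =
  fixes C :: "('o1, 'm1, 'k::field) lin_mon_cat"
    and D :: "('o2, 'm2, 'k) lin_mon_cat"
    and F :: "'o1 \<Rightarrow> 'o2" and \<Phi> :: "'m1 \<Rightarrow> 'm2"
    and J :: "'o1 \<Rightarrow> 'o1 \<Rightarrow> 'm2" and \<epsilon> :: "'m2"
  assumes F_obj: "X \<in> obj C \<Longrightarrow> F X \<in> obj D"
    and F_hom: "f \<in> hom_set C X Y \<Longrightarrow> \<Phi> f \<in> hom_set D (F X) (F Y)"
    and F_ident: "X \<in> obj C \<Longrightarrow> \<Phi> (ident C X) = ident D (F X)"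
    and F_cmp: "\<lbrakk>f \<in> hom_set C X Y; g \<in> hom_set C Y Z\<rbrakk> \<Longrightarrow> \<Phi> (g \<cdot>\<^bsub>C\<^esub> f) = \<Phi> g \<cdot>\<^bsub>D\<^esub> \<Phi> f"
    and F_plus: "\<lbrakk>f \<in> hom_set C X Y; g \<in> hom_set C X Y\<rbrakk>
        \<Longrightarrow> \<Phi> (f \<boxplus>\<^bsub>C\<^esub> g) = \<Phi> f \<boxplus>\<^bsub>D\<^esub> \<Phi> g"
    and F_scale: "f \<in> hom_set C X Y \<Longrightarrow> \<Phi> (a \<odot>\<^sub>m\<^bsub>C\<^esub> f) = a \<odot>\<^sub>m\<^bsub>D\<^esub> \<Phi> f"
    and J_hom: "\<lbrakk>X \<in> obj C; Y \<in> obj C\<rbrakk>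
        \<Longrightarrow> J X Y \<in> hom_set D (F X \<boxtimes>\<^sub>o\<^bsub>D\<^esub> F Y) (F (X \<boxtimes>\<^sub>o\<^bsub>C\<^esub> Y))"
    and J_iso: "\<lbrakk>X \<in> obj C; Y \<in> obj C\<rbrakk> \<Longrightarrow> iso_arr D (J X Y)"
    and J_natural: "\<lbrakk>f \<in> hom_set C X X'; g \<in> hom_set C Y Y'\<rbrakk>
        \<Longrightarrow> \<Phi> (f \<boxtimes>\<^sub>m\<^bsub>C\<^esub> g) \<cdot>\<^bsub>D\<^esub> J X Y = J X' Y' \<cdot>\<^bsub>D\<^esub> (\<Phi> f \<boxtimes>\<^sub>m\<^bsub>D\<^esub> \<Phi> g)"
    and \<epsilon>_hom: "\<epsilon> \<in> hom_set D \<I>\<^bsub>D\<^esub> (F \<I>\<^bsub>C\<^esub>)"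
    and \<epsilon>_iso: "iso_arr D \<epsilon>"
    and J_assoc: "\<lbrakk>X \<in> obj C; Y \<in> obj C; Z \<in> obj C\<rbrakk>
        \<Longrightarrow> \<Phi> (assoc C X Y Z) \<cdot>\<^bsub>D\<^esub> J (X \<boxtimes>\<^sub>o\<^bsub>C\<^esub> Y) Z \<cdot>\<^bsub>D\<^esub> (J X Y \<boxtimes>\<^sub>m\<^bsub>D\<^esub> ident D (F Z))
          = J X (Y \<boxtimes>\<^sub>o\<^bsub>C\<^esub> Z) \<cdot>\<^bsub>D\<^esub> (ident D (F X) \<boxtimes>\<^sub>m\<^bsub>D\<^esub> J Y Z) \<cdot>\<^bsub>D\<^esub> assoc D (F X) (F Y) (F Z)"
    and J_lunit: "X \<in> obj C
        \<Longrightarrow> \<Phi> (lunit C X) \<cdot>\<^bsub>D\<^esub> J \<I>\<^bsub>C\<^esub> X \<cdot>\<^bsub>D\<^esub> (\<epsilon> \<boxtimes>\<^sub>m\<^bsub>D\<^esub> ident D (F X)) = lunit D (F X)"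
    and J_runit: "X \<in> obj C
        \<Longrightarrow> \<Phi> (runit C X) \<cdot>\<^bsub>D\<^esub> J X \<I>\<^bsub>C\<^esub> \<cdot>\<^bsub>D\<^esub> (ident D (F X) \<boxtimes>\<^sub>m\<^bsub>D\<^esub> \<epsilon>) = runit D (F X)"

definition tensor_equivalent ::
  "('o1, 'm1, 'k::field) lin_mon_cat \<Rightarrow> ('o2, 'm2, 'k) lin_mon_cat \<Rightarrow> bool" where
  "tensor_equivalent C D \<longleftrightarrow>
     (\<exists>F \<Phi> J \<epsilon>. tensor_functor C D F \<Phi> J \<epsilon> \<and>
        (\<forall>X \<in> obj C. \<forall>Y \<in> obj C. bij_betw \<Phi> (hom_set C X Y) (hom_set D (F X) (F Y))) \<and>
        (\<forall>Z \<in> obj D. \<exists>X \<in> obj C. isomorphic D (F X) Z))"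

text \<open>
  The fourth and fifth conjuncts say that the category is the direct sum of the full subcategories
  \<open>Cs h\<close>.
\<close>

definition faithful_grading ::
  "('o, 'm, 'k) lin_mon_cat \<Rightarrow> ('h, 'b) monoid_scheme \<Rightarrow> ('h \<Rightarrow> 'o set) \<Rightarrow> bool" where
  "faithful_grading C H Cs \<longleftrightarrow>
     group H \<and> finite (carrier H) \<and>
     (\<forall>h \<in> carrier H. abelian_subcategory C (Cs h)) \<and>
     (\<forall>g \<in> carrier H. \<forall>h \<in> carrier H. g \<noteq> h \<longrightarrow>
        (\<forall>X \<in> Cs g. \<forall>Y \<in> Cs h. hom_set C X Y = {zero_arr C X Y})) \<and>
     (\<forall>X \<in> obj C. \<exists>hs Y. distinct hs \<and> set hs = carrier H \<and>
        (\<forall>h \<in> carrier H. Y h \<in> Cs h) \<and> is_direct_sum C X (map Y hs)) \<and>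
     (\<forall>h \<in> carrier H. \<exists>X \<in> Cs h. \<not> zero_object C X) \<and>
     (\<forall>g \<in> carrier H. \<forall>h \<in> carrier H. \<forall>X \<in> Cs g. \<forall>Y \<in> Cs h.
        X \<boxtimes>\<^sub>o\<^bsub>C\<^esub> Y \<in> Cs (g \<otimes>\<^bsub>H\<^esub> h)) \<and>
     (\<forall>h \<in> carrier H. {Y. \<exists>X \<in> Cs h. left_dual C X Y} = Cs (inv\<^bsub>H\<^esub> h))"

text \<open>Every finite group is isomorphic to one whose elements are natural numbers.\<close>

definition extension_of ::
  "('o1, 'm1, 'k::{alg_closed_field, field_char_0}) lin_mon_cat \<Rightarrow>
   ('o2, 'm2, 'k) lin_mon_cat \<Rightarrow> bool" where
  "extension_of C D \<longleftrightarrow> fusion_category C \<and> fusion_category D \<and>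
     (\<exists>(H :: nat monoid) Cs. faithful_grading C H Cs \<and>
        tensor_equivalent (full_sub C (Cs \<one>\<^bsub>H\<^esub>)) D)"

text \<open>
  A faithful grading is determined, up to isomorphism of the group, by its trivial component: two
  simple objects \<open>X\<close>, \<open>Y\<close> are in the same component iff \<open>X \<otimes> Y\<^sup>*\<close> is in the trivial one.
\<close>

definition universal_grading ::
  "('o, 'm, 'k) lin_mon_cat \<Rightarrow> ('h, 'b) monoid_scheme \<Rightarrow> ('h \<Rightarrow> 'o set) \<Rightarrow> bool" where
  "universal_grading C H Cs \<longleftrightarrow>
     faithful_grading C H Cs \<and> Cs \<one>\<^bsub>H\<^esub> = adjoint_subcategory C"

definition trivial_universal_grading :: "('o, 'm, 'k) lin_mon_cat \<Rightarrow> bool" where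
  "trivial_universal_grading C \<longleftrightarrow>
     (\<exists>(U :: nat monoid) Cs. universal_grading C U Cs \<and> carrier U = {\<one>\<^bsub>U\<^esub>})"

definition pointed :: "('o, 'm, 'k) lin_mon_cat \<Rightarrow> bool" where
  "pointed C \<longleftrightarrow> (\<forall>X. simple_object C X \<longrightarrow> invertible_object C X)"

definition generalized_near_group ::
  "('o, 'm, 'k::{alg_closed_field, field_char_0}) lin_mon_cat \<Rightarrow> bool" where
  "generalized_near_group C \<longleftrightarrow> fusion_category C \<and> \<not> pointed C \<and>
     transitive_action (invertible_group C) (noninvertible_Irr C) (left_tensor_action C)"

text \<open>
  \<open>Xs\<close> is an enumeration \<open>X\<^sub>1, \<dots>, X\<^sub>n\<close> of representatives of the non-invertible simple objects
  (nonempty, as the category is not pointed) and \<open>gs\<close> one of representatives of \<open>\<Gamma>\<close>.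
\<close>

definition generalized_near_group_of_type ::
  "('o, 'm, 'k::{alg_closed_field, field_char_0}) lin_mon_cat \<Rightarrow> 'o set monoid \<Rightarrow> 'o set set \<Rightarrow>
   nat list \<Rightarrow> bool" where
  "generalized_near_group_of_type C G \<Gamma> ks \<longleftrightarrow>
     generalized_near_group C \<and> G = invertible_group C \<and>
     (\<exists>Xs gs.
        (\<forall>X \<in> set Xs. simple_object C X) \<and> distinct (map (iso_class C) Xs) \<and>
        iso_class C ` set Xs = noninvertible_Irr C \<and>
        length ks = length Xs \<and>
        \<Gamma> = stabilizer G (left_tensor_action C) (iso_class C (hd Xs)) \<and>
        (\<forall>g \<in> set gs. simple_object C g) \<and> distinct (map (iso_class C) gs) \<and>
        iso_class C ` set gs = \<Gamma> \<and>
        is_direct_sum C (hd Xs \<boxtimes>\<^sub>o\<^bsub>C\<^esub> dual C (hd Xs)) (gs @ concat (map2 replicate ks Xs)))"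

definition generalized_Tambara_Yamagami ::
  "('o, 'm, 'k::{alg_closed_field, field_char_0}) lin_mon_cat \<Rightarrow> bool" where
  "generalized_Tambara_Yamagami C \<longleftrightarrow> fusion_category C \<and> \<not> pointed C \<and>
     (\<forall>X Y. simple_object C X \<and> \<not> invertible_object C X \<and>
            simple_object C Y \<and> \<not> invertible_object C Y \<longrightarrow>
        (\<exists>Zs. (\<forall>Z \<in> set Zs. simple_object C Z \<and> invertible_object C Z) \<and>
              is_direct_sum C (X \<boxtimes>\<^sub>o\<^bsub>C\<^esub> Y) Zs))"

text \<open>
  \<open>D\<close> has at most as many simple objects as \<open>C\<close>, and strictly fewer unless the universal grading
  of \<open>C\<close> is already trivial.  In that degenerate case (e.g. the Fibonacci category) \<open>C\<close> is not an
  extension of any strictly smaller category with trivial universal grading, only of itself.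
\<close>

definition smaller_unless_trivially_graded ::
  "('o1, 'm1, 'k) lin_mon_cat \<Rightarrow> ('o2, 'm2, 'k) lin_mon_cat \<Rightarrow> bool" where
  "smaller_unless_trivially_graded D C \<longleftrightarrow> card (Irr D) \<le> card (Irr C) \<and>
     (\<not> trivial_universal_grading C \<longrightarrow> card (Irr D) < card (Irr C))"

end

theory Submission
  imports Defs "HOL-Algebra.Weak_Morphisms"
begin

text \<open>
  The category \<open>D\<close> of case (2) is the adjoint subcategory \<open>A = C\<^sub>a\<^sub>d\<close>.  If some \<open>k\<^sub>i\<close> is nonzero, then \<open>A\<close>
  contains a non-invertible simple object, so by transitivity every simple object of \<open>C\<close> has the form
  \<open>u \<otimes> W\<close> with \<open>u\<close> invertible and \<open>W \<in> A\<close>.  Since \<open>A\<close> is stable under conjugation by invertible objects,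
  \<open>u \<otimes> W \<mapsto> [u]\<close> is a faithful grading of \<open>C\<close> by \<open>G(C) / G(A)\<close> with trivial component \<open>A\<close>.  If \<open>u \<otimes> X\<close> and
  \<open>X\<close> are non-invertible simple objects of \<open>A\<close>, then \<open>u\<close> is a summand of \<open>(u \<otimes> X) \<otimes> X\<^sup>*\<close> and so lies in
  \<open>A\<close>; hence \<open>G(A)\<close> acts transitively.  Finally, a simple object \<open>X = u \<otimes> X\<^sub>0\<close> with \<open>X\<^sub>0 \<in> A\<close> satisfies
  \<open>X \<otimes> X\<^sup>* = V \<otimes> V\<^sup>*\<close> with \<open>V = u \<otimes> X\<^sub>0 \<otimes> u\<^sup>*\<close> in \<open>A\<close>, so that the adjoint subcategory of \<open>A\<close> is \<open>A\<close>.

  Duality enters only through consequences of the zigzag identities: if \<open>Y\<close> is a left dual of \<open>X\<close>, then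
  \<open>1\<close> is a summand of \<open>X \<otimes> T\<close> for every simple summand \<open>T\<close> of \<open>Y\<close>, and of \<open>S \<otimes> Y\<close> for every simple
  summand \<open>S\<close> of \<open>X\<close>; moreover \<open>1\<close> is a summand of \<open>Y \<otimes> X\<close> if \<open>X\<close> is nonzero.
\<close>

section \<open>Linear categories\<close>

text \<open>The main obstacle is that duality comes only as a pair of arrows satisfying the zigzag
  identities: left duals of simple objects are not identified as simple, the dual of a tensor
  product is never computed, and multiplicities do not occur. Instead of "T is a dual of S" the
  proof uses that the unit is a retract of S \<otimes> T. For non-invertible simple S and T this
  suffices, because transitivity gives T = g \<otimes> S and S \<otimes> g = h \<otimes> S with g
  and h invertible, and invertible factors can be cancelled. For this reason even stability of the
  adjoint subcategory under conjugation rests on transitivity here. The second obstacle is that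
  \<open>fusion_subcategory\<close> asks for left duals only, whereas a
  \<open>fusion_category\<close> has duals on both sides. The missing closure is read off the
  duality clause of the grading, so the grading is built before the subcategory is known to be a
  fusion category. Case (1) uses the same devices: a product of two non-invertible simple objects is
  an invertible object times X \<otimes> T, where T is a simple summand of a dual of X. Retracts
  stand for subobjects and quotients alike, since monos and epis split.\<close>

definition retract :: "('o, 'm, 'k) lin_mon_cat \<Rightarrow> 'o \<Rightarrow> 'o \<Rightarrow> bool" where
  "retract C X Y \<longleftrightarrow> (\<exists>i \<in> hom_set C X Y. \<exists>p \<in> hom_set C Y X. p \<cdot>\<^bsub>C\<^esub> i = ident C X)"

text \<open>The case of two summands with its four arrows named, so that the equations can be used
  for rewriting without index functions; \<open>is_direct_sum_two_iff\<close> links it to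
  \<open>is_direct_sum\<close>.\<close>

definition biproduct_arrs ::
  "('o, 'm, 'k) lin_mon_cat \<Rightarrow> 'o \<Rightarrow> 'o \<Rightarrow> 'o \<Rightarrow> 'm \<Rightarrow> 'm \<Rightarrow> 'm \<Rightarrow> 'm \<Rightarrow> bool" where
  "biproduct_arrs C Z X Y i j p q \<longleftrightarrow>
     i \<in> hom_set C X Z \<and> j \<in> hom_set C Y Z \<and> p \<in> hom_set C Z X \<and> q \<in> hom_set C Z Y \<and>
     p \<cdot>\<^bsub>C\<^esub> i = ident C X \<and> q \<cdot>\<^bsub>C\<^esub> j = ident C Y \<and>
     p \<cdot>\<^bsub>C\<^esub> j = zero_arr C Y X \<and> q \<cdot>\<^bsub>C\<^esub> i = zero_arr C X Y \<and>
     (i \<cdot>\<^bsub>C\<^esub> p) \<boxplus>\<^bsub>C\<^esub> (j \<cdot>\<^bsub>C\<^esub> q) = ident C Z"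

definition biproduct :: "('o, 'm, 'k) lin_mon_cat \<Rightarrow> 'o \<Rightarrow> 'o \<Rightarrow> 'o \<Rightarrow> bool" where
  "biproduct C Z X Y \<longleftrightarrow> (\<exists>i j p q. biproduct_arrs C Z X Y i j p q)"

context small_category
begin

lemma in_hom_iff: "f \<in> hom_set C X Y \<longleftrightarrow> f \<in> arr C \<and> src C f = X \<and> tgt C f = Y"
  by (auto simp: hom_set_def)

declare src_obj [simp] tgt_obj [simp]

lemma ident_arr [simp]:
  "X \<in> obj C \<Longrightarrow> ident C X \<in> arr C"
  "X \<in> obj C \<Longrightarrow> src C (ident C X) = X"
  "X \<in> obj C \<Longrightarrow> tgt C (ident C X) = X"
  using ident_hom by (auto simp: in_hom_iff)

lemma cmp_arr [simp]:
  assumes "f \<in> arr C" "g \<in> arr C" "src C g = tgt C f"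
  shows "g \<cdot> f \<in> arr C" "src C (g \<cdot> f) = src C f" "tgt C (g \<cdot> f) = tgt C g"
  using cmp_hom[of f "src C f" "tgt C f" g "tgt C g"] assms by (auto simp: in_hom_iff)

lemma cmp_ident [simp]:
  "f \<in> arr C \<Longrightarrow> Y = tgt C f \<Longrightarrow> ident C Y \<cdot> f = f"
  "f \<in> arr C \<Longrightarrow> X = src C f \<Longrightarrow> f \<cdot> ident C X = f"
  using cmp_ident_left[of f "src C f" "tgt C f"] cmp_ident_right[of f "src C f" "tgt C f"]
  by (auto simp: in_hom_iff)

lemma cmp_assoc_arr [simp]:
  "\<lbrakk>f \<in> arr C; g \<in> arr C; h \<in> arr C; src C g = tgt C f; src C h = tgt C g\<rbrakk>
    \<Longrightarrow> (h \<cdot> g) \<cdot> f = h \<cdot> g \<cdot> f"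
  by (rule cmp_assoc) (auto simp: in_hom_iff)

text \<open>Since \<open>cmp_assoc_arr\<close> nests composites to the right, an equation for two
  adjacent arrows no longer matches inside a longer composite. This is the equation prolonged by a
  further arrow.\<close>

lemma cmp_eq_assoc:
  assumes "g \<cdot> f = k" "f \<in> arr C" "g \<in> arr C" "src C g = tgt C f" "x \<in> arr C" "tgt C x = src C f"
  shows "g \<cdot> f \<cdot> x = k \<cdot> x"
  using assms by (simp flip: cmp_assoc_arr)

lemma inverse_arrs_unique:
  assumes "inverse_arrs C f g" "inverse_arrs C f h" shows "g = h"
proof -
  have "(g \<cdot> f) \<cdot> h = g \<cdot> f \<cdot> h"
    using assms by (intro cmp_assoc_arr) (auto simp: inverse_arrs_def in_hom_iff)
  then show ?thesis
    using assms by (simp add: inverse_arrs_def in_hom_iff)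
qed

lemma inv_arr_eq: "inverse_arrs C f g \<Longrightarrow> inv_arr C f = g"
  unfolding inv_arr_def using inverse_arrs_unique by blast

lemma isomorphicI:
  assumes "f \<in> hom_set C X Y" "g \<in> hom_set C Y X" "g \<cdot> f = ident C X" "f \<cdot> g = ident C Y"
  shows "isomorphic C X Y"
  using assms by (auto simp: isomorphic_def iso_arr_def inverse_arrs_def in_hom_iff Bex_def)

lemma isomorphicE:
  assumes "isomorphic C X Y"
  obtains f g where "f \<in> hom_set C X Y" "g \<in> hom_set C Y X"
    "g \<cdot> f = ident C X" "f \<cdot> g = ident C Y"
  using assms by (auto simp: isomorphic_def iso_arr_def inverse_arrs_def in_hom_iff Bex_def)

lemma iso_arr_isomorphic: "iso_arr C f \<Longrightarrow> isomorphic C (src C f) (tgt C f)"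
  by (auto simp: isomorphic_def iso_arr_def inverse_arrs_def in_hom_iff Bex_def)

lemma isomorphic_obj: "isomorphic C X Y \<Longrightarrow> X \<in> obj C" "isomorphic C X Y \<Longrightarrow> Y \<in> obj C"
  by (auto simp: isomorphic_def)

lemma isomorphic_refl [simp]: "X \<in> obj C \<Longrightarrow> isomorphic C X X"
  by (rule isomorphicI[of "ident C X" _ _ "ident C X"]) (auto simp: in_hom_iff)

lemma isomorphic_sym: "isomorphic C X Y \<Longrightarrow> isomorphic C Y X"
  by (auto elim!: isomorphicE intro: isomorphicI)

lemma isomorphic_trans [trans]:
  assumes "isomorphic C X Y" "isomorphic C Y Z" shows "isomorphic C X Z"
proof -
  obtain f g where 1: "f \<in> hom_set C X Y" "g \<in> hom_set C Y X"
    "g \<cdot> f = ident C X" "f \<cdot> g = ident C Y" using assms(1) by (rule isomorphicE)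
  obtain f' g' where 2: "f' \<in> hom_set C Y Z" "g' \<in> hom_set C Z Y"
    "g' \<cdot> f' = ident C Y" "f' \<cdot> g' = ident C Z" using assms(2) by (rule isomorphicE)
  show ?thesis
    using 1 2 cmp_eq_assoc[OF 2(3), of f] cmp_eq_assoc[OF 1(4), of g']
    by (intro isomorphicI[of "f' \<cdot> f" _ _ "g \<cdot> g'"]) (auto simp: in_hom_iff)
qed

lemma iso_class_eq_iff:
  "X \<in> obj C \<Longrightarrow> Y \<in> obj C \<Longrightarrow> iso_class C X = iso_class C Y \<longleftrightarrow> isomorphic C X Y"
  unfolding iso_class_def using isomorphic_refl isomorphic_sym isomorphic_trans by blast

lemma retractE:
  assumes "retract C X Y"
  obtains i p where "i \<in> arr C" "src C i = X" "tgt C i = Y" "p \<in> arr C" "src C p = Y" "tgt C p = X"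
    "p \<cdot> i = ident C X"
  using assms by (auto simp: retract_def in_hom_iff Bex_def)

lemma retractI:
  "\<lbrakk>i \<in> hom_set C X Y; p \<in> hom_set C Y X; p \<cdot> i = ident C X\<rbrakk> \<Longrightarrow> retract C X Y"
  unfolding retract_def by blast

lemma retract_obj: "retract C X Y \<Longrightarrow> X \<in> obj C" "retract C X Y \<Longrightarrow> Y \<in> obj C"
  by (auto elim!: retractE)

lemma isomorphic_retract: "isomorphic C X Y \<Longrightarrow> retract C X Y"
  by (auto elim!: isomorphicE intro: retractI)

lemma retract_refl [simp]: "X \<in> obj C \<Longrightarrow> retract C X X"
  by (simp add: isomorphic_retract)

lemma retract_trans [trans]:
  assumes "retract C X Y" "retract C Y Z" shows "retract C X Z"
proof -
  obtain f g where 1: "f \<in> arr C" "src C f = X" "tgt C f = Y" "g \<in> arr C" "src C g = Y" "tgt C g = X"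
    "g \<cdot> f = ident C X" using assms(1) by (rule retractE)
  obtain f' g' where 2: "f' \<in> arr C" "src C f' = Y" "tgt C f' = Z" "g' \<in> arr C" "src C g' = Z"
    "tgt C g' = Y" "g' \<cdot> f' = ident C Y" using assms(2) by (rule retractE)
  show ?thesis
    using 1 2 cmp_eq_assoc[OF 2(7), of f]
    by (intro retractI[of "f' \<cdot> f" _ _ "g \<cdot> g'"]) (auto simp: in_hom_iff)
qed

lemma retract_isomorphic [trans]:
  "retract C X Y \<Longrightarrow> isomorphic C Y Z \<Longrightarrow> retract C X Z"
  "isomorphic C X Y \<Longrightarrow> retract C Y Z \<Longrightarrow> retract C X Z"
  by (blast intro: retract_trans isomorphic_retract)+

lemma retract_mono_arr:
  assumes "i \<in> arr C" "p \<in> arr C" "src C p = tgt C i" "p \<cdot> i = ident C (src C i)"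
  shows "mono_arr C i"
  unfolding mono_arr_def
proof (intro conjI ballI impI assms)
  fix X f g assume "f \<in> hom_set C X (src C i)" "g \<in> hom_set C X (src C i)" "i \<cdot> f = i \<cdot> g"
  then have *: "f \<in> arr C" "g \<in> arr C" "tgt C f = src C i" "tgt C g = src C i" "i \<cdot> f = i \<cdot> g"
    by (auto simp: in_hom_iff)
  have "f = p \<cdot> i \<cdot> f" using * assms cmp_eq_assoc[OF assms(4), of f] by simp
  also have "\<dots> = p \<cdot> i \<cdot> g" using * by simp
  also have "\<dots> = g" using * assms cmp_eq_assoc[OF assms(4), of g] by simp
  finally show "f = g" .
qed

end

section \<open>Addition of arrows, zero objects and biproducts\<close>

context linear_category
begin

lemma zero_arr_simps [simp]:
  "\<lbrakk>X \<in> obj C; Y \<in> obj C\<rbrakk> \<Longrightarrow> zero_arr C X Y \<in> arr C"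
  "\<lbrakk>X \<in> obj C; Y \<in> obj C\<rbrakk> \<Longrightarrow> src C (zero_arr C X Y) = X"
  "\<lbrakk>X \<in> obj C; Y \<in> obj C\<rbrakk> \<Longrightarrow> tgt C (zero_arr C X Y) = Y"
  using zero_hom by (auto simp: in_hom_iff)

lemma plus_arr_simps [simp]:
  assumes "f \<in> arr C" "g \<in> arr C" "src C f = src C g" "tgt C f = tgt C g"
  shows "f \<boxplus> g \<in> arr C" "src C (f \<boxplus> g) = src C g" "tgt C (f \<boxplus> g) = tgt C g"
  using plus_hom[of f "src C g" "tgt C g" g] assms by (auto simp: in_hom_iff)

lemma scale_arr_simps [simp]:
  assumes "f \<in> arr C"
  shows "c \<odot>\<^sub>m f \<in> arr C" "src C (c \<odot>\<^sub>m f) = src C f" "tgt C (c \<odot>\<^sub>m f) = tgt C f"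
  using scale_hom[of f "src C f" "tgt C f" c] assms by (auto simp: in_hom_iff)

lemma plus_assoc_arr:
  "\<lbrakk>f \<in> arr C; g \<in> arr C; h \<in> arr C; src C f = src C g; tgt C f = tgt C g;
    src C g = src C h; tgt C g = tgt C h\<rbrakk> \<Longrightarrow> (f \<boxplus> g) \<boxplus> h = f \<boxplus> (g \<boxplus> h)"
  by (rule plus_assoc) (auto simp: in_hom_iff)

lemma plus_comm_arr:
  "\<lbrakk>f \<in> arr C; g \<in> arr C; src C f = src C g; tgt C f = tgt C g\<rbrakk> \<Longrightarrow> f \<boxplus> g = g \<boxplus> f"
  by (rule plus_comm) (auto simp: in_hom_iff)

lemma plus_left_comm_arr:
  assumes "f \<in> arr C" "g \<in> arr C" "h \<in> arr C" "src C f = src C g" "tgt C f = tgt C g"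
    "src C g = src C h" "tgt C g = tgt C h"
  shows "f \<boxplus> (g \<boxplus> h) = g \<boxplus> (f \<boxplus> h)"
  using assms plus_assoc_arr[of f g h] plus_assoc_arr[of g f h] plus_comm_arr[of f g] by simp

lemma plus_zero_arr [simp]:
  assumes "f \<in> arr C" "X = src C f" "Y = tgt C f"
  shows "f \<boxplus> zero_arr C X Y = f" "zero_arr C X Y \<boxplus> f = f"
proof -
  show "f \<boxplus> zero_arr C X Y = f"
    using assms by (intro plus_zero) (auto simp: in_hom_iff)
  moreover have "zero_arr C X Y \<boxplus> f = f \<boxplus> zero_arr C X Y"
    using assms by (intro plus_comm_arr) auto
  ultimately show "zero_arr C X Y \<boxplus> f = f" by (rule trans[rotated])
qed

lemma plus_left_cancel:
  assumes "f \<boxplus> g = f \<boxplus> h" "f \<in> hom_set C X Y" "g \<in> hom_set C X Y" "h \<in> hom_set C X Y"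
  shows "g = h"
proof -
  obtain k where k: "k \<in> hom_set C X Y" "f \<boxplus> k = zero_arr C X Y"
    using plus_inverse assms by blast
  have *: "k \<boxplus> f = zero_arr C X Y" using k assms plus_comm by metis
  have "k \<boxplus> (f \<boxplus> g) = g"
    using k assms * plus_assoc_arr[of k f g] by (auto simp: in_hom_iff)
  moreover have "k \<boxplus> (f \<boxplus> h) = h"
    using k assms * plus_assoc_arr[of k f h] by (auto simp: in_hom_iff)
  ultimately show ?thesis using assms(1) by metis
qed

lemma scale_zero [simp]:
  assumes "f \<in> arr C" shows "0 \<odot>\<^sub>m f = zero_arr C (src C f) (tgt C f)"
proof -
  have "0 \<odot>\<^sub>m f \<boxplus> 0 \<odot>\<^sub>m f = 0 \<odot>\<^sub>m f"
    using scale_add_left[of f "src C f" "tgt C f" 0 0] assms by (simp add: in_hom_iff)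
  then show ?thesis
    using assms plus_left_cancel[of "0 \<odot>\<^sub>m f" "0 \<odot>\<^sub>m f" "zero_arr C (src C f) (tgt C f)" "src C f" "tgt C f"]
    by (simp add: in_hom_iff)
qed

lemma plus_neg:
  assumes "f \<in> arr C" shows "f \<boxplus> (-1) \<odot>\<^sub>m f = zero_arr C (src C f) (tgt C f)"
  using scale_add_left[of f "src C f" "tgt C f" 1 "-1"] scale_one[of f "src C f" "tgt C f"] assms
  by (simp add: in_hom_iff)

lemma neg_eq_zero_imp_eq:
  assumes "f \<boxplus> (-1) \<odot>\<^sub>m g = zero_arr C X Y" "f \<in> hom_set C X Y" "g \<in> hom_set C X Y"
  shows "f = g"
proof -
  have "(-1) \<odot>\<^sub>m g \<boxplus> f = (-1) \<odot>\<^sub>m g \<boxplus> g"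
    using assms plus_neg[of g] plus_comm_arr[of "(-1) \<odot>\<^sub>m g" f] plus_comm_arr[of "(-1) \<odot>\<^sub>m g" g]
    by (simp add: in_hom_iff)
  then show ?thesis
    using assms by (elim plus_left_cancel) (auto simp: in_hom_iff)
qed

lemma cmp_scale_arr [simp]:
  "\<lbrakk>f \<in> arr C; g \<in> arr C; src C g = tgt C f\<rbrakk> \<Longrightarrow> (a \<odot>\<^sub>m g) \<cdot> f = a \<odot>\<^sub>m (g \<cdot> f)"
  "\<lbrakk>f \<in> arr C; g \<in> arr C; src C g = tgt C f\<rbrakk> \<Longrightarrow> g \<cdot> (a \<odot>\<^sub>m f) = a \<odot>\<^sub>m (g \<cdot> f)"
  by (rule cmp_scale_left cmp_scale_right; auto simp: in_hom_iff)+

lemma cmp_plus_arr [simp]: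
  "\<lbrakk>f \<in> arr C; g \<in> arr C; h \<in> arr C; src C g = tgt C f; src C h = tgt C f; tgt C g = tgt C h\<rbrakk>
    \<Longrightarrow> (g \<boxplus> h) \<cdot> f = (g \<cdot> f) \<boxplus> (h \<cdot> f)"
  "\<lbrakk>f \<in> arr C; g \<in> arr C; h \<in> arr C; src C f = src C g; tgt C f = src C h; tgt C g = src C h\<rbrakk>
    \<Longrightarrow> h \<cdot> (f \<boxplus> g) = (h \<cdot> f) \<boxplus> (h \<cdot> g)"
  by (rule cmp_plus_left cmp_plus_right; auto simp: in_hom_iff)+

text \<open>Absorption is not among the axioms of \<open>linear_category\<close>. A zero arrow
  equals 0 times itself, and the scalar 0 can be pulled out of the composite by bilinearity.\<close>

lemma cmp_zero [simp]:
  assumes "f \<in> arr C"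
  shows "\<lbrakk>X \<in> obj C; Y = src C f\<rbrakk> \<Longrightarrow> f \<cdot> zero_arr C X Y = zero_arr C X (tgt C f)"
    and "\<lbrakk>Z \<in> obj C; Y = tgt C f\<rbrakk> \<Longrightarrow> zero_arr C Y Z \<cdot> f = zero_arr C (src C f) Z"
proof -
  assume *: "X \<in> obj C" "Y = src C f"
  have "f \<cdot> (0 \<odot>\<^sub>m zero_arr C X Y) = 0 \<odot>\<^sub>m (f \<cdot> zero_arr C X Y)"
    using * assms by (intro cmp_scale_arr) auto
  then show "f \<cdot> zero_arr C X Y = zero_arr C X (tgt C f)"
    using * assms by simp
next
  assume *: "Z \<in> obj C" "Y = tgt C f"
  have "(0 \<odot>\<^sub>m zero_arr C Y Z) \<cdot> f = 0 \<odot>\<^sub>m (zero_arr C Y Z \<cdot> f)"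
    using * assms by (intro cmp_scale_arr) auto
  then show "zero_arr C Y Z \<cdot> f = zero_arr C (src C f) Z"
    using * assms by simp
qed

text \<open>Replaces a universal property by one equation between arrows, a form that passes easily
  to tensor products and to full subcategories.\<close>

lemma zero_object_iff: "zero_object C Z \<longleftrightarrow> Z \<in> obj C \<and> ident C Z = zero_arr C Z Z"
proof safe
  assume "zero_object C Z"
  then show "Z \<in> obj C" "ident C Z = zero_arr C Z Z"
    using ident_hom zero_hom unfolding zero_object_def by blast+
next
  assume Z: "Z \<in> obj C" "ident C Z = zero_arr C Z Z"
  have "f = zero_arr C X Z" if "f \<in> hom_set C X Z" "X \<in> obj C" for f X
    using cmp_ident(1)[of f Z] cmp_zero(2)[of f Z Z] that Z(1) unfolding Z(2)
    by (simp add: in_hom_iff del: cmp_zero)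
  moreover have "f = zero_arr C Z X" if "f \<in> hom_set C Z X" "X \<in> obj C" for f X
    using cmp_ident(2)[of f Z] cmp_zero(1)[of f Z Z] that Z(1) unfolding Z(2)
    by (simp add: in_hom_iff del: cmp_zero)
  ultimately show "zero_object C Z"
    using zero_hom Z unfolding zero_object_def by metis
qed

lemma zero_object_retract:
  assumes "retract C X Y" "zero_object C Y" shows "zero_object C X"
  using assms(1)
proof (rule retractE)
  fix i p
  assume *: "i \<in> arr C" "src C i = X" "tgt C i = Y" "p \<in> arr C" "src C p = Y" "tgt C p = X"
    "p \<cdot> i = ident C X"
  have "p \<cdot> ident C Y \<cdot> i = ident C X" using * by auto
  moreover have "p \<cdot> zero_arr C Y Y \<cdot> i = zero_arr C X X" using * by auto
  ultimately show "zero_object C X"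
    using assms(2) *(7) src_obj[OF *(1)] *(2) by (metis zero_object_iff)
qed

lemma biproductE:
  assumes "biproduct C Z X Y"
  obtains i j p q where "biproduct_arrs C Z X Y i j p q"
  using assms unfolding biproduct_def by blast

text \<open>The last five facts are the biproduct equations prolonged by an arrow \<open>x\<close>,
  as in \<open>cmp_eq_assoc\<close>. The very last one decomposes any arrow into \<open>Z\<close>
  and is the usual way to show that some component of a nonzero arrow is nonzero.\<close>

lemma biproduct_arrsD:
  assumes "biproduct_arrs C Z X Y i j p q"
  shows
    "i \<in> arr C" "src C i = X" "tgt C i = Z" "j \<in> arr C" "src C j = Y" "tgt C j = Z"
    "p \<in> arr C" "src C p = Z" "tgt C p = X" "q \<in> arr C" "src C q = Z" "tgt C q = Y"
    "X \<in> obj C" "Y \<in> obj C" "Z \<in> obj C"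
    "p \<cdot> i = ident C X" "q \<cdot> j = ident C Y" "p \<cdot> j = zero_arr C Y X" "q \<cdot> i = zero_arr C X Y"
    "(i \<cdot> p) \<boxplus> (j \<cdot> q) = ident C Z"
    "\<And>x. x \<in> arr C \<Longrightarrow> tgt C x = X \<Longrightarrow> p \<cdot> i \<cdot> x = x"
    "\<And>x. x \<in> arr C \<Longrightarrow> tgt C x = Y \<Longrightarrow> q \<cdot> j \<cdot> x = x"
    "\<And>x. x \<in> arr C \<Longrightarrow> tgt C x = Y \<Longrightarrow> p \<cdot> j \<cdot> x = zero_arr C (src C x) X"
    "\<And>x. x \<in> arr C \<Longrightarrow> tgt C x = X \<Longrightarrow> q \<cdot> i \<cdot> x = zero_arr C (src C x) Y"
    "\<And>x. x \<in> arr C \<Longrightarrow> tgt C x = Z \<Longrightarrow> (i \<cdot> p \<cdot> x) \<boxplus> (j \<cdot> q \<cdot> x) = x"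
proof -
  show *: "i \<in> arr C" "src C i = X" "tgt C i = Z" "j \<in> arr C" "src C j = Y" "tgt C j = Z"
    "p \<in> arr C" "src C p = Z" "tgt C p = X" "q \<in> arr C" "src C q = Z" "tgt C q = Y"
    "p \<cdot> i = ident C X" "q \<cdot> j = ident C Y" "p \<cdot> j = zero_arr C Y X" "q \<cdot> i = zero_arr C X Y"
    "(i \<cdot> p) \<boxplus> (j \<cdot> q) = ident C Z"
    using assms by (simp_all add: biproduct_arrs_def in_hom_iff)
  show o: "X \<in> obj C" "Y \<in> obj C" "Z \<in> obj C"
    using src_obj[OF *(1)] src_obj[OF *(4)] tgt_obj[OF *(1)] *(2,3,5) by simp_all
  fix x assume x: "x \<in> arr C"
  show "tgt C x = X \<Longrightarrow> p \<cdot> i \<cdot> x = x" "tgt C x = Y \<Longrightarrow> q \<cdot> j \<cdot> x = x"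
    "tgt C x = Y \<Longrightarrow> p \<cdot> j \<cdot> x = zero_arr C (src C x) X" "tgt C x = X \<Longrightarrow> q \<cdot> i \<cdot> x = zero_arr C (src C x) Y"
    using * o x by (simp_all add: cmp_eq_assoc[OF *(13)] cmp_eq_assoc[OF *(14)]
      cmp_eq_assoc[OF *(15)] cmp_eq_assoc[OF *(16)])
  assume xZ: "tgt C x = Z"
  have "((i \<cdot> p) \<boxplus> (j \<cdot> q)) \<cdot> x = x" using * x xZ by simp
  then show "(i \<cdot> p \<cdot> x) \<boxplus> (j \<cdot> q \<cdot> x) = x" using *(1-12) x xZ by simp
qed

lemma biproductI:
  assumes "i \<in> arr C" "src C i = X" "tgt C i = Z" "j \<in> arr C" "src C j = Y" "tgt C j = Z"
    "p \<in> arr C" "src C p = Z" "tgt C p = X" "q \<in> arr C" "src C q = Z" "tgt C q = Y"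
    "p \<cdot> i = ident C X" "q \<cdot> j = ident C Y" "p \<cdot> j = zero_arr C Y X" "q \<cdot> i = zero_arr C X Y"
    "(i \<cdot> p) \<boxplus> (j \<cdot> q) = ident C Z"
  shows "biproduct C Z X Y"
  unfolding biproduct_def biproduct_arrs_def in_hom_iff using assms by blast

lemma biproduct_obj:
  assumes "biproduct C Z X Y" shows "X \<in> obj C" "Y \<in> obj C" "Z \<in> obj C"
proof -
  obtain i j p q where b: "biproduct_arrs C Z X Y i j p q" using assms by (rule biproductE)
  show "X \<in> obj C" "Y \<in> obj C" "Z \<in> obj C" by (rule biproduct_arrsD[OF b])+
qed

lemma biproduct_retract:
  assumes "biproduct C Z X Y" shows "retract C X Z" "retract C Y Z"
  using assms by (auto simp: biproduct_def biproduct_arrs_def retract_def)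

lemma biproduct_comm:
  assumes "biproduct C Z X Y" shows "biproduct C Z Y X"
proof -
  obtain i j p q where b: "biproduct_arrs C Z X Y i j p q" using assms by (rule biproductE)
  note * = biproduct_arrsD[OF b]
  show ?thesis
    by (rule biproductI[of j _ _ i _ q p])
      (use * in \<open>simp_all add: plus_comm_arr[of "j \<cdot> q" "i \<cdot> p"]\<close>)
qed

text \<open>There is no chosen direct sum of two objects, so associativity is a statement about
  whichever objects happen to be biproducts of one another.\<close>

lemma biproduct_assoc:
  assumes "biproduct C X S P" "biproduct C P Y W" "biproduct C Z S Y"
  shows "biproduct C X Z W"
proof -
  obtain i1 j1 p1 q1 where b1: "biproduct_arrs C X S P i1 j1 p1 q1"
    using assms(1) by (rule biproductE)
  note 1 = biproduct_arrsD[OF b1]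
  obtain i2 j2 p2 q2 where b2: "biproduct_arrs C P Y W i2 j2 p2 q2"
    using assms(2) by (rule biproductE)
  note 2 = biproduct_arrsD[OF b2]
  obtain i3 j3 p3 q3 where b3: "biproduct_arrs C Z S Y i3 j3 p3 q3"
    using assms(3) by (rule biproductE)
  note 3 = biproduct_arrsD[OF b3]
  \<comment> \<open>From the summand \<open>S\<close> of \<open>Z\<close> the inclusion enters
    \<open>X\<close> directly, from the summand \<open>Y\<close> it passes through \<open>P\<close>;
    the projection retraces both ways.\<close>
  let ?I = "(i1 \<cdot> p3) \<boxplus> (j1 \<cdot> i2 \<cdot> q3)" and ?P = "(i3 \<cdot> p1) \<boxplus> (j3 \<cdot> p2 \<cdot> q1)"
  have e: "(j1 \<cdot> i2 \<cdot> p2 \<cdot> q1) \<boxplus> (j1 \<cdot> j2 \<cdot> q2 \<cdot> q1) = j1 \<cdot> q1"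
  proof -
    have "(i2 \<cdot> p2 \<cdot> q1) \<boxplus> (j2 \<cdot> q2 \<cdot> q1) = q1" using 2(25)[of q1] 1(10,12) by simp
    then have "j1 \<cdot> ((i2 \<cdot> p2 \<cdot> q1) \<boxplus> (j2 \<cdot> q2 \<cdot> q1)) = j1 \<cdot> q1" by simp
    then show ?thesis using 1 2(1-13) by simp
  qed
  show ?thesis
    by (rule biproductI[of ?I _ _ "j1 \<cdot> j2" _ ?P "q2 \<cdot> q1"])
      (use 1 2 3 e in \<open>simp_all add: plus_assoc_arr\<close>)
qed

text \<open>Moves a new summand \<open>S\<close> past the leading summand \<open>Y\<close>; this is
  the inductive step of \<open>is_direct_sum_update\<close>.\<close>

lemma biproduct_left_comm:
  assumes "biproduct C X S P" "biproduct C P Y W" "biproduct C V S W" "biproduct C U S Y"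
  shows "biproduct C X Y V"
proof -
  have "biproduct C X U W" by (rule biproduct_assoc[OF assms(1,2,4)])
  then have "biproduct C X W U" by (rule biproduct_comm)
  then have "biproduct C X V Y"
    using assms(3,4) by (blast intro: biproduct_assoc biproduct_comm)
  then show ?thesis by (rule biproduct_comm)
qed

end

section \<open>Direct sums\<close>

context small_category
begin

lemma mono_arrD:
  assumes "mono_arr C m" "f \<in> arr C" "g \<in> arr C" "tgt C f = src C m" "tgt C g = src C m"
    "src C f = src C g" "m \<cdot> f = m \<cdot> g"
  shows "f = g"
proof -
  have "src C g \<in> obj C" "f \<in> hom_set C (src C g) (src C m)" "g \<in> hom_set C (src C g) (src C m)"
    using assms(2-6) by (simp_all add: in_hom_iff)
  with assms(1,7) show ?thesis unfolding mono_arr_def by blast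
qed

lemma epi_arrD:
  assumes "epi_arr C e" "f \<in> arr C" "g \<in> arr C" "src C f = tgt C e" "src C g = tgt C e"
    "tgt C f = tgt C g" "f \<cdot> e = g \<cdot> e"
  shows "f = g"
proof -
  have "tgt C g \<in> obj C" "f \<in> hom_set C (tgt C e) (tgt C g)" "g \<in> hom_set C (tgt C e) (tgt C g)"
    using assms(2-6) by (simp_all add: in_hom_iff)
  with assms(1,7) show ?thesis unfolding epi_arr_def by blast
qed

end

context linear_category
begin

lemma neg_zero_arr [simp]:
  assumes "U \<in> obj C" "V \<in> obj C" shows "(- 1) \<odot>\<^sub>m zero_arr C U V = zero_arr C U V"
proof -
  have "(-1) \<odot>\<^sub>m (0 \<odot>\<^sub>m zero_arr C U V) = (-1 * 0) \<odot>\<^sub>m zero_arr C U V"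
    using zero_hom[OF assms] by (rule scale_scale)
  then show ?thesis using assms by simp
qed

lemma sum_arrs_simps:
  "sum_arrs C X Y [] = zero_arr C X Y"
  "sum_arrs C X Y (f # fs) = f \<boxplus> sum_arrs C X Y fs"
  by (simp_all add: sum_arrs_def)

lemma sum_arrs_hom:
  assumes "X \<in> obj C" "Y \<in> obj C" "set fs \<subseteq> hom_set C X Y"
  shows "sum_arrs C X Y fs \<in> hom_set C X Y"
  using assms(3) by (induction fs) (use assms in \<open>auto simp: sum_arrs_simps in_hom_iff\<close>)

lemma cmp_sum_arrs:
  assumes "X \<in> obj C" "Y \<in> obj C" "set fs \<subseteq> hom_set C X Y" "h \<in> hom_set C Y Z"
  shows "h \<cdot> sum_arrs C X Y fs = sum_arrs C X Z (map (\<lambda>f. h \<cdot> f) fs)"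
  using assms(3)
proof (induction fs)
  case Nil
  then show ?case using assms by (auto simp: sum_arrs_simps in_hom_iff)
next
  case (Cons f fs)
  then show ?case
    using assms sum_arrs_hom[of X Y fs] by (auto simp: sum_arrs_simps in_hom_iff)
qed

lemma sum_arrs_cmp:
  assumes "X \<in> obj C" "Y \<in> obj C" "set fs \<subseteq> hom_set C X Y" "h \<in> hom_set C W X"
  shows "sum_arrs C X Y fs \<cdot> h = sum_arrs C W Y (map (\<lambda>f. f \<cdot> h) fs)"
  using assms(3)
proof (induction fs)
  case Nil
  then show ?case using assms by (auto simp: sum_arrs_simps in_hom_iff)
next
  case (Cons f fs)
  then show ?case
    using assms sum_arrs_hom[of X Y fs] by (auto simp: sum_arrs_simps in_hom_iff)
qed

lemma is_direct_sumE:
  assumes "is_direct_sum C S Xs"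
  obtains \<iota> \<pi> where "S \<in> obj C" "set Xs \<subseteq> obj C"
    "\<forall>i < length Xs. \<iota> i \<in> arr C \<and> src C (\<iota> i) = Xs ! i \<and> tgt C (\<iota> i) = S"
    "\<forall>i < length Xs. \<pi> i \<in> arr C \<and> src C (\<pi> i) = S \<and> tgt C (\<pi> i) = Xs ! i"
    "\<forall>i < length Xs. \<forall>j < length Xs.
       \<pi> i \<cdot> \<iota> j = (if i = j then ident C (Xs ! i) else zero_arr C (Xs ! j) (Xs ! i))"
    "sum_arrs C S S (map (\<lambda>i. \<iota> i \<cdot> \<pi> i) [0..<length Xs]) = ident C S"
  using assms unfolding is_direct_sum_def in_hom_iff by blast

lemma is_direct_sumI:
  assumes "S \<in> obj C" "set Xs \<subseteq> obj C"
    "\<And>i. i < length Xs \<Longrightarrow> \<iota> i \<in> hom_set C (Xs ! i) S \<and> \<pi> i \<in> hom_set C S (Xs ! i)"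
    "\<And>i j. i < length Xs \<Longrightarrow> j < length Xs \<Longrightarrow>
       \<pi> i \<cdot> \<iota> j = (if i = j then ident C (Xs ! i) else zero_arr C (Xs ! j) (Xs ! i))"
    "sum_arrs C S S (map (\<lambda>i. \<iota> i \<cdot> \<pi> i) [0..<length Xs]) = ident C S"
  shows "is_direct_sum C S Xs"
  using assms unfolding is_direct_sum_def by blast

lemma is_direct_sum_retract:
  assumes "is_direct_sum C Z Xs" "X \<in> set Xs"
  shows "retract C X Z"
proof -
  obtain k where "k < length Xs" "X = Xs ! k" using assms by (auto simp: in_set_conv_nth)
  then show ?thesis
    using assms(1) by (auto simp: is_direct_sum_def intro: retractI)
qed

lemma is_direct_sum_Nil_iff: "is_direct_sum C Z [] \<longleftrightarrow> zero_object C Z"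
  by (auto simp: is_direct_sum_def sum_arrs_simps zero_object_iff)

lemma is_direct_sum_two_iff: "is_direct_sum C Z [X, Y] \<longleftrightarrow> biproduct C Z X Y"
proof
  have upt2: "[0..<length [X, Y]] = [0, 1]" by simp
  assume "is_direct_sum C Z [X, Y]"
  then obtain \<iota> \<pi> where "Z \<in> obj C" and XY: "set [X, Y] \<subseteq> obj C"
      and i: "\<forall>i < length [X, Y]. \<iota> i \<in> arr C \<and> src C (\<iota> i) = [X, Y] ! i \<and> tgt C (\<iota> i) = Z"
      and p: "\<forall>i < length [X, Y]. \<pi> i \<in> arr C \<and> src C (\<pi> i) = Z \<and> tgt C (\<pi> i) = [X, Y] ! i"
      and pi: "\<forall>i < length [X, Y]. \<forall>j < length [X, Y].
        \<pi> i \<cdot> \<iota> j = (if i = j then ident C ([X, Y] ! i) else zero_arr C ([X, Y] ! j) ([X, Y] ! i))"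
      and s: "sum_arrs C Z Z (map (\<lambda>i. \<iota> i \<cdot> \<pi> i) [0..<length [X, Y]]) = ident C Z"
    by (rule is_direct_sumE)
  have ip: "\<iota> 0 \<in> arr C" "src C (\<iota> 0) = X" "tgt C (\<iota> 0) = Z"
    "\<iota> 1 \<in> arr C" "src C (\<iota> 1) = Y" "tgt C (\<iota> 1) = Z"
    "\<pi> 0 \<in> arr C" "src C (\<pi> 0) = Z" "tgt C (\<pi> 0) = X"
    "\<pi> 1 \<in> arr C" "src C (\<pi> 1) = Z" "tgt C (\<pi> 1) = Y"
    using i p by (simp_all add: numeral_2_eq_2)
  have "\<iota> 0 \<cdot> \<pi> 0 \<boxplus> \<iota> 1 \<cdot> \<pi> 1 = ident C Z"
    using s ip unfolding upt2 by (simp add: sum_arrs_simps)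
  then show "biproduct C Z X Y"
    using ip pi by (intro biproductI[of "\<iota> 0" X Z "\<iota> 1" Y "\<pi> 0" "\<pi> 1"]) simp_all
next
  have upt2: "[0..<length [X, Y]] = [0, 1]" by simp
  assume "biproduct C Z X Y"
  then obtain i j p q where b: "biproduct_arrs C Z X Y i j p q"
    by (rule biproductE)
  note * = biproduct_arrsD[OF b]
  have less2: "k < length [X, Y] \<longleftrightarrow> k = 0 \<or> k = Suc 0" for k by auto
  let ?I = "\<lambda>k::nat. if k = 0 then i else j" and ?P = "\<lambda>k::nat. if k = 0 then p else q"
  show "is_direct_sum C Z [X, Y]"
  proof (rule is_direct_sumI[of _ _ ?I ?P])
    show "sum_arrs C Z Z (map (\<lambda>i. ?I i \<cdot> ?P i) [0..<length [X, Y]]) = ident C Z"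
      using * unfolding upt2 by (simp add: sum_arrs_simps)
  next
    fix k assume "k < length [X, Y]"
    then show "?I k \<in> hom_set C ([X, Y] ! k) Z \<and> ?P k \<in> hom_set C Z ([X, Y] ! k)"
      using * unfolding less2 by (elim disjE) (simp_all add: in_hom_iff)
  next
    fix k l assume "k < length [X, Y]" "l < length [X, Y]"
    then show "?P k \<cdot> ?I l = (if k = l then ident C ([X, Y] ! k) else zero_arr C ([X, Y] ! l) ([X, Y] ! k))"
      using * unfolding less2 by (elim disjE) simp_all
  qed (use * in simp_all)
qed

text \<open>With \<open>is_direct_sum_ConsE\<close> this turns a definition by index functions into
  a recursion on the list, on which the later inductions over summands rest. The present direction
  holds in every linear category; the converse has to produce a complement and draws on
  kernels.\<close>

lemma is_direct_sum_ConsI: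
  assumes "biproduct C Z X W" "is_direct_sum C W Xs"
  shows "is_direct_sum C Z (X # Xs)"
proof -
  obtain i j p q where b1: "biproduct_arrs C Z X W i j p q"
    using assms(1) by (rule biproductE)
  note 1 = biproduct_arrsD[OF b1]
  obtain \<iota> \<pi> where "W \<in> obj C" and 2: "set Xs \<subseteq> obj C"
    "\<forall>k < length Xs. \<iota> k \<in> arr C \<and> src C (\<iota> k) = Xs ! k \<and> tgt C (\<iota> k) = W"
    "\<forall>k < length Xs. \<pi> k \<in> arr C \<and> src C (\<pi> k) = W \<and> tgt C (\<pi> k) = Xs ! k"
    "\<forall>i < length Xs. \<forall>j < length Xs.
       \<pi> i \<cdot> \<iota> j = (if i = j then ident C (Xs ! i) else zero_arr C (Xs ! j) (Xs ! i))"
    and s: "sum_arrs C W W (map (\<lambda>i. \<iota> i \<cdot> \<pi> i) [0..<length Xs]) = ident C W"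
    using assms(2) by (rule is_direct_sumE)
  have XsO: "k < length Xs \<Longrightarrow> Xs ! k \<in> obj C" for k using 2(1) by auto
  let ?I = "\<lambda>k. case k of 0 \<Rightarrow> i | Suc k \<Rightarrow> j \<cdot> \<iota> k" and ?P = "\<lambda>k. case k of 0 \<Rightarrow> p | Suc k \<Rightarrow> \<pi> k \<cdot> q"
  let ?L = "map (\<lambda>i. \<iota> i \<cdot> \<pi> i) [0..<length Xs]"
  have L: "set ?L \<subseteq> hom_set C W W" using 2 by (auto simp: in_hom_iff)
  have "j \<cdot> q = j \<cdot> sum_arrs C W W ?L \<cdot> q" using 1 s by simp
  also have "\<dots> = j \<cdot> sum_arrs C Z W (map (\<lambda>f. f \<cdot> q) ?L)"
    using sum_arrs_cmp[OF _ _ L, of q Z] 1(1-15) by (simp add: in_hom_iff)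
  also have "\<dots> = sum_arrs C Z Z (map (\<lambda>f. j \<cdot> f) (map (\<lambda>f. f \<cdot> q) ?L))"
    using 1(1-15) L by (intro cmp_sum_arrs) (auto simp: in_hom_iff)
  also have "map (\<lambda>f. j \<cdot> f) (map (\<lambda>f. f \<cdot> q) ?L) = map (\<lambda>k. ?I k \<cdot> ?P k) [Suc 0..<Suc (length Xs)]"
    using 1(1-15) 2 by (simp add: o_def del: upt_Suc flip: map_Suc_upt)
  finally have "sum_arrs C Z Z (map (\<lambda>k. ?I k \<cdot> ?P k) [0..<length (X # Xs)]) = ident C Z"
    using 1(20) by (simp add: sum_arrs_simps upt_conv_Cons del: upt_Suc)
  moreover have "?P k \<cdot> ?I l = (if k = l then ident C ((X # Xs) ! k) else zero_arr C ((X # Xs) ! l) ((X # Xs) ! k))"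
    if "k < length (X # Xs)" "l < length (X # Xs)" for k l
    using that 1(1-24) 2 XsO by (cases k; cases l) simp_all
  moreover have "?I k \<in> hom_set C ((X # Xs) ! k) Z \<and> ?P k \<in> hom_set C Z ((X # Xs) ! k)"
    if "k < length (X # Xs)" for k
    using that 1(1-15) 2 by (cases k) (auto simp: in_hom_iff)
  ultimately show ?thesis
    using 1 2(1) by (intro is_direct_sumI[of _ _ ?I ?P]) simp_all
qed

end

section \<open>Kernels, cokernels and complements of summands\<close>

context linear_abelian_category
begin

lemma is_kernelE:
  assumes "is_kernel C f i"
  obtains "f \<in> arr C" "i \<in> arr C" "tgt C i = src C f" "f \<cdot> i = zero_arr C (src C i) (tgt C f)"
    "\<And>h. h \<in> arr C \<Longrightarrow> tgt C h = src C f \<Longrightarrow> f \<cdot> h = zero_arr C (src C h) (tgt C f) \<Longrightarrow>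
      \<exists>u. u \<in> arr C \<and> src C u = src C h \<and> tgt C u = src C i \<and> i \<cdot> u = h"
    "mono_arr C i"
proof -
  have i: "f \<in> arr C" "i \<in> arr C" "tgt C i = src C f" "f \<cdot> i = zero_arr C (src C i) (tgt C f)"
    using assms by (auto simp: is_kernel_def)
  have u: "\<exists>!u. u \<in> hom_set C (src C h) (src C i) \<and> i \<cdot> u = h"
    if "h \<in> arr C" "tgt C h = src C f" "f \<cdot> h = zero_arr C (src C h) (tgt C f)" for h
    using assms that by (simp add: is_kernel_def)
  have "mono_arr C i"
    unfolding mono_arr_def
  proof (intro conjI ballI impI i)
    fix X g h assume *: "g \<in> hom_set C X (src C i)" "h \<in> hom_set C X (src C i)" "i \<cdot> g = i \<cdot> h"
    then have g: "g \<in> arr C" "tgt C g = src C i" "src C g = X" by (auto simp: in_hom_iff)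
    have "f \<cdot> i \<cdot> g = zero_arr C (src C (i \<cdot> g)) (tgt C f)"
      using i g by (simp add: cmp_eq_assoc[OF i(4)])
    from u[OF _ _ this] g i have "\<exists>!u. u \<in> hom_set C X (src C i) \<and> i \<cdot> u = i \<cdot> g" by simp
    then show "g = h" using * by metis
  qed
  moreover have "\<exists>u. u \<in> arr C \<and> src C u = src C h \<and> tgt C u = src C i \<and> i \<cdot> u = h"
    if "h \<in> arr C" "tgt C h = src C f" "f \<cdot> h = zero_arr C (src C h) (tgt C f)" for h
    using u[OF that] unfolding in_hom_iff by blast
  ultimately show thesis using i by (intro that) simp_all
qed

lemma is_cokernelE:
  assumes "is_cokernel C f p"
  obtains "f \<in> arr C" "p \<in> arr C" "src C p = tgt C f" "p \<cdot> f = zero_arr C (src C f) (tgt C p)"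
    "\<And>h. h \<in> arr C \<Longrightarrow> src C h = tgt C f \<Longrightarrow> h \<cdot> f = zero_arr C (src C f) (tgt C h) \<Longrightarrow>
      \<exists>u. u \<in> arr C \<and> src C u = tgt C p \<and> tgt C u = tgt C h \<and> u \<cdot> p = h"
    "epi_arr C p"
proof -
  have p: "f \<in> arr C" "p \<in> arr C" "src C p = tgt C f" "p \<cdot> f = zero_arr C (src C f) (tgt C p)"
    using assms by (auto simp: is_cokernel_def)
  have u: "\<exists>!u. u \<in> hom_set C (tgt C p) (tgt C h) \<and> u \<cdot> p = h"
    if "h \<in> arr C" "src C h = tgt C f" "h \<cdot> f = zero_arr C (src C f) (tgt C h)" for h
    using assms that by (simp add: is_cokernel_def)
  have "epi_arr C p"
    unfolding epi_arr_def
  proof (intro conjI ballI impI p)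
    fix X g h assume *: "g \<in> hom_set C (tgt C p) X" "h \<in> hom_set C (tgt C p) X" "g \<cdot> p = h \<cdot> p"
    then have g: "g \<in> arr C" "src C g = tgt C p" "tgt C g = X" by (auto simp: in_hom_iff)
    have "(g \<cdot> p) \<cdot> f = zero_arr C (src C f) (tgt C (g \<cdot> p))"
      using p g by simp
    from u[OF _ _ this] g p have "\<exists>!u. u \<in> hom_set C (tgt C p) X \<and> u \<cdot> p = g \<cdot> p" by simp
    then show "g = h" using * by metis
  qed
  moreover have "\<exists>u. u \<in> arr C \<and> src C u = tgt C p \<and> tgt C u = tgt C h \<and> u \<cdot> p = h"
    if "h \<in> arr C" "src C h = tgt C f" "h \<cdot> f = zero_arr C (src C f) (tgt C h)" for h
    using u[OF that] unfolding in_hom_iff by blast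
  ultimately show thesis using p by (intro that) simp_all
qed

lemma biproduct_ex:
  "X \<in> obj C \<Longrightarrow> Y \<in> obj C \<Longrightarrow> \<exists>Z. biproduct C Z X Y"
  using biproduct_exists is_direct_sum_two_iff by blast

text \<open>The complement is the kernel of the projection onto the first summand.\<close>

lemma is_direct_sum_ConsE:
  assumes "is_direct_sum C Z (X # Xs)"
  obtains W where "biproduct C Z X W" "is_direct_sum C W Xs"
proof -
  let ?n = "length Xs"
  obtain \<iota> \<pi> where 0: "Z \<in> obj C" "set (X # Xs) \<subseteq> obj C"
    "\<forall>k < length (X # Xs). \<iota> k \<in> arr C \<and> src C (\<iota> k) = (X # Xs) ! k \<and> tgt C (\<iota> k) = Z"
    "\<forall>k < length (X # Xs). \<pi> k \<in> arr C \<and> src C (\<pi> k) = Z \<and> tgt C (\<pi> k) = (X # Xs) ! k"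
    "\<forall>i < length (X # Xs). \<forall>j < length (X # Xs).
       \<pi> i \<cdot> \<iota> j = (if i = j then ident C ((X # Xs) ! i) else zero_arr C ((X # Xs) ! j) ((X # Xs) ! i))"
    and s: "sum_arrs C Z Z (map (\<lambda>i. \<iota> i \<cdot> \<pi> i) [0..<length (X # Xs)]) = ident C Z"
    using assms by (rule is_direct_sumE)
  have 1: "Z \<in> obj C" "X \<in> obj C" "set Xs \<subseteq> obj C"
    "\<And>k. k < Suc ?n \<Longrightarrow> \<iota> k \<in> arr C \<and> src C (\<iota> k) = (X # Xs) ! k \<and> tgt C (\<iota> k) = Z"
    "\<And>k. k < Suc ?n \<Longrightarrow> \<pi> k \<in> arr C \<and> src C (\<pi> k) = Z \<and> tgt C (\<pi> k) = (X # Xs) ! k"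
    "\<And>i j. i < Suc ?n \<Longrightarrow> j < Suc ?n \<Longrightarrow>
       \<pi> i \<cdot> \<iota> j = (if i = j then ident C ((X # Xs) ! i) else zero_arr C ((X # Xs) ! j) ((X # Xs) ! i))"
    using 0 by simp_all
  have XsO: "k < ?n \<Longrightarrow> Xs ! k \<in> obj C" for k using 1(3) by auto
  let ?i = "\<iota> 0" and ?p = "\<pi> 0"
  have ip: "?i \<in> arr C" "src C ?i = X" "tgt C ?i = Z" "?p \<in> arr C" "src C ?p = Z" "tgt C ?p = X"
    "?p \<cdot> ?i = ident C X"
    using 1(4-6)[of 0] 1(6)[of 0 0] by auto
  obtain k where k: "is_kernel C ?p k" using kernel_exists ip by blast
  define W where "W = src C k"
  have karr: "k \<in> arr C" "src C k = W" "tgt C k = Z" "W \<in> obj C" "?p \<cdot> k = zero_arr C W X"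
    and kfac: "\<And>h. h \<in> arr C \<Longrightarrow> tgt C h = Z \<Longrightarrow> ?p \<cdot> h = zero_arr C (src C h) X \<Longrightarrow>
      \<exists>u. u \<in> arr C \<and> src C u = src C h \<and> tgt C u = W \<and> k \<cdot> u = h"
    and kmon: "mono_arr C k"
    by (rule is_kernelE[OF k]; use ip in \<open>simp add: W_def\<close>)+
  \<comment> \<open>The projection complementary to the first summand. It is killed by
    \<open>?p\<close>, so it factors through the kernel as k after r, and r becomes the projection
    onto the complement.\<close>
  let ?e = "ident C Z \<boxplus> (-1) \<odot>\<^sub>m (?i \<cdot> ?p)"
  have ipe: "?p \<cdot> ?i \<cdot> x = x" if "x \<in> arr C" "tgt C x = X" for x
    using cmp_eq_assoc[OF ip(7), of x] that ip by simp
  have pe: "?p \<cdot> ?e = zero_arr C Z X"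
    using ip 1(1,2) ipe by (simp add: plus_neg)
  have e: "?e \<in> arr C" "src C ?e = Z" "tgt C ?e = Z" using ip 1(1) by auto
  then obtain r where r: "r \<in> arr C" "src C r = Z" "tgt C r = W" "k \<cdot> r = ?e"
    using kfac[OF e(1,3)] pe unfolding e by blast
  have kmono: "f = g" if "f \<in> hom_set C U W" "g \<in> hom_set C U W" "k \<cdot> f = k \<cdot> g" for f g U
    by (rule mono_arrD[OF kmon]) (use that karr in \<open>simp_all add: in_hom_iff\<close>)
  have pkx: "?p \<cdot> k \<cdot> x = zero_arr C (src C x) X" if "x \<in> arr C" "tgt C x = W" for x
    using cmp_eq_assoc[OF karr(5), of x] that karr ip 1 by simp
  have krx: "k \<cdot> r \<cdot> x = x \<boxplus> (-1) \<odot>\<^sub>m (?i \<cdot> ?p \<cdot> x)" if "x \<in> arr C" "tgt C x = Z" for x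
    using cmp_eq_assoc[OF r(4), of x] that karr ip 1(1,2) r by simp
  have rk: "r \<cdot> k = ident C W"
  proof (rule kmono)
    have "k \<cdot> r \<cdot> k = k \<boxplus> (-1) \<odot>\<^sub>m zero_arr C W Z"
      unfolding krx[OF karr(1,3)] karr(5) using ip karr by simp
    then show "k \<cdot> r \<cdot> k = k \<cdot> ident C W"
      using karr tgt_obj[OF karr(1)] by simp
  qed (use karr r in \<open>simp_all add: in_hom_iff\<close>)
  have ri: "r \<cdot> ?i = zero_arr C X W"
  proof (rule kmono)
    have "k \<cdot> r \<cdot> ?i = ?i \<boxplus> (-1) \<odot>\<^sub>m ?i"
      unfolding krx[OF ip(1,3)] ip(7) using ip(1,2) by simp
    then show "k \<cdot> r \<cdot> ?i = k \<cdot> zero_arr C X W"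
      using karr 1(2) ip(1-3) plus_neg[OF ip(1)] by simp
  qed (use karr r ip 1(2) in \<open>simp_all add: in_hom_iff\<close>)
  have sum: "?i \<cdot> ?p \<boxplus> k \<cdot> r = ident C Z"
  proof -
    have "?i \<cdot> ?p \<boxplus> (ident C Z \<boxplus> (-1) \<odot>\<^sub>m (?i \<cdot> ?p)) = ident C Z \<boxplus> (?i \<cdot> ?p \<boxplus> (-1) \<odot>\<^sub>m (?i \<cdot> ?p))"
      using ip 1(1) by (intro plus_left_comm_arr) simp_all
    also have "\<dots> = ident C Z"
      using ip 1(1) by (subst plus_neg) simp_all
    finally show ?thesis unfolding r(4) .
  qed
  have bip: "biproduct C Z X W"
    by (rule biproductI[of ?i _ _ k _ ?p r]) (use karr r ip rk ri sum in simp_all)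
  have rkx: "r \<cdot> k \<cdot> x = x" if "x \<in> arr C" "tgt C x = W" for x
    using cmp_eq_assoc[OF rk, of x] that karr r by simp
  let ?I = "\<lambda>l. r \<cdot> \<iota> (Suc l)" and ?P = "\<lambda>l. \<pi> (Suc l) \<cdot> k"
  have kr\<iota>: "k \<cdot> r \<cdot> \<iota> (Suc l) = \<iota> (Suc l)" if "l < ?n" for l
    using krx[of "\<iota> (Suc l)"] 1(4)[of "Suc l"] 1(6)[of 0 "Suc l"] that ip XsO 1(1,2) by simp
  have "?P a \<cdot> ?I b = (if a = b then ident C (Xs ! a) else zero_arr C (Xs ! b) (Xs ! a))"
    if "a < ?n" "b < ?n" for a b
    using 1(4)[of "Suc b"] 1(5)[of "Suc a"] 1(6)[of "Suc a" "Suc b"] that karr r kr\<iota> by simp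
  moreover have "?I l \<in> hom_set C (Xs ! l) W \<and> ?P l \<in> hom_set C W (Xs ! l)" if "l < ?n" for l
    using 1(4,5)[of "Suc l"] that karr r by (simp add: in_hom_iff)
  moreover have "sum_arrs C W W (map (\<lambda>l. ?I l \<cdot> ?P l) [0..<?n]) = ident C W"
  proof -
    let ?L = "map (\<lambda>l. \<iota> (Suc l) \<cdot> \<pi> (Suc l)) [0..<?n]"
    have L: "set ?L \<subseteq> hom_set C Z Z" using 1(4,5) by (auto simp: in_hom_iff)
    have "[0..<Suc ?n] = 0 # map Suc [0..<?n]" by (simp add: upt_conv_Cons map_Suc_upt del: upt_Suc)
    then have s': "?i \<cdot> ?p \<boxplus> sum_arrs C Z Z ?L = ident C Z"
      using s by (simp add: sum_arrs_simps o_def del: upt_Suc)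
    have Lh: "sum_arrs C Z Z ?L \<in> hom_set C Z Z" using L 1(1) by (intro sum_arrs_hom)
    \<comment> \<open>Both sides added to the first idempotent give the identity of
      \<open>Z\<close>, so cancellation identifies the remaining summands with the
      complement.\<close>
    have Le: "sum_arrs C Z Z ?L = k \<cdot> r"
      by (rule plus_left_cancel[of "?i \<cdot> ?p" _ _ Z Z]) (use s' sum Lh ip karr r in \<open>auto simp: in_hom_iff\<close>)
    have "r \<cdot> sum_arrs C Z Z ?L \<cdot> k = r \<cdot> sum_arrs C W Z (map (\<lambda>f. f \<cdot> k) ?L)"
      using sum_arrs_cmp[OF _ _ L, of k W] 1(1) karr by (simp add: in_hom_iff)
    also have "\<dots> = sum_arrs C W W (map (\<lambda>f. r \<cdot> f) (map (\<lambda>f. f \<cdot> k) ?L))"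
      using 1(1) karr r L by (intro cmp_sum_arrs) (auto simp: in_hom_iff)
    also have "map (\<lambda>f. r \<cdot> f) (map (\<lambda>f. f \<cdot> k) ?L) = map (\<lambda>l. ?I l \<cdot> ?P l) [0..<?n]"
      using 1(4,5) karr r by auto
    finally have "r \<cdot> (k \<cdot> r) \<cdot> k = sum_arrs C W W (map (\<lambda>l. ?I l \<cdot> ?P l) [0..<?n])"
      unfolding Le .
    moreover have "r \<cdot> (k \<cdot> r) \<cdot> k = ident C W" using karr r(1-3) rk rkx by simp
    ultimately show ?thesis by simp
  qed
  ultimately have "is_direct_sum C W Xs"
    using karr 1(3) by (intro is_direct_sumI[of _ _ ?I ?P]) simp_all
  with bip show thesis by (rule that)
qed

lemma is_direct_sum_Cons_iff:
  "is_direct_sum C Z (X # Xs) \<longleftrightarrow> (\<exists>W. biproduct C Z X W \<and> is_direct_sum C W Xs)"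
  by (meson is_direct_sum_ConsE is_direct_sum_ConsI)

end

section \<open>Tensor products and simple objects\<close>

context linear_monoidal_category
begin

lemma unit_obj_simp [simp]: "\<I> \<in> obj C" by (rule unit_obj)

lemma tensor_obj_simp [simp]: "\<lbrakk>X \<in> obj C; Y \<in> obj C\<rbrakk> \<Longrightarrow> X \<boxtimes>\<^sub>o Y \<in> obj C"
  by (rule tensor_obj)

lemma tensor_arr_simps [simp]:
  assumes "f \<in> arr C" "g \<in> arr C"
  shows "f \<boxtimes>\<^sub>m g \<in> arr C" "src C (f \<boxtimes>\<^sub>m g) = src C f \<boxtimes>\<^sub>o src C g"
    "tgt C (f \<boxtimes>\<^sub>m g) = tgt C f \<boxtimes>\<^sub>o tgt C g"
  using tensor_hom[of f "src C f" "tgt C f" g "src C g" "tgt C g"] assms by (simp_all add: in_hom_iff)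

lemma tensor_ident_simp [simp]:
  "\<lbrakk>X \<in> obj C; Y \<in> obj C\<rbrakk> \<Longrightarrow> ident C X \<boxtimes>\<^sub>m ident C Y = ident C (X \<boxtimes>\<^sub>o Y)"
  by (rule tensor_ident)

lemma interchange [simp]:
  "\<lbrakk>f \<in> arr C; f' \<in> arr C; g \<in> arr C; g' \<in> arr C; src C f' = tgt C f; src C g' = tgt C g\<rbrakk>
    \<Longrightarrow> (f' \<boxtimes>\<^sub>m g') \<cdot> (f \<boxtimes>\<^sub>m g) = (f' \<cdot> f) \<boxtimes>\<^sub>m (g' \<cdot> g)"
  by (rule tensor_cmp[symmetric]) (auto simp: in_hom_iff)

lemma tensor_zero_arr [simp]:
  assumes "X \<in> obj C" "Y \<in> obj C" "g \<in> arr C"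
  shows "zero_arr C X Y \<boxtimes>\<^sub>m g = zero_arr C (X \<boxtimes>\<^sub>o src C g) (Y \<boxtimes>\<^sub>o tgt C g)"
    "g \<boxtimes>\<^sub>m zero_arr C X Y = zero_arr C (src C g \<boxtimes>\<^sub>o X) (tgt C g \<boxtimes>\<^sub>o Y)"
proof -
  have "(0 \<odot>\<^sub>m zero_arr C X Y) \<boxtimes>\<^sub>m g = 0 \<odot>\<^sub>m (zero_arr C X Y \<boxtimes>\<^sub>m g)"
    using assms by (intro tensor_scale_left) (auto simp: in_hom_iff)
  then show "zero_arr C X Y \<boxtimes>\<^sub>m g = zero_arr C (X \<boxtimes>\<^sub>o src C g) (Y \<boxtimes>\<^sub>o tgt C g)"
    using assms by simp
  have "g \<boxtimes>\<^sub>m (0 \<odot>\<^sub>m zero_arr C X Y) = 0 \<odot>\<^sub>m (g \<boxtimes>\<^sub>m zero_arr C X Y)"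
    using assms by (intro tensor_scale_right) (auto simp: in_hom_iff)
  then show "g \<boxtimes>\<^sub>m zero_arr C X Y = zero_arr C (src C g \<boxtimes>\<^sub>o X) (tgt C g \<boxtimes>\<^sub>o Y)"
    using assms by simp
qed

lemma tensor_plus_arr:
  "\<lbrakk>f \<in> arr C; f' \<in> arr C; g \<in> arr C; src C f = src C f'; tgt C f = tgt C f'\<rbrakk>
    \<Longrightarrow> (f \<boxplus> f') \<boxtimes>\<^sub>m g = (f \<boxtimes>\<^sub>m g) \<boxplus> (f' \<boxtimes>\<^sub>m g)"
  "\<lbrakk>f \<in> arr C; f' \<in> arr C; g \<in> arr C; src C f = src C f'; tgt C f = tgt C f'\<rbrakk>
    \<Longrightarrow> g \<boxtimes>\<^sub>m (f \<boxplus> f') = (g \<boxtimes>\<^sub>m f) \<boxplus> (g \<boxtimes>\<^sub>m f')"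
  by (rule tensor_plus_left tensor_plus_right; simp add: in_hom_iff)+

lemma tensor_retract:
  assumes "retract C X X'" "retract C Y Y'"
  shows "retract C (X \<boxtimes>\<^sub>o Y) (X' \<boxtimes>\<^sub>o Y')"
proof -
  obtain i p where 1: "i \<in> arr C" "src C i = X" "tgt C i = X'" "p \<in> arr C" "src C p = X'" "tgt C p = X"
    "p \<cdot> i = ident C X" using assms(1) by (rule retractE)
  obtain j q where 2: "j \<in> arr C" "src C j = Y" "tgt C j = Y'" "q \<in> arr C" "src C q = Y'" "tgt C q = Y"
    "q \<cdot> j = ident C Y" using assms(2) by (rule retractE)
  show ?thesis
    using 1 2 retract_obj[OF assms(1)] retract_obj[OF assms(2)]
    by (intro retractI[of "i \<boxtimes>\<^sub>m j" _ _ "p \<boxtimes>\<^sub>m q"]) (simp_all add: in_hom_iff)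
qed

lemma tensor_isomorphic:
  assumes "isomorphic C X X'" "isomorphic C Y Y'"
  shows "isomorphic C (X \<boxtimes>\<^sub>o Y) (X' \<boxtimes>\<^sub>o Y')"
proof -
  obtain i p where 1: "i \<in> hom_set C X X'" "p \<in> hom_set C X' X"
    "p \<cdot> i = ident C X" "i \<cdot> p = ident C X'" using assms(1) by (rule isomorphicE)
  obtain j q where 2: "j \<in> hom_set C Y Y'" "q \<in> hom_set C Y' Y"
    "q \<cdot> j = ident C Y" "j \<cdot> q = ident C Y'" using assms(2) by (rule isomorphicE)
  show ?thesis
    using 1 2 isomorphic_obj[OF assms(1)] isomorphic_obj[OF assms(2)]
    by (intro isomorphicI[of "i \<boxtimes>\<^sub>m j" _ _ "p \<boxtimes>\<^sub>m q"]) (simp_all add: in_hom_iff)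
qed

lemma assoc_isomorphic:
  assumes "X \<in> obj C" "Y \<in> obj C" "Z \<in> obj C"
  shows "isomorphic C ((X \<boxtimes>\<^sub>o Y) \<boxtimes>\<^sub>o Z) (X \<boxtimes>\<^sub>o (Y \<boxtimes>\<^sub>o Z))"
  using iso_arr_isomorphic[OF assoc_iso[OF assms]] assoc_hom[OF assms] by (simp add: in_hom_iff)

lemma lunit_isomorphic: "X \<in> obj C \<Longrightarrow> isomorphic C (\<I> \<boxtimes>\<^sub>o X) X"
  using iso_arr_isomorphic[OF lunit_iso] lunit_hom by (simp add: in_hom_iff)

lemma runit_isomorphic: "X \<in> obj C \<Longrightarrow> isomorphic C (X \<boxtimes>\<^sub>o \<I>) X"
  using iso_arr_isomorphic[OF runit_iso] runit_hom by (simp add: in_hom_iff)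

lemma biproduct_tensor_left:
  assumes "biproduct C Z X Y" "W \<in> obj C"
  shows "biproduct C (W \<boxtimes>\<^sub>o Z) (W \<boxtimes>\<^sub>o X) (W \<boxtimes>\<^sub>o Y)"
proof -
  obtain i j p q where b: "biproduct_arrs C Z X Y i j p q"
    using assms(1) by (rule biproductE)
  note * = biproduct_arrsD[OF b]
  have s: "ident C W \<boxtimes>\<^sub>m (i \<cdot> p) \<boxplus> ident C W \<boxtimes>\<^sub>m (j \<cdot> q) = ident C (W \<boxtimes>\<^sub>o Z)"
    using tensor_plus_arr(2)[of "i \<cdot> p" "j \<cdot> q" "ident C W"] * assms(2) by simp
  let ?w = "ident C W"
  show ?thesis
    by (rule biproductI[of "?w \<boxtimes>\<^sub>m i" _ _ "?w \<boxtimes>\<^sub>m j" _ "?w \<boxtimes>\<^sub>m p" "?w \<boxtimes>\<^sub>m q"]) (use * s assms(2) in simp_all)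
qed

lemma biproduct_tensor_right:
  assumes "biproduct C Z X Y" "W \<in> obj C"
  shows "biproduct C (Z \<boxtimes>\<^sub>o W) (X \<boxtimes>\<^sub>o W) (Y \<boxtimes>\<^sub>o W)"
proof -
  obtain i j p q where b: "biproduct_arrs C Z X Y i j p q"
    using assms(1) by (rule biproductE)
  note * = biproduct_arrsD[OF b]
  let ?w = "ident C W"
  have s: "(i \<cdot> p) \<boxtimes>\<^sub>m ?w \<boxplus> (j \<cdot> q) \<boxtimes>\<^sub>m ?w = ident C (Z \<boxtimes>\<^sub>o W)"
    using tensor_plus_arr(1)[of "i \<cdot> p" "j \<cdot> q" "ident C W"] * assms(2) by simp
  show ?thesis
    by (rule biproductI[of "i \<boxtimes>\<^sub>m ?w" _ _ "j \<boxtimes>\<^sub>m ?w" _ "p \<boxtimes>\<^sub>m ?w" "q \<boxtimes>\<^sub>m ?w"]) (use * s assms(2) in simp_all)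
qed

lemma zero_object_tensor:
  assumes "zero_object C X" "Y \<in> obj C"
  shows "zero_object C (X \<boxtimes>\<^sub>o Y)" "zero_object C (Y \<boxtimes>\<^sub>o X)"
proof -
  have X: "X \<in> obj C" "ident C X = zero_arr C X X" using assms(1) by (simp_all add: zero_object_iff)
  have "ident C X \<boxtimes>\<^sub>m ident C Y = zero_arr C (X \<boxtimes>\<^sub>o Y) (X \<boxtimes>\<^sub>o Y)"
    "ident C Y \<boxtimes>\<^sub>m ident C X = zero_arr C (Y \<boxtimes>\<^sub>o X) (Y \<boxtimes>\<^sub>o X)"
    unfolding X(2) using X(1) assms(2) by simp_all
  then show "zero_object C (X \<boxtimes>\<^sub>o Y)" "zero_object C (Y \<boxtimes>\<^sub>o X)"
    using X(1) assms(2) by (simp_all add: zero_object_iff)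
qed

end

section \<open>Simple objects under retracts and isomorphisms\<close>

context linear_category
begin

lemma is_zero_arr_iso:
  assumes "iso_arr C i" "f \<in> arr C" "src C f = tgt C i" "f \<cdot> i = zero_arr C (src C i) (tgt C f)"
  shows "f = zero_arr C (src C f) (tgt C f)"
proof -
  obtain j where j: "j \<in> arr C" "src C j = tgt C i" "tgt C j = src C i" "i \<cdot> j = ident C (tgt C i)" "i \<in> arr C"
    using assms(1) by (auto simp: iso_arr_def inverse_arrs_def in_hom_iff)
  have "f = f \<cdot> i \<cdot> j" using j assms(2,3) by simp
  also have "\<dots> = zero_arr C (src C i) (tgt C f) \<cdot> j"
    using j(1,2,3,5) assms(2-4) by (intro cmp_eq_assoc) simp_all
  also have "\<dots> = zero_arr C (src C f) (tgt C f)" using j assms(2,3) by simp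
  finally show ?thesis .
qed

lemma zero_object_arr:
  assumes "f \<in> arr C" "zero_object C (src C f) \<or> zero_object C (tgt C f)"
  shows "f = zero_arr C (src C f) (tgt C f)"
  using assms(2)
proof
  assume "zero_object C (src C f)"
  then have e: "ident C (src C f) = zero_arr C (src C f) (src C f)" by (simp add: zero_object_iff)
  have "f = f \<cdot> ident C (src C f)" using assms by simp
  also have "\<dots> = zero_arr C (src C f) (tgt C f)" unfolding e using assms(1) by simp
  finally show ?thesis .
next
  assume "zero_object C (tgt C f)"
  then have e: "ident C (tgt C f) = zero_arr C (tgt C f) (tgt C f)" by (simp add: zero_object_iff)
  have "f = ident C (tgt C f) \<cdot> f" using assms by simp
  also have "\<dots> = zero_arr C (src C f) (tgt C f)" unfolding e using assms(1) by simp
  finally show ?thesis .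
qed

lemma simple_object_obj: "simple_object C X \<Longrightarrow> X \<in> obj C"
  by (simp add: simple_object_def)

lemma simple_object_nonzero: "simple_object C X \<Longrightarrow> \<not> zero_object C X"
  by (simp add: simple_object_def)

lemma retract_simple_isomorphic:
  assumes "retract C R S" "simple_object C S" "\<not> zero_object C R"
  shows "isomorphic C R S"
  using assms(1)
proof (rule retractE)
  fix i p assume *: "i \<in> arr C" "src C i = R" "tgt C i = S" "p \<in> arr C" "src C p = S" "tgt C p = R"
    "p \<cdot> i = ident C R"
  then have "mono_arr C i" by (intro retract_mono_arr[of i p]) simp_all
  with * assms have "iso_arr C i" by (auto simp: simple_object_def)
  with * show ?thesis using iso_arr_isomorphic by blast
qed

lemma isomorphic_zero_object: "isomorphic C X Y \<Longrightarrow> zero_object C X \<longleftrightarrow> zero_object C Y"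
  using isomorphic_retract isomorphic_sym zero_object_retract by blast

text \<open>Simplicity speaks about monos into the object. Those into \<open>Y\<close> become monos
  into \<open>X\<close> by composing with one half of the isomorphism, and an inverse found there is
  carried back by the other half.\<close>

lemma isomorphic_simple_object:
  assumes "isomorphic C X Y" "simple_object C X" shows "simple_object C Y"
  unfolding simple_object_def
proof (intro conjI allI impI)
  show "Y \<in> obj C" using assms(1) isomorphic_obj by blast
  show "\<not> zero_object C Y" using isomorphic_zero_object[OF assms(1)] assms(2) simple_object_nonzero by blast
  fix m assume m: "mono_arr C m \<and> tgt C m = Y"
  then have marr: "m \<in> arr C" by (simp add: mono_arr_def)
  obtain f g where fg: "f \<in> arr C" "src C f = X" "tgt C f = Y" "g \<in> arr C" "src C g = Y" "tgt C g = X"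
    "g \<cdot> f = ident C X" "f \<cdot> g = ident C Y" using assms(1) by (rule isomorphicE) (auto simp: in_hom_iff)
  have fgx: "f \<cdot> g \<cdot> x = x" if "x \<in> arr C" "tgt C x = Y" for x
    using cmp_eq_assoc[OF fg(8), of x] that fg by simp
  have "mono_arr C (g \<cdot> m)"
    unfolding mono_arr_def
  proof (intro conjI ballI impI)
    show "g \<cdot> m \<in> arr C" using fg m marr by simp
    fix U u v assume uv: "u \<in> hom_set C U (src C (g \<cdot> m))" "v \<in> hom_set C U (src C (g \<cdot> m))"
      "(g \<cdot> m) \<cdot> u = (g \<cdot> m) \<cdot> v"
    then have uv': "u \<in> arr C" "v \<in> arr C" "tgt C u = src C m" "tgt C v = src C m" "src C u = src C v"
      using fg m marr by (simp_all add: in_hom_iff)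
    have "f \<cdot> (g \<cdot> m) \<cdot> u = f \<cdot> (g \<cdot> m) \<cdot> v" using uv(3) by simp
    then have mm: "m \<cdot> u = m \<cdot> v" using fg(1-6) m marr uv' by (simp add: fgx)
    show "u = v" by (rule mono_arrD[of m]) (use m mm uv' in simp_all)
  qed
  then have "zero_object C (src C m) \<or> iso_arr C (g \<cdot> m)"
    using assms(2) fg m marr by (auto simp: simple_object_def)
  then show "zero_object C (src C m) \<or> iso_arr C m"
  proof
    assume "iso_arr C (g \<cdot> m)"
    then obtain h where h: "h \<in> arr C" "src C h = X" "tgt C h = src C m"
      "h \<cdot> g \<cdot> m = ident C (src C m)" "(g \<cdot> m) \<cdot> h = ident C X"
      using fg(1-6) m marr by (auto simp: iso_arr_def inverse_arrs_def in_hom_iff)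
    have "m \<cdot> h \<cdot> g = f \<cdot> ((g \<cdot> m) \<cdot> h) \<cdot> g" using fg(1-6) m marr h(1-3) by (simp add: fgx)
    also have "\<dots> = ident C Y" unfolding h(5) using fg by simp
    finally have "inverse_arrs C m (h \<cdot> g)"
      using fg(1-6) m marr h(1-4) by (simp add: inverse_arrs_def in_hom_iff)
    then show ?thesis by (auto simp: iso_arr_def)
  qed simp
qed

end

section \<open>Schur's lemma\<close>

context linear_abelian_category
begin

text \<open>If f does not distinguish g from h, the difference g - h factors through the zero kernel
  and vanishes.\<close>

lemma mono_if_kernel_zero:
  assumes "is_kernel C f i" "i = zero_arr C (src C i) (src C f)"
  shows "mono_arr C f"
  using assms(1)
proof (rule is_kernelE)
  assume f: "f \<in> arr C" and i: "i \<in> arr C"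
    and fac: "\<And>h. h \<in> arr C \<Longrightarrow> tgt C h = src C f \<Longrightarrow> f \<cdot> h = zero_arr C (src C h) (tgt C f) \<Longrightarrow>
      \<exists>u. u \<in> arr C \<and> src C u = src C h \<and> tgt C u = src C i \<and> i \<cdot> u = h"
  show ?thesis
    unfolding mono_arr_def
  proof (intro conjI ballI impI f)
    fix X g h assume "g \<in> hom_set C X (src C f)" "h \<in> hom_set C X (src C f)" and eq: "f \<cdot> g = f \<cdot> h"
    then have gh: "g \<in> arr C" "h \<in> arr C" "src C g = X" "src C h = X" "tgt C g = src C f" "tgt C h = src C f"
      by (simp_all add: in_hom_iff)
    let ?d = "g \<boxplus> (-1) \<odot>\<^sub>m h"
    have d: "?d \<in> arr C" "src C ?d = X" "tgt C ?d = src C f" using gh by simp_all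
    have "f \<cdot> ?d = f \<cdot> h \<boxplus> (-1) \<odot>\<^sub>m (f \<cdot> h)" using gh f eq by simp
    also have "\<dots> = zero_arr C (src C (f \<cdot> h)) (tgt C (f \<cdot> h))"
      using gh f by (intro plus_neg) simp
    finally have "f \<cdot> ?d = zero_arr C (src C ?d) (tgt C f)" using gh d f by simp
    from fac[OF d(1,3) this] obtain u where u: "u \<in> arr C" "src C u = X" "tgt C u = src C i" "i \<cdot> u = ?d"
      unfolding d by blast
    have "zero_arr C (src C i) (src C f) \<cdot> u = ?d" using u(4) assms(2) by simp
    then have "?d = zero_arr C X (src C f)" using u(1-3) f by simp
    then show "g = h" by (rule neg_eq_zero_imp_eq) (use gh in \<open>simp_all add: in_hom_iff\<close>)
  qed
qed

lemma simple_nonzero_mono: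
  assumes "simple_object C S" "f \<in> arr C" "src C f = S" "f \<noteq> zero_arr C S (tgt C f)"
  shows "mono_arr C f"
proof -
  obtain i where i: "is_kernel C f i" using kernel_exists assms(2) by blast
  have ia: "i \<in> arr C" "tgt C i = S" "f \<cdot> i = zero_arr C (src C i) (tgt C f)" "mono_arr C i"
    by (rule is_kernelE[OF i]; use assms(3) in simp)+
  have "\<not> iso_arr C i"
    using is_zero_arr_iso[of i f] ia assms by auto
  then have "zero_object C (src C i)"
    using ia assms(1) by (auto simp: simple_object_def)
  then show ?thesis
    using zero_object_arr[OF ia(1)] ia(2) assms(3) by (intro mono_if_kernel_zero[OF i]) simp
qed

text \<open>The kernel of a nonzero arrow out of \<open>S\<close> is zero, so the arrow is mono;
  simplicity of \<open>T\<close>, being phrased through monos, then makes it an isomorphism.\<close>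

lemma Schur:
  assumes "simple_object C S" "simple_object C T" "f \<in> arr C" "src C f = S" "tgt C f = T"
    "f \<noteq> zero_arr C S T"
  shows "\<exists>g. g \<in> arr C \<and> src C g = T \<and> tgt C g = S \<and> g \<cdot> f = ident C S \<and> f \<cdot> g = ident C T"
proof -
  have "mono_arr C f" using assms by (intro simple_nonzero_mono[of S]) simp_all
  then have "iso_arr C f"
    using assms simple_object_nonzero[of S] by (auto simp: simple_object_def)
  then show ?thesis using assms by (auto simp: iso_arr_def inverse_arrs_def in_hom_iff)
qed

text \<open>Some component of \<open>f\<close> into a simple summand is nonzero, hence invertible by
  \<open>Schur\<close>; its inverse after the projection is a retraction of
  \<open>f\<close>.\<close>

lemma simple_to_sum_split:
  assumes "simple_object C S" "\<forall>T \<in> set Xs. simple_object C T" "is_direct_sum C X Xs"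
    "f \<in> arr C" "src C f = S" "tgt C f = X" "f \<noteq> zero_arr C S X"
  shows "\<exists>q. q \<in> arr C \<and> src C q = X \<and> tgt C q = S \<and> q \<cdot> f = ident C S"
  using assms(2-)
proof (induction Xs arbitrary: X f)
  case Nil
  then show ?case using zero_object_arr[of f] by (auto simp: is_direct_sum_Nil_iff)
next
  case (Cons T Xs)
  obtain W where W: "biproduct C X T W" "is_direct_sum C W Xs"
    using Cons.prems(2) by (rule is_direct_sum_ConsE)
  obtain i j p q where b: "biproduct_arrs C X T W i j p q"
    using W(1) by (rule biproductE)
  note * = biproduct_arrsD[OF b]
  have S: "S \<in> obj C" using assms(1) by (rule simple_object_obj)
  consider "p \<cdot> f \<noteq> zero_arr C S T" | "q \<cdot> f \<noteq> zero_arr C S W"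
  proof (rule ccontr)
    assume "\<not> thesis"
    then have "p \<cdot> f = zero_arr C S T" "q \<cdot> f = zero_arr C S W" using that by blast+
    then have "i \<cdot> p \<cdot> f \<boxplus> j \<cdot> q \<cdot> f = zero_arr C S X" using *(1-15) S by simp
    then show False using *(25)[of f] Cons.prems(3,5,6) by simp
  qed
  then show ?case
  proof cases
    case 1
    then obtain g where "g \<in> arr C" "src C g = T" "tgt C g = S" "g \<cdot> p \<cdot> f = ident C S"
      using Schur[of S T "p \<cdot> f"] assms(1) Cons.prems * by auto
    then show ?thesis using * Cons.prems(3-5) by (intro exI[of _ "g \<cdot> p"]) simp
  next
    case 2
    then obtain r where "r \<in> arr C" "src C r = W" "tgt C r = S" "r \<cdot> q \<cdot> f = ident C S"
      using Cons.IH[of W "q \<cdot> f"] W Cons.prems * by auto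
    then show ?thesis using * Cons.prems(3-5) by (intro exI[of _ "r \<cdot> q"]) simp
  qed
qed

end

section \<open>Semisimplicity and duals\<close>

context fusion_category
begin

lemma simple_sum_ex:
  assumes "X \<in> obj C"
  obtains Xs where "\<forall>T \<in> set Xs. simple_object C T" "is_direct_sum C X Xs"
  using semisimple[OF assms] by blast

text \<open>Semisimplicity is given as the existence of decompositions into simple objects. This
  derives the splitting of monos from it, by induction on a decomposition S \<oplus> W of the
  source: a retraction on W is corrected by one on the part of the image of S that lies outside the
  image of W.\<close>

lemma mono_split:
  assumes "mono_arr C m"
  shows "\<exists>r. r \<in> arr C \<and> src C r = tgt C m \<and> tgt C r = src C m \<and> r \<cdot> m = ident C (src C m)"
proof -
  have *: "\<exists>r. r \<in> arr C \<and> src C r = tgt C m \<and> tgt C r = X \<and> r \<cdot> m = ident C X"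
    if "\<forall>T \<in> set Xs. simple_object C T" "is_direct_sum C X Xs" "mono_arr C m" "src C m = X" for Xs X m
    using that
  proof (induction Xs arbitrary: X m)
    case Nil
    then have "m \<in> arr C" "zero_object C X" by (simp_all add: mono_arr_def is_direct_sum_Nil_iff)
    with Nil(4) show ?case
      by (intro exI[of _ "zero_arr C (tgt C m) X"]) (auto simp: zero_object_iff)
  next
    case (Cons S Xs)
    obtain W where W: "biproduct C X S W" "is_direct_sum C W Xs"
      using Cons.prems(2) by (rule is_direct_sum_ConsE)
    obtain i j p q where b: "biproduct_arrs C X S W i j p q"
      using W(1) by (rule biproductE)
    note * = biproduct_arrsD[OF b]
    have S: "simple_object C S" using Cons.prems(1) by simp
    define Y where "Y = tgt C m"
    have m: "m \<in> arr C" "src C m = X" "tgt C m = Y" "mono_arr C m" "Y \<in> obj C"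
      using Cons.prems(3,4) by (simp_all add: mono_arr_def Y_def)
    have "mono_arr C (m \<cdot> j)"
      unfolding mono_arr_def
    proof (intro conjI ballI impI)
      show "m \<cdot> j \<in> arr C" using * m by simp
      fix U u v assume uv: "u \<in> hom_set C U (src C (m \<cdot> j))" "v \<in> hom_set C U (src C (m \<cdot> j))"
        "(m \<cdot> j) \<cdot> u = (m \<cdot> j) \<cdot> v"
      then have uv': "u \<in> arr C" "v \<in> arr C" "tgt C u = W" "tgt C v = W" "src C u = src C v"
        using * m by (simp_all add: in_hom_iff)
      have ju: "j \<cdot> u = j \<cdot> v" by (rule mono_arrD[of m]) (use uv uv' * m in simp_all)
      have "mono_arr C j" using * by (intro retract_mono_arr[of j q]) simp_all
      then show "u = v" by (rule mono_arrD) (use ju uv' * in simp_all)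
    qed
    then obtain r where r: "r \<in> arr C" "src C r = Y" "tgt C r = W" "r \<cdot> m \<cdot> j = ident C W"
      using Cons.IH[of W "m \<cdot> j"] Cons.prems(1) W(2) * m by auto
    \<comment> \<open>The idempotent 1 - m j r on the target; it kills the image of
      \<open>W\<close>.\<close>
    obtain e where e: "e \<in> arr C" "src C e = Y" "tgt C e = Y"
      and ex: "\<And>x. x \<in> arr C \<Longrightarrow> tgt C x = Y \<Longrightarrow> e \<cdot> x = x \<boxplus> (-1) \<odot>\<^sub>m (m \<cdot> j \<cdot> r \<cdot> x)"
    proof (rule that)
      let ?e = "ident C Y \<boxplus> (-1) \<odot>\<^sub>m (m \<cdot> j \<cdot> r)"
      show "?e \<in> arr C" "src C ?e = Y" "tgt C ?e = Y" using * m r by simp_all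
      show "?e \<cdot> x = x \<boxplus> (-1) \<odot>\<^sub>m (m \<cdot> j \<cdot> r \<cdot> x)" if "x \<in> arr C" "tgt C x = Y" for x
        using * m r that by simp
    qed
    have emj: "e \<cdot> m \<cdot> j = zero_arr C W Y"
    proof -
      have "e \<cdot> m \<cdot> j = m \<cdot> j \<boxplus> (-1) \<odot>\<^sub>m (m \<cdot> j)"
        using ex[of "m \<cdot> j"] * m r by simp
      also have "\<dots> = zero_arr C W Y" using plus_neg[of "m \<cdot> j"] * m by simp
      finally show ?thesis .
    qed
    \<comment> \<open>Otherwise \<open>S\<close> would lie in the image of \<open>W\<close>:
      cancelling m gives a factorisation of the inclusion i through j, against p i = 1 and p j =
      0.\<close>
    have "e \<cdot> m \<cdot> i \<noteq> zero_arr C S Y"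
    proof
      assume "e \<cdot> m \<cdot> i = zero_arr C S Y"
      then have "m \<cdot> i \<boxplus> (-1) \<odot>\<^sub>m (m \<cdot> j \<cdot> r \<cdot> m \<cdot> i) = zero_arr C S Y"
        using ex[of "m \<cdot> i"] * m by simp
      then have "m \<cdot> i = m \<cdot> j \<cdot> r \<cdot> m \<cdot> i"
        by (rule neg_eq_zero_imp_eq) (use * m r in \<open>simp_all add: in_hom_iff\<close>)
      then have i: "i = j \<cdot> r \<cdot> m \<cdot> i"
        by (intro mono_arrD[OF m(4), of i "j \<cdot> r \<cdot> m \<cdot> i"]) (use * m r in simp_all)
      have "p \<cdot> j \<cdot> r \<cdot> m \<cdot> i = zero_arr C S S"
        using * m r cmp_eq_assoc[OF *(18), of "r \<cdot> m \<cdot> i"] by simp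
      then have "ident C S = zero_arr C S S" using *(16) i by simp
      then show False using S *(13) by (simp add: simple_object_def zero_object_iff)
    qed
    moreover obtain Ys where "\<forall>T \<in> set Ys. simple_object C T" "is_direct_sum C Y Ys"
      by (rule simple_sum_ex[OF m(5)])
    ultimately obtain t where t: "t \<in> arr C" "src C t = Y" "tgt C t = S" "t \<cdot> e \<cdot> m \<cdot> i = ident C S"
      using simple_to_sum_split[OF S, of Ys Y "e \<cdot> m \<cdot> i"] e * m by auto
    \<comment> \<open>The \<open>S\<close>-component is t e. The \<open>W\<close>-component is r
      minus the value that r takes on the image of \<open>S\<close>, so that \<open>?R\<close> after
      m fixes both i and j.\<close>
    let ?R = "i \<cdot> t \<cdot> e \<boxplus> j \<cdot> (r \<boxplus> (-1) \<odot>\<^sub>m (r \<cdot> m \<cdot> i \<cdot> t \<cdot> e))"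
    have R: "?R \<in> arr C" "src C ?R = Y" "tgt C ?R = X" using * m r t e by simp_all
    have Rx: "?R \<cdot> x = i \<cdot> t \<cdot> e \<cdot> x \<boxplus> j \<cdot> (r \<cdot> x \<boxplus> (-1) \<odot>\<^sub>m (r \<cdot> m \<cdot> i \<cdot> t \<cdot> e \<cdot> x))"
      if "x \<in> arr C" "tgt C x = Y" for x
      using * m r t e that by simp
    have "?R \<cdot> m \<cdot> i = i \<boxplus> j \<cdot> (r \<cdot> m \<cdot> i \<boxplus> (-1) \<odot>\<^sub>m (r \<cdot> m \<cdot> i))"
      using Rx[of "m \<cdot> i"] t(4) * m r by simp
    also have "r \<cdot> m \<cdot> i \<boxplus> (-1) \<odot>\<^sub>m (r \<cdot> m \<cdot> i) = zero_arr C S W"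
      using plus_neg[of "r \<cdot> m \<cdot> i"] * m r by simp
    finally have Ri: "?R \<cdot> m \<cdot> i = i" using * by simp
    have Rj: "?R \<cdot> m \<cdot> j = j" using Rx[of "m \<cdot> j"] emj r(4) * m r(1-3) t(1-3) by simp
    have "?R \<cdot> m = (?R \<cdot> m) \<cdot> (i \<cdot> p \<boxplus> j \<cdot> q)" unfolding *(20) using R m by simp
    also have "\<dots> = (?R \<cdot> m) \<cdot> i \<cdot> p \<boxplus> (?R \<cdot> m) \<cdot> j \<cdot> q"
      using R m *(1-15) by (intro cmp_plus_arr) (simp_all del: cmp_assoc_arr cmp_plus_arr)
    also have "(?R \<cdot> m) \<cdot> i \<cdot> p = (?R \<cdot> m \<cdot> i) \<cdot> p"
      using R m *(1-15) by (simp del: cmp_plus_arr)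
    also have "(?R \<cdot> m) \<cdot> j \<cdot> q = (?R \<cdot> m \<cdot> j) \<cdot> q"
      using R m *(1-15) by (simp del: cmp_plus_arr)
    finally have "?R \<cdot> m = ident C X" unfolding Ri Rj *(20) .
    with R show ?case unfolding m(3) by (intro exI[of _ ?R] conjI)
  qed
  have "src C m \<in> obj C" using assms by (simp add: mono_arr_def)
  then obtain Xs where "\<forall>T \<in> set Xs. simple_object C T" "is_direct_sum C (src C m) Xs"
    by (rule simple_sum_ex)
  then show ?thesis using assms refl by (rule *)
qed

lemma mono_retract:
  assumes "mono_arr C m" shows "retract C (src C m) (tgt C m)"
  using mono_split[OF assms] assms by (auto intro!: retractI[of m] simp: in_hom_iff mono_arr_def)

text \<open>A complement of the kernel of \<open>e\<close> is a section of \<open>e\<close>.\<close>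

lemma epi_split:
  assumes "epi_arr C e"
  shows "\<exists>s. s \<in> arr C \<and> src C s = tgt C e \<and> tgt C s = src C e \<and> e \<cdot> s = ident C (tgt C e)"
proof -
  have e: "e \<in> arr C" using assms by (simp add: epi_arr_def)
  obtain f where f: "is_cokernel C f e" using epi_is_cokernel[OF assms] by blast
  have fa: "f \<in> arr C" "tgt C f = src C e" "e \<cdot> f = zero_arr C (src C f) (tgt C e)"
    and cofac: "\<And>h. h \<in> arr C \<Longrightarrow> src C h = tgt C f \<Longrightarrow> h \<cdot> f = zero_arr C (src C f) (tgt C h) \<Longrightarrow>
      \<exists>u. u \<in> arr C \<and> src C u = tgt C e \<and> tgt C u = tgt C h \<and> u \<cdot> e = h"
    by (rule is_cokernelE[OF f]; simp)+
  obtain k where k: "is_kernel C e k" using kernel_exists[OF e] by blast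
  have ka: "k \<in> arr C" "tgt C k = src C e" "e \<cdot> k = zero_arr C (src C k) (tgt C e)" "mono_arr C k"
    and fac: "\<And>h. h \<in> arr C \<Longrightarrow> tgt C h = src C e \<Longrightarrow> e \<cdot> h = zero_arr C (src C h) (tgt C e) \<Longrightarrow>
      \<exists>u. u \<in> arr C \<and> src C u = src C h \<and> tgt C u = src C k \<and> k \<cdot> u = h"
    by (rule is_kernelE[OF k]; simp)+
  obtain r where r: "r \<in> arr C" "src C r = src C e" "tgt C r = src C k" "r \<cdot> k = ident C (src C k)"
    using mono_split[OF ka(4)] ka(2) by auto
  obtain u where u: "u \<in> arr C" "src C u = src C f" "tgt C u = src C k" "k \<cdot> u = f"
    using fac[OF fa] by blast
  let ?E = "ident C (src C e) \<boxplus> (-1) \<odot>\<^sub>m (k \<cdot> r)"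
  have E: "?E \<in> arr C" "src C ?E = src C e" "tgt C ?E = src C e" using e ka r by simp_all
  have "r \<cdot> f = u" unfolding u(4)[symmetric] using u(1-3) ka r cmp_eq_assoc[OF r(4), of u] by simp
  then have "?E \<cdot> f = f \<boxplus> (-1) \<odot>\<^sub>m f" using e ka r fa u(4) by simp
  also have "\<dots> = zero_arr C (src C f) (tgt C ?E)" unfolding E using plus_neg[OF fa(1)] fa(2) by simp
  finally obtain s where s: "s \<in> arr C" "src C s = tgt C e" "tgt C s = src C e" "s \<cdot> e = ?E"
    using cofac[OF E(1)] E fa(2) by auto
  have "e \<cdot> s \<cdot> e = e"
    unfolding s(4) using e ka r cmp_eq_assoc[OF ka(3), of r] by simp
  then have "e \<cdot> s = ident C (tgt C e)"
    by (intro epi_arrD[OF assms, of "e \<cdot> s" "ident C (tgt C e)"]) (use e s in simp_all)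
  with s show ?thesis by blast
qed

lemma epi_retract:
  assumes "epi_arr C e" shows "retract C (tgt C e) (src C e)"
  using epi_split[OF assms] assms by (auto intro!: retractI[of _ _ _ e] simp: in_hom_iff epi_arr_def)

lemma simple_nonzero_retract:
  assumes "simple_object C S" "f \<in> arr C" "f \<noteq> zero_arr C (src C f) (tgt C f)" "src C f = S"
  shows "retract C S (tgt C f)"
  using mono_retract[OF simple_nonzero_mono[of S f]] assms by simp

lemma simple_retract_ex:
  assumes "X \<in> obj C" "\<not> zero_object C X"
  obtains S where "simple_object C S" "retract C S X"
proof -
  obtain Xs where Xs: "\<forall>T \<in> set Xs. simple_object C T" "is_direct_sum C X Xs"
    by (rule simple_sum_ex[OF assms(1)])
  moreover have "Xs \<noteq> []" using Xs(2) assms(2) by (auto simp: is_direct_sum_Nil_iff)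
  ultimately show thesis
    using that[of "hd Xs"] is_direct_sum_retract[OF Xs(2), of "hd Xs"] by auto
qed

lemma simple_retract_nonzero:
  "\<lbrakk>simple_object C S; retract C S X\<rbrakk> \<Longrightarrow> \<not> zero_object C X"
  using zero_object_retract simple_object_nonzero by blast

lemma simple_retract_isomorphic:
  "\<lbrakk>simple_object C S; simple_object C T; retract C S T\<rbrakk> \<Longrightarrow> isomorphic C S T"
  using retract_simple_isomorphic simple_object_nonzero by blast

text \<open>Restrict the arrow to the summands of a decomposition of its source; a simple summand on
  which it is nonzero embeds into the target and splits off there. Applied to graded components,
  this gives the vanishing of arrows between different degrees.\<close>

lemma nonzero_arr_common_retract:
  assumes "f \<in> arr C" "f \<noteq> zero_arr C (src C f) (tgt C f)"
  obtains S where "simple_object C S" "retract C S (src C f)" "retract C S (tgt C f)"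
proof -
  have *: "\<exists>S. simple_object C S \<and> retract C S X \<and> retract C S Y"
    if "is_direct_sum C X Xs" "\<forall>T \<in> set Xs. simple_object C T" "g \<in> arr C" "src C g = X" "tgt C g = Y"
      "g \<noteq> zero_arr C X Y" for Xs X Y g
    using that
  proof (induction Xs arbitrary: X g)
    case Nil
    then show ?case using zero_object_arr[of g] by (auto simp: is_direct_sum_Nil_iff)
  next
    case (Cons S Xs)
    obtain W where W: "biproduct C X S W" "is_direct_sum C W Xs"
      using Cons.prems(1) by (rule is_direct_sum_ConsE)
    obtain i j p q where b: "biproduct_arrs C X S W i j p q"
    using W(1) by (rule biproductE)
  note * = biproduct_arrsD[OF b]
    have Y: "Y \<in> obj C" using Cons.prems(3,5) by auto
    consider "g \<cdot> i \<noteq> zero_arr C S Y" | "g \<cdot> j \<noteq> zero_arr C W Y"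
    proof (rule ccontr)
      assume "\<not> thesis"
      then have z: "g \<cdot> i = zero_arr C S Y" "g \<cdot> j = zero_arr C W Y" using that by blast+
      have "g = g \<cdot> ((i \<cdot> p) \<boxplus> (j \<cdot> q))" unfolding *(20) using Cons.prems by simp
      also have "\<dots> = g \<cdot> i \<cdot> p \<boxplus> g \<cdot> j \<cdot> q" using *(1-15) Cons.prems(3,4) by simp
      also have "\<dots> = zero_arr C X Y"
        using *(1-15) Cons.prems(3,4,5) Y cmp_eq_assoc[OF z(1), of p] cmp_eq_assoc[OF z(2), of q] by simp
      finally show False using Cons.prems(6) by simp
    qed
    then show ?case
    proof cases
      case 1
      have "retract C S Y"
        using simple_nonzero_retract[of S "g \<cdot> i"] 1 Cons.prems(2-5) * by simp
      then show ?thesis using Cons.prems(2) biproduct_retract(1)[OF W(1)] by auto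
    next
      case 2
      then obtain T where "simple_object C T" "retract C T W" "retract C T Y"
        using Cons.IH[of W "g \<cdot> j"] W(2) Cons.prems(2-5) * by auto
      then show ?thesis using retract_trans[OF _ biproduct_retract(2)[OF W(1)]] by blast
    qed
  qed
  obtain Xs where "\<forall>T \<in> set Xs. simple_object C T" "is_direct_sum C (src C f) Xs"
    by (rule simple_sum_ex[OF src_obj[OF assms(1)]])
  from *[OF this(2,1) assms(1) refl refl assms(2)] show thesis using that by blast
qed

lemma nonzero_to_simple_retract:
  assumes "simple_object C S" "f \<in> arr C" "f \<noteq> zero_arr C (src C f) (tgt C f)" "tgt C f = S"
  shows "retract C S (src C f)"
proof -
  obtain T where T: "simple_object C T" "retract C T (src C f)" "retract C T (tgt C f)"
    using assms(2,3) by (rule nonzero_arr_common_retract)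
  then have "isomorphic C S T"
    using assms(1,4) simple_retract_isomorphic isomorphic_sym by blast
  then show ?thesis using T(2) by (rule retract_isomorphic)
qed

text \<open>One component of the inclusion of \<open>S\<close> is nonzero and therefore split. This
  takes the place of uniqueness of decompositions: no multiplicity is ever compared.\<close>

lemma simple_retract_biproduct:
  assumes "simple_object C S" "retract C S Z" "biproduct C Z X Y"
  shows "retract C S X \<or> retract C S Y"
proof -
  obtain k l where k: "k \<in> arr C" "src C k = S" "tgt C k = Z" "l \<in> arr C" "src C l = Z" "tgt C l = S"
    "l \<cdot> k = ident C S" using assms(2) by (rule retractE)
  obtain i j p q where b: "biproduct_arrs C Z X Y i j p q"
    using assms(3) by (rule biproductE)
  note * = biproduct_arrsD[OF b]
  have S: "S \<in> obj C" using assms(1) by (rule simple_object_obj)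
  consider "p \<cdot> k \<noteq> zero_arr C S X" | "q \<cdot> k \<noteq> zero_arr C S Y"
  proof (rule ccontr)
    assume "\<not> thesis"
    then have "p \<cdot> k = zero_arr C S X" "q \<cdot> k = zero_arr C S Y" using that by blast+
    then have "i \<cdot> p \<cdot> k \<boxplus> j \<cdot> q \<cdot> k = zero_arr C S Z" using *(1-15) S by simp
    then have "k = zero_arr C S Z" using *(25)[of k] k by simp
    then have "ident C S = zero_arr C S S" using k(4-7) S by simp
    then show False using simple_object_nonzero[OF assms(1)] S by (simp add: zero_object_iff)
  qed
  then show ?thesis
    using simple_nonzero_retract[OF assms(1), of "p \<cdot> k"]
      simple_nonzero_retract[OF assms(1), of "q \<cdot> k"] k * by cases simp_all
qed

lemma simple_retract_sum:
  assumes "simple_object C S" "retract C S Z" "is_direct_sum C Z Xs"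
  shows "\<exists>X \<in> set Xs. retract C S X"
  using assms(2,3)
proof (induction Xs arbitrary: Z)
  case Nil
  then show ?case using simple_retract_nonzero assms(1) by (auto simp: is_direct_sum_Nil_iff)
next
  case (Cons X Xs)
  then show ?case
    using simple_retract_biproduct[OF assms(1)] unfolding is_direct_sum_Cons_iff by fastforce
qed

text \<open>The tensor product distributes over a decomposition of the first factor, so a simple
  constituent already occurs over one simple summand. With the mirrored lemma below, arguments about
  arbitrary objects reduce to pairs of simple ones.\<close>

lemma simple_retract_tensor_left:
  assumes "simple_object C S" "retract C S (X \<boxtimes>\<^sub>o Y)" "X \<in> obj C" "Y \<in> obj C"
  obtains T where "simple_object C T" "retract C T X" "retract C S (T \<boxtimes>\<^sub>o Y)"
proof -
  obtain Xs where Xs: "\<forall>T \<in> set Xs. simple_object C T" "is_direct_sum C X Xs"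
    by (rule simple_sum_ex[OF assms(3)])
  have "\<exists>T \<in> set Xs. retract C S (T \<boxtimes>\<^sub>o Y)"
    using Xs(2) assms(2)
  proof (induction Xs arbitrary: X)
    case Nil
    then show ?case
      using simple_retract_nonzero assms(1,4) zero_object_tensor(1) by (auto simp: is_direct_sum_Nil_iff)
  next
    case (Cons T Xs)
    then obtain W where W: "biproduct C X T W" "is_direct_sum C W Xs"
      unfolding is_direct_sum_Cons_iff by blast
    from simple_retract_biproduct[OF assms(1) Cons.prems(2) biproduct_tensor_right[OF W(1) assms(4)]]
    show ?case using Cons.IH[OF W(2)] by auto
  qed
  then show thesis using that Xs is_direct_sum_retract by blast
qed

lemma simple_retract_tensor_right:
  assumes "simple_object C S" "retract C S (Y \<boxtimes>\<^sub>o X)" "X \<in> obj C" "Y \<in> obj C"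
  obtains T where "simple_object C T" "retract C T X" "retract C S (Y \<boxtimes>\<^sub>o T)"
proof -
  obtain Xs where Xs: "\<forall>T \<in> set Xs. simple_object C T" "is_direct_sum C X Xs"
    by (rule simple_sum_ex[OF assms(3)])
  have "\<exists>T \<in> set Xs. retract C S (Y \<boxtimes>\<^sub>o T)"
    using Xs(2) assms(2)
  proof (induction Xs arbitrary: X)
    case Nil
    then show ?case
      using simple_retract_nonzero assms(1,4) zero_object_tensor(2) by (auto simp: is_direct_sum_Nil_iff)
  next
    case (Cons T Xs)
    then obtain W where W: "biproduct C X T W" "is_direct_sum C W Xs"
      unfolding is_direct_sum_Cons_iff by blast
    from simple_retract_biproduct[OF assms(1) Cons.prems(2) biproduct_tensor_left[OF W(1) assms(4)]]
    show ?case using Cons.IH[OF W(2)] by auto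
  qed
  then show thesis using that Xs is_direct_sum_retract by blast
qed

lemma abelian_subcategory_retract:
  assumes "abelian_subcategory C A" "retract C X Y" "Y \<in> A" shows "X \<in> A"
proof -
  obtain i p where *: "i \<in> arr C" "src C i = X" "tgt C i = Y" "p \<in> arr C" "src C p = Y" "tgt C p = X"
    "p \<cdot> i = ident C X" using assms(2) by (rule retractE)
  then have "mono_arr C i" by (intro retract_mono_arr[of i p]) simp_all
  moreover have "\<forall>m. mono_arr C m \<and> tgt C m \<in> A \<longrightarrow> src C m \<in> A"
    using assms(1) by (simp add: abelian_subcategory_def)
  ultimately show ?thesis using *(2,3) assms(3) by blast
qed

lemma abelian_subcategory_sum:
  assumes "abelian_subcategory C A" "is_direct_sum C X Xs" "set Xs \<subseteq> A" shows "X \<in> A"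
  using assms(2,3)
proof (induction Xs arbitrary: X)
  case Nil
  then show ?case using assms(1) by (simp add: abelian_subcategory_def is_direct_sum_Nil_iff)
next
  case (Cons Y Xs)
  then obtain W where W: "biproduct C X Y W" "is_direct_sum C W Xs"
    unfolding is_direct_sum_Cons_iff by blast
  then have "W \<in> A" "Y \<in> A" "is_direct_sum C X [Y, W]"
    using Cons by (simp_all add: is_direct_sum_two_iff)
  then show ?case using assms(1) unfolding abelian_subcategory_def by blast
qed

lemma abelian_subcategory_simple_retracts:
  assumes "abelian_subcategory C A" "X \<in> obj C" "\<And>S. simple_object C S \<Longrightarrow> retract C S X \<Longrightarrow> S \<in> A"
  shows "X \<in> A"
proof -
  obtain Xs where Xs: "\<forall>T \<in> set Xs. simple_object C T" "is_direct_sum C X Xs"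
    by (rule simple_sum_ex[OF assms(2)])
  then show ?thesis
    using abelian_subcategory_sum[OF assms(1) Xs(2)] is_direct_sum_retract[OF Xs(2)] assms(3) by blast
qed

text \<open>Monos and epis split, so subobjects and quotients are both retracts and a single closure
  condition covers them.\<close>

lemma abelian_subcategoryI:
  assumes "A \<subseteq> obj C" "\<And>Z. zero_object C Z \<Longrightarrow> Z \<in> A"
    "\<And>X Y Z. X \<in> A \<Longrightarrow> Y \<in> A \<Longrightarrow> biproduct C Z X Y \<Longrightarrow> Z \<in> A"
    "\<And>X Y. Y \<in> A \<Longrightarrow> retract C X Y \<Longrightarrow> X \<in> A"
  shows "abelian_subcategory C A"
  unfolding abelian_subcategory_def is_direct_sum_two_iff
proof (intro conjI allI impI ballI assms(1))
  show "Z \<in> A" if "zero_object C Z" for Z using that by (rule assms(2))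
  show "Z \<in> A" if "X \<in> A" "Y \<in> A" "biproduct C Z X Y" for X Y Z using that by (rule assms(3))
  show "src C m \<in> A" if "mono_arr C m \<and> tgt C m \<in> A" for m
    using that mono_retract by (blast intro: assms(4))
  show "tgt C e \<in> A" if "epi_arr C e \<and> src C e \<in> A" for e
    using that epi_retract by (blast intro: assms(4))
qed

text \<open>Source of the components of a grading, where \<open>P\<close> fixes a degree; with
  \<open>P\<close> constantly true it is the whole category.\<close>

lemma abelian_subcategory_of_simples:
  "abelian_subcategory C {X \<in> obj C. \<forall>S. simple_object C S \<and> retract C S X \<longrightarrow> P S}"
proof (rule abelian_subcategoryI)
  show "Z \<in> {X \<in> obj C. \<forall>S. simple_object C S \<and> retract C S X \<longrightarrow> P S}" if "zero_object C Z" for Z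
    using that simple_retract_nonzero by (simp add: zero_object_iff) blast
next
  fix X Y Z assume "X \<in> {X \<in> obj C. \<forall>S. simple_object C S \<and> retract C S X \<longrightarrow> P S}"
    "Y \<in> {X \<in> obj C. \<forall>S. simple_object C S \<and> retract C S X \<longrightarrow> P S}" "biproduct C Z X Y"
  then show "Z \<in> {X \<in> obj C. \<forall>S. simple_object C S \<and> retract C S X \<longrightarrow> P S}"
    using simple_retract_biproduct biproduct_obj(3) by blast
next
  fix X Y assume "Y \<in> {X \<in> obj C. \<forall>S. simple_object C S \<and> retract C S X \<longrightarrow> P S}" "retract C X Y"
  then show "X \<in> {X \<in> obj C. \<forall>S. simple_object C S \<and> retract C S X \<longrightarrow> P S}"
    using retract_trans retract_obj(1) by blast
qed blast

section \<open>Consequences of the zigzag identities\<close>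

lemma assoc_arr [simp]:
  assumes "X \<in> obj C" "Y \<in> obj C" "Z \<in> obj C"
  shows "assoc C X Y Z \<in> arr C" "src C (assoc C X Y Z) = (X \<boxtimes>\<^sub>o Y) \<boxtimes>\<^sub>o Z"
    "tgt C (assoc C X Y Z) = X \<boxtimes>\<^sub>o (Y \<boxtimes>\<^sub>o Z)"
  using assoc_hom[OF assms] by (simp_all add: in_hom_iff)

lemma lunit_arr [simp]:
  assumes "X \<in> obj C"
  shows "lunit C X \<in> arr C" "src C (lunit C X) = \<I> \<boxtimes>\<^sub>o X" "tgt C (lunit C X) = X"
  using lunit_hom[OF assms] by (simp_all add: in_hom_iff)

lemma runit_arr [simp]:
  assumes "X \<in> obj C"
  shows "runit C X \<in> arr C" "src C (runit C X) = X \<boxtimes>\<^sub>o \<I>" "tgt C (runit C X) = X"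
  using runit_hom[OF assms] by (simp_all add: in_hom_iff)

lemma left_dualE:
  assumes "left_dual C X Y"
  obtains ev coev where "X \<in> obj C" "Y \<in> obj C"
    "ev \<in> arr C" "src C ev = Y \<boxtimes>\<^sub>o X" "tgt C ev = \<I>"
    "coev \<in> arr C" "src C coev = \<I>" "tgt C coev = X \<boxtimes>\<^sub>o Y"
    "runit C X \<cdot> (ident C X \<boxtimes>\<^sub>m ev) \<cdot> assoc C X Y X \<cdot> (coev \<boxtimes>\<^sub>m ident C X) = lunit C X"
    "lunit C Y \<cdot> (ev \<boxtimes>\<^sub>m ident C Y) \<cdot> inv_arr C (assoc C Y X Y) \<cdot> (ident C Y \<boxtimes>\<^sub>m coev) = runit C Y"
  using assms unfolding left_dual_def in_hom_iff Bex_def by (elim conjE exE) (rule that)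

text \<open>Let p project \<open>X\<close> onto \<open>S\<close>. If p applied to the first factor
  of the coevaluation gave zero, then moving p through the first zigzag composite by naturality
  would give p after \<open>lunit\<close> zero, hence p zero. So there is a nonzero arrow from the
  simple unit to S \<otimes> Y, and it splits.\<close>

lemma retract_left_dual_unit:
  assumes "left_dual C X Y" "retract C S X" "\<not> zero_object C S"
  shows "retract C \<I> (S \<boxtimes>\<^sub>o Y)"
proof -
  obtain ev coev where o: "X \<in> obj C" "Y \<in> obj C"
    "ev \<in> arr C" "src C ev = Y \<boxtimes>\<^sub>o X" "tgt C ev = \<I>"
    "coev \<in> arr C" "src C coev = \<I>" "tgt C coev = X \<boxtimes>\<^sub>o Y"
    and z: "runit C X \<cdot> (ident C X \<boxtimes>\<^sub>m ev) \<cdot> assoc C X Y X \<cdot> (coev \<boxtimes>\<^sub>m ident C X) = lunit C X"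
    using assms(1) by (rule left_dualE)
  obtain i p where p: "i \<in> arr C" "src C i = S" "tgt C i = X" "p \<in> arr C" "src C p = X" "tgt C p = S"
    "p \<cdot> i = ident C S" using assms(2) by (rule retractE)
  have S: "S \<in> obj C" using retract_obj assms(2) by blast
  let ?c = "(p \<boxtimes>\<^sub>m ident C Y) \<cdot> coev"
  have c: "?c \<in> arr C" "src C ?c = \<I>" "tgt C ?c = S \<boxtimes>\<^sub>o Y" using o p S by simp_all
  have "?c \<noteq> zero_arr C \<I> (S \<boxtimes>\<^sub>o Y)"
  proof
    assume c0: "?c = zero_arr C \<I> (S \<boxtimes>\<^sub>o Y)"
    have "p \<cdot> lunit C X = (p \<cdot> runit C X) \<cdot> (ident C X \<boxtimes>\<^sub>m ev) \<cdot> assoc C X Y X \<cdot> (coev \<boxtimes>\<^sub>m ident C X)"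
      unfolding z[symmetric] using o p S by simp
    also have "p \<cdot> runit C X = runit C S \<cdot> (p \<boxtimes>\<^sub>m ident C \<I>)"
      by (rule runit_natural[symmetric]) (use p in \<open>simp add: in_hom_iff\<close>)
    also have "(runit C S \<cdot> (p \<boxtimes>\<^sub>m ident C \<I>)) \<cdot> (ident C X \<boxtimes>\<^sub>m ev) \<cdot> assoc C X Y X \<cdot> (coev \<boxtimes>\<^sub>m ident C X)
      = runit C S \<cdot> ((p \<boxtimes>\<^sub>m ident C \<I>) \<cdot> (ident C X \<boxtimes>\<^sub>m ev)) \<cdot> assoc C X Y X \<cdot> (coev \<boxtimes>\<^sub>m ident C X)"
      using o p S by (simp del: interchange)
    also have "(p \<boxtimes>\<^sub>m ident C \<I>) \<cdot> (ident C X \<boxtimes>\<^sub>m ev) = (ident C S \<boxtimes>\<^sub>m ev) \<cdot> (p \<boxtimes>\<^sub>m ident C (Y \<boxtimes>\<^sub>o X))"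
      using o p S by simp
    also have "runit C S \<cdot> ((ident C S \<boxtimes>\<^sub>m ev) \<cdot> (p \<boxtimes>\<^sub>m ident C (Y \<boxtimes>\<^sub>o X))) \<cdot> assoc C X Y X \<cdot> (coev \<boxtimes>\<^sub>m ident C X)
      = runit C S \<cdot> (ident C S \<boxtimes>\<^sub>m ev) \<cdot> ((p \<boxtimes>\<^sub>m ident C (Y \<boxtimes>\<^sub>o X)) \<cdot> assoc C X Y X) \<cdot> (coev \<boxtimes>\<^sub>m ident C X)"
      using o p S by (simp del: interchange)
    also have "(p \<boxtimes>\<^sub>m ident C (Y \<boxtimes>\<^sub>o X)) \<cdot> assoc C X Y X = assoc C S Y X \<cdot> ((p \<boxtimes>\<^sub>m ident C Y) \<boxtimes>\<^sub>m ident C X)"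
      using assoc_natural[of p X S "ident C Y" Y Y "ident C X" X X] o p S by (simp add: in_hom_iff)
    also have "runit C S \<cdot> (ident C S \<boxtimes>\<^sub>m ev) \<cdot> (assoc C S Y X \<cdot> ((p \<boxtimes>\<^sub>m ident C Y) \<boxtimes>\<^sub>m ident C X)) \<cdot> (coev \<boxtimes>\<^sub>m ident C X)
      = runit C S \<cdot> (ident C S \<boxtimes>\<^sub>m ev) \<cdot> assoc C S Y X \<cdot> (?c \<boxtimes>\<^sub>m ident C X)"
      using o p S by simp
    also have "\<dots> = zero_arr C (\<I> \<boxtimes>\<^sub>o X) S"
      unfolding c0 using o p S by simp
    finally have "p = zero_arr C X S"
      using is_zero_arr_iso[OF lunit_iso[OF o(1)], of p] o p by simp
    then have "ident C S = zero_arr C S S" using p o(1) S by simp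
    then show False using assms(3) S by (simp add: zero_object_iff)
  qed
  then show ?thesis using simple_nonzero_retract[OF unit_simple, of ?c] c by simp
qed

text \<open>The mirror argument, with a projection q of \<open>Y\<close> onto \<open>T\<close> moved
  through the second zigzag identity.\<close>

lemma left_dual_retract_unit:
  assumes "left_dual C X Y" "retract C T Y" "\<not> zero_object C T"
  shows "retract C \<I> (X \<boxtimes>\<^sub>o T)"
proof -
  obtain ev coev where o: "X \<in> obj C" "Y \<in> obj C"
    "ev \<in> arr C" "src C ev = Y \<boxtimes>\<^sub>o X" "tgt C ev = \<I>"
    "coev \<in> arr C" "src C coev = \<I>" "tgt C coev = X \<boxtimes>\<^sub>o Y"
    "runit C X \<cdot> (ident C X \<boxtimes>\<^sub>m ev) \<cdot> assoc C X Y X \<cdot> (coev \<boxtimes>\<^sub>m ident C X) = lunit C X"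
    and z: "lunit C Y \<cdot> (ev \<boxtimes>\<^sub>m ident C Y) \<cdot> inv_arr C (assoc C Y X Y) \<cdot> (ident C Y \<boxtimes>\<^sub>m coev) = runit C Y"
    using assms(1) by (rule left_dualE)
  obtain i q where q: "i \<in> arr C" "src C i = T" "tgt C i = Y" "q \<in> arr C" "src C q = Y" "tgt C q = T"
    "q \<cdot> i = ident C T" using assms(2) by (rule retractE)
  have T: "T \<in> obj C" using retract_obj assms(2) by blast
  let ?c = "(ident C X \<boxtimes>\<^sub>m q) \<cdot> coev"
  have c: "?c \<in> arr C" "src C ?c = \<I>" "tgt C ?c = X \<boxtimes>\<^sub>o T" using o q T by simp_all
  have inv: "\<exists>b. inverse_arrs C (assoc C Y X Z) b \<and> inv_arr C (assoc C Y X Z) = b" if "Z \<in> obj C" for Z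
    using assoc_iso[OF o(2,1) that] inv_arr_eq unfolding iso_arr_def by blast
  let ?b = "inv_arr C (assoc C Y X Y)" and ?b' = "inv_arr C (assoc C Y X T)"
  have b: "?b \<in> arr C" "src C ?b = Y \<boxtimes>\<^sub>o (X \<boxtimes>\<^sub>o Y)" "tgt C ?b = (Y \<boxtimes>\<^sub>o X) \<boxtimes>\<^sub>o Y"
    "assoc C Y X Y \<cdot> ?b = ident C (Y \<boxtimes>\<^sub>o (X \<boxtimes>\<^sub>o Y))"
    using inv[OF o(2)] o by (auto simp: inverse_arrs_def in_hom_iff)
  have b': "?b' \<in> arr C" "src C ?b' = Y \<boxtimes>\<^sub>o (X \<boxtimes>\<^sub>o T)" "tgt C ?b' = (Y \<boxtimes>\<^sub>o X) \<boxtimes>\<^sub>o T"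
    "?b' \<cdot> assoc C Y X T = ident C ((Y \<boxtimes>\<^sub>o X) \<boxtimes>\<^sub>o T)"
    using inv[OF T] o T by (auto simp: inverse_arrs_def in_hom_iff)
  \<comment> \<open>The second zigzag identity contains the inverse associator, while the axioms
    give naturality of the associator itself; it is conjugated by the two inverses.\<close>
  have nat: "(ident C (Y \<boxtimes>\<^sub>o X) \<boxtimes>\<^sub>m q) \<cdot> ?b = ?b' \<cdot> (ident C Y \<boxtimes>\<^sub>m (ident C X \<boxtimes>\<^sub>m q))"
  proof -
    have n: "assoc C Y X T \<cdot> (ident C (Y \<boxtimes>\<^sub>o X) \<boxtimes>\<^sub>m q) = (ident C Y \<boxtimes>\<^sub>m (ident C X \<boxtimes>\<^sub>m q)) \<cdot> assoc C Y X Y"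
      using assoc_natural[of "ident C Y" Y Y "ident C X" X X q Y T] o q T by (simp add: in_hom_iff)
    have "(ident C (Y \<boxtimes>\<^sub>o X) \<boxtimes>\<^sub>m q) \<cdot> ?b = (?b' \<cdot> assoc C Y X T) \<cdot> (ident C (Y \<boxtimes>\<^sub>o X) \<boxtimes>\<^sub>m q) \<cdot> ?b"
      unfolding b'(4) using o q T b(1-3) by simp
    also have "\<dots> = ?b' \<cdot> (assoc C Y X T \<cdot> (ident C (Y \<boxtimes>\<^sub>o X) \<boxtimes>\<^sub>m q)) \<cdot> ?b"
      using o q T b(1-3) b'(1-3) by simp
    also have "\<dots> = ?b' \<cdot> (ident C Y \<boxtimes>\<^sub>m (ident C X \<boxtimes>\<^sub>m q)) \<cdot> (assoc C Y X Y \<cdot> ?b)"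
      unfolding n using o q T b(1-3) b'(1-3) by simp
    also have "\<dots> = ?b' \<cdot> (ident C Y \<boxtimes>\<^sub>m (ident C X \<boxtimes>\<^sub>m q))"
      unfolding b(4) using o q T b'(1-3) by simp
    finally show ?thesis .
  qed
  have "?c \<noteq> zero_arr C \<I> (X \<boxtimes>\<^sub>o T)"
  proof
    assume c0: "?c = zero_arr C \<I> (X \<boxtimes>\<^sub>o T)"
    have "q \<cdot> runit C Y = (q \<cdot> lunit C Y) \<cdot> (ev \<boxtimes>\<^sub>m ident C Y) \<cdot> ?b \<cdot> (ident C Y \<boxtimes>\<^sub>m coev)"
      unfolding z[symmetric] using o q T b(1-3) by simp
    also have "q \<cdot> lunit C Y = lunit C T \<cdot> (ident C \<I> \<boxtimes>\<^sub>m q)"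
      by (rule lunit_natural[symmetric]) (use q in \<open>simp add: in_hom_iff\<close>)
    also have "(lunit C T \<cdot> (ident C \<I> \<boxtimes>\<^sub>m q)) \<cdot> (ev \<boxtimes>\<^sub>m ident C Y) \<cdot> ?b \<cdot> (ident C Y \<boxtimes>\<^sub>m coev)
      = lunit C T \<cdot> ((ident C \<I> \<boxtimes>\<^sub>m q) \<cdot> (ev \<boxtimes>\<^sub>m ident C Y)) \<cdot> ?b \<cdot> (ident C Y \<boxtimes>\<^sub>m coev)"
      using o q T b(1-3) by (simp del: interchange)
    also have "(ident C \<I> \<boxtimes>\<^sub>m q) \<cdot> (ev \<boxtimes>\<^sub>m ident C Y) = (ev \<boxtimes>\<^sub>m ident C T) \<cdot> (ident C (Y \<boxtimes>\<^sub>o X) \<boxtimes>\<^sub>m q)"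
      using o q T by simp
    also have "lunit C T \<cdot> ((ev \<boxtimes>\<^sub>m ident C T) \<cdot> (ident C (Y \<boxtimes>\<^sub>o X) \<boxtimes>\<^sub>m q)) \<cdot> ?b \<cdot> (ident C Y \<boxtimes>\<^sub>m coev)
      = lunit C T \<cdot> (ev \<boxtimes>\<^sub>m ident C T) \<cdot> ((ident C (Y \<boxtimes>\<^sub>o X) \<boxtimes>\<^sub>m q) \<cdot> ?b) \<cdot> (ident C Y \<boxtimes>\<^sub>m coev)"
      using o q T b(1-3) by (simp del: interchange)
    also note nat
    also have "lunit C T \<cdot> (ev \<boxtimes>\<^sub>m ident C T) \<cdot> (?b' \<cdot> (ident C Y \<boxtimes>\<^sub>m (ident C X \<boxtimes>\<^sub>m q))) \<cdot> (ident C Y \<boxtimes>\<^sub>m coev)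
      = lunit C T \<cdot> (ev \<boxtimes>\<^sub>m ident C T) \<cdot> ?b' \<cdot> (ident C Y \<boxtimes>\<^sub>m ?c)"
      using o q T b'(1-3) by simp
    also have "\<dots> = zero_arr C (Y \<boxtimes>\<^sub>o \<I>) T"
      unfolding c0 using o q T b'(1-3) by simp
    finally have "q = zero_arr C Y T"
      using is_zero_arr_iso[OF runit_iso[OF o(2)], of q] o q by simp
    then have "ident C T = zero_arr C T T" using q o T by simp
    then show False using assms(3) T by (simp add: zero_object_iff)
  qed
  then show ?thesis using simple_nonzero_retract[OF unit_simple, of ?c] c by simp
qed

text \<open>A vanishing evaluation would make the first zigzag composite, which equals the
  isomorphism \<open>lunit\<close>, zero, and with it \<open>X\<close>. Here the nonzero arrow goes
  into the unit, so the unit splits off the source.\<close>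

lemma left_dual_evaluation_unit:
  assumes "left_dual C X Y" "\<not> zero_object C X"
  shows "retract C \<I> (Y \<boxtimes>\<^sub>o X)"
proof -
  obtain ev coev where o: "X \<in> obj C" "Y \<in> obj C"
    "ev \<in> arr C" "src C ev = Y \<boxtimes>\<^sub>o X" "tgt C ev = \<I>"
    "coev \<in> arr C" "src C coev = \<I>" "tgt C coev = X \<boxtimes>\<^sub>o Y"
    and z: "runit C X \<cdot> (ident C X \<boxtimes>\<^sub>m ev) \<cdot> assoc C X Y X \<cdot> (coev \<boxtimes>\<^sub>m ident C X) = lunit C X"
    using assms(1) by (rule left_dualE)
  have "ev \<noteq> zero_arr C (Y \<boxtimes>\<^sub>o X) \<I>"
  proof
    assume e: "ev = zero_arr C (Y \<boxtimes>\<^sub>o X) \<I>"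
    have "lunit C X = zero_arr C (\<I> \<boxtimes>\<^sub>o X) X"
      unfolding z[symmetric] e using o by simp
    then have "ident C X = zero_arr C X X"
      using is_zero_arr_iso[OF lunit_iso[OF o(1)], of "ident C X"] o by simp
    then show False using assms(2) o by (simp add: zero_object_iff)
  qed
  then show ?thesis using nonzero_to_simple_retract[OF unit_simple, of ev] o by simp
qed

end

section \<open>Invertible objects\<close>

context fusion_category
begin

text \<open>Isomorphisms between iterated tensor products are computed as equations of isomorphism
  classes: on classes of objects, associativity and unit laws are rewrite rules, and
  \<open>cl_eqD\<close> returns to an isomorphism. \<open>obj_classes\<close> is the domain on which
  those rules hold.\<close>

abbreviation cl :: "'o \<Rightarrow> 'o set" where "cl \<equiv> iso_class C"
abbreviation ct :: "'o set \<Rightarrow> 'o set \<Rightarrow> 'o set" (infixr "\<star>" 70) where "a \<star> b \<equiv> class_tensor C a b"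
abbreviation obj_classes :: "'o set set" where "obj_classes \<equiv> iso_class C ` obj C"

lemma cl_tensor:
  assumes "X \<in> obj C" "Y \<in> obj C" shows "cl (X \<boxtimes>\<^sub>o Y) = cl X \<star> cl Y"
proof -
  have "isomorphic C (X' \<boxtimes>\<^sub>o Y') Z \<longleftrightarrow> isomorphic C (X \<boxtimes>\<^sub>o Y) Z"
    if "isomorphic C X X'" "isomorphic C Y Y'" for X' Y' Z
    using tensor_isomorphic[OF that] isomorphic_sym isomorphic_trans by blast
  then show ?thesis
    using isomorphic_refl[OF assms(1)] isomorphic_refl[OF assms(2)]
    unfolding iso_class_def class_tensor_def by blast
qed

lemma cl_in [simp]: "X \<in> obj C \<Longrightarrow> cl X \<in> obj_classes" by simp

lemma ct_closed [simp]: "\<lbrakk>a \<in> obj_classes; b \<in> obj_classes\<rbrakk> \<Longrightarrow> a \<star> b \<in> obj_classes"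
  by (auto simp flip: cl_tensor)

lemma cl_eqD: "\<lbrakk>cl X = cl Y; X \<in> obj C; Y \<in> obj C\<rbrakk> \<Longrightarrow> isomorphic C X Y"
  by (simp add: iso_class_eq_iff)

lemma cl_eqI: "isomorphic C X Y \<Longrightarrow> cl X = cl Y"
  using isomorphic_obj[of X Y] by (simp add: iso_class_eq_iff)

lemma ct_assoc:
  assumes "a \<in> obj_classes" "b \<in> obj_classes" "c \<in> obj_classes"
  shows "(a \<star> b) \<star> c = a \<star> (b \<star> c)"
proof -
  obtain X Y Z where *: "X \<in> obj C" "Y \<in> obj C" "Z \<in> obj C" "a = cl X" "b = cl Y" "c = cl Z"
    using assms by blast
  then show ?thesis using cl_eqI[OF assoc_isomorphic[of X Y Z]] by (simp add: cl_tensor)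
qed

lemma ct_one [simp]:
  assumes "a \<in> obj_classes" shows "cl \<I> \<star> a = a" "a \<star> cl \<I> = a"
proof -
  obtain X where X: "X \<in> obj C" "a = cl X" using assms by blast
  show "cl \<I> \<star> a = a" "a \<star> cl \<I> = a"
    using X cl_eqI[OF lunit_isomorphic[OF X(1)]] cl_eqI[OF runit_isomorphic[OF X(1)]]
    by (simp_all add: cl_tensor)
qed

text \<open>Invertibility with the inverse as a named witness and with equations between classes,
  which rewrite and cancel directly (\<open>inverse_objectsD\<close>).\<close>

definition inverse_objects :: "'o \<Rightarrow> 'o \<Rightarrow> bool" where
  "inverse_objects u v \<longleftrightarrow> u \<in> obj C \<and> v \<in> obj C \<and> cl u \<star> cl v = cl \<I> \<and> cl v \<star> cl u = cl \<I>"

lemma inverse_objects_sym: "inverse_objects u v \<Longrightarrow> inverse_objects v u"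
  by (simp add: inverse_objects_def)

lemma inverse_objectsD:
  assumes "inverse_objects u v"
  shows "u \<in> obj C" "v \<in> obj C" "cl u \<star> cl v = cl \<I>" "cl v \<star> cl u = cl \<I>"
    "a \<in> obj_classes \<Longrightarrow> cl u \<star> (cl v \<star> a) = a" "a \<in> obj_classes \<Longrightarrow> cl v \<star> (cl u \<star> a) = a"
  using assms ct_assoc[of "cl u" "cl v" a] ct_assoc[of "cl v" "cl u" a]
  by (simp_all add: inverse_objects_def)

lemma invertible_object_iff: "invertible_object C u \<longleftrightarrow> (\<exists>v. inverse_objects u v)"
proof -
  have "isomorphic C (u \<boxtimes>\<^sub>o v) \<I> \<longleftrightarrow> cl u \<star> cl v = cl \<I>" if "u \<in> obj C" "v \<in> obj C" for u v
    using that by (simp add: iso_class_eq_iff flip: cl_tensor)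
  then show ?thesis
    unfolding invertible_object_def inverse_objects_def by blast
qed

lemma inverse_objects_invertible: "inverse_objects u v \<Longrightarrow> invertible_object C u"
  by (auto simp: invertible_object_iff)

lemma invertible_object_obj: "invertible_object C u \<Longrightarrow> u \<in> obj C"
  by (simp add: invertible_object_def)

lemma isomorphic_invertible_object:
  assumes "isomorphic C u w" "invertible_object C u" shows "invertible_object C w"
  using assms(2) cl_eqI[OF assms(1)] isomorphic_obj[OF assms(1)]
  by (auto simp: invertible_object_iff inverse_objects_def)

lemma inverse_objects_tensor:
  assumes "inverse_objects u v" "inverse_objects w z"
  shows "inverse_objects (u \<boxtimes>\<^sub>o w) (z \<boxtimes>\<^sub>o v)"
  using inverse_objectsD[OF assms(1)] inverse_objectsD[OF assms(2)]
  by (simp add: inverse_objects_def cl_tensor ct_assoc)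

lemma invertible_object_tensor:
  "\<lbrakk>invertible_object C u; invertible_object C w\<rbrakk> \<Longrightarrow> invertible_object C (u \<boxtimes>\<^sub>o w)"
  unfolding invertible_object_iff using inverse_objects_tensor by blast

lemma invertible_object_unit: "invertible_object C \<I>"
  unfolding invertible_object_iff by (rule exI[of _ \<I>]) (simp add: inverse_objects_def)

lemma retract_move_left:
  assumes "inverse_objects u v" "retract C X (u \<boxtimes>\<^sub>o Y)" "Y \<in> obj C"
  shows "retract C (v \<boxtimes>\<^sub>o X) Y"
proof -
  note uv = inverse_objectsD[OF assms(1)]
  have "retract C (v \<boxtimes>\<^sub>o X) (v \<boxtimes>\<^sub>o (u \<boxtimes>\<^sub>o Y))"
    using uv assms by (intro tensor_retract) simp_all
  also have "isomorphic C (v \<boxtimes>\<^sub>o (u \<boxtimes>\<^sub>o Y)) Y"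
    using uv assms by (intro cl_eqD) (simp_all add: cl_tensor)
  finally show ?thesis .
qed

lemma retract_move_right:
  assumes "inverse_objects u v" "retract C X (Y \<boxtimes>\<^sub>o u)" "Y \<in> obj C"
  shows "retract C (X \<boxtimes>\<^sub>o v) Y"
proof -
  note uv = inverse_objectsD[OF assms(1)]
  have "retract C (X \<boxtimes>\<^sub>o v) ((Y \<boxtimes>\<^sub>o u) \<boxtimes>\<^sub>o v)"
    using uv assms by (intro tensor_retract) simp_all
  also have "isomorphic C ((Y \<boxtimes>\<^sub>o u) \<boxtimes>\<^sub>o v) Y"
    using uv assms by (intro cl_eqD) (simp_all add: cl_tensor ct_assoc)
  finally show ?thesis .
qed

lemma tensor_invertible_nonzero:
  assumes "inverse_objects u v" "X \<in> obj C" "\<not> zero_object C X"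
  shows "\<not> zero_object C (u \<boxtimes>\<^sub>o X)" "\<not> zero_object C (X \<boxtimes>\<^sub>o u)"
proof -
  note uv = inverse_objectsD[OF assms(1)]
  have "retract C X (v \<boxtimes>\<^sub>o (u \<boxtimes>\<^sub>o X))" "retract C X ((X \<boxtimes>\<^sub>o u) \<boxtimes>\<^sub>o v)"
    using uv assms(2) by (auto intro!: isomorphic_retract cl_eqD simp: cl_tensor ct_assoc)
  then show "\<not> zero_object C (u \<boxtimes>\<^sub>o X)" "\<not> zero_object C (X \<boxtimes>\<^sub>o u)"
    using assms(3) zero_object_retract zero_object_tensor uv(1,2) by blast+
qed

text \<open>Let T be a simple summand of u \<otimes> S and v inverse to u. Then v \<otimes> T is a
  nonzero retract of the simple object S, hence isomorphic to it, and tensoring back with u shows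
  that T is all of u \<otimes> S.\<close>

lemma tensor_invertible_simple:
  assumes "invertible_object C u" "simple_object C S"
  shows "simple_object C (u \<boxtimes>\<^sub>o S)" "simple_object C (S \<boxtimes>\<^sub>o u)"
proof -
  obtain v where uv': "inverse_objects u v" using assms(1) by (auto simp: invertible_object_iff)
  note uv = inverse_objectsD[OF uv'] and vu' = inverse_objects_sym[OF uv']
  have S: "S \<in> obj C" "\<not> zero_object C S"
    using assms(2) by (simp_all add: simple_object_obj simple_object_nonzero)
  note nz = tensor_invertible_nonzero[OF uv' S]
  obtain T where T: "simple_object C T" "retract C T (u \<boxtimes>\<^sub>o S)"
    by (rule simple_retract_ex[OF _ nz(1)]) (use uv S in simp_all)
  have To: "T \<in> obj C" "\<not> zero_object C T"
    using T(1) by (simp_all add: simple_object_obj simple_object_nonzero)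
  have "isomorphic C (v \<boxtimes>\<^sub>o T) S"
    by (rule retract_simple_isomorphic[OF retract_move_left[OF uv' T(2) S(1)] assms(2)
          tensor_invertible_nonzero(1)[OF vu' To]])
  then have "cl v \<star> cl T = cl S" using cl_eqI uv To by (simp flip: cl_tensor)
  then have "cl u \<star> (cl v \<star> cl T) = cl (u \<boxtimes>\<^sub>o S)" using uv To S by (simp add: cl_tensor)
  then have "cl T = cl (u \<boxtimes>\<^sub>o S)" using uv To S by simp
  then show "simple_object C (u \<boxtimes>\<^sub>o S)"
    using isomorphic_simple_object[OF cl_eqD T(1)] To uv S by simp
  obtain T where T: "simple_object C T" "retract C T (S \<boxtimes>\<^sub>o u)"
    by (rule simple_retract_ex[OF _ nz(2)]) (use uv S in simp_all)
  have To: "T \<in> obj C" "\<not> zero_object C T"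
    using T(1) by (simp_all add: simple_object_obj simple_object_nonzero)
  have "isomorphic C (T \<boxtimes>\<^sub>o v) S"
    by (rule retract_simple_isomorphic[OF retract_move_right[OF uv' T(2) S(1)] assms(2)
          tensor_invertible_nonzero(2)[OF vu' To]])
  then have "cl T \<star> cl v = cl S" using cl_eqI uv To by (simp flip: cl_tensor)
  then have "(cl T \<star> cl v) \<star> cl u = cl (S \<boxtimes>\<^sub>o u)" using uv To S by (simp add: cl_tensor)
  then have "cl T = cl (S \<boxtimes>\<^sub>o u)" using uv To S by (simp add: ct_assoc)
  then show "simple_object C (S \<boxtimes>\<^sub>o u)"
    using isomorphic_simple_object[OF cl_eqD T(1)] To uv S by simp
qed

lemma invertible_simple:
  assumes "invertible_object C u" shows "simple_object C u"
  using isomorphic_simple_object[OF runit_isomorphic tensor_invertible_simple(1)[OF assms unit_simple]]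
    invertible_object_obj[OF assms] by simp

lemma tensor_noninvertible:
  assumes "invertible_object C u" "X \<in> obj C" "\<not> invertible_object C X"
  shows "\<not> invertible_object C (u \<boxtimes>\<^sub>o X)" "\<not> invertible_object C (X \<boxtimes>\<^sub>o u)"
proof -
  obtain v where uv': "inverse_objects u v" using assms(1) by (auto simp: invertible_object_iff)
  note uv = inverse_objectsD[OF uv']
  have v: "invertible_object C v" using inverse_objects_sym[OF uv'] by (rule inverse_objects_invertible)
  have i: "isomorphic C (v \<boxtimes>\<^sub>o (u \<boxtimes>\<^sub>o X)) X" "isomorphic C ((X \<boxtimes>\<^sub>o u) \<boxtimes>\<^sub>o v) X"
    using uv assms(2) by (auto intro!: cl_eqD simp: cl_tensor ct_assoc)
  show "\<not> invertible_object C (u \<boxtimes>\<^sub>o X)" "\<not> invertible_object C (X \<boxtimes>\<^sub>o u)"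
    using i v assms(3) invertible_object_tensor isomorphic_invertible_object by blast+
qed

text \<open>With one factor invertible the product is simple, so its retract, the unit, is the whole
  of it; the other factor is then the inverse.\<close>

lemma unit_retract_invertible:
  assumes "simple_object C S" "simple_object C T" "retract C \<I> (S \<boxtimes>\<^sub>o T)"
    "invertible_object C S \<or> invertible_object C T"
  shows "inverse_objects S T"
proof -
  have o: "S \<in> obj C" "T \<in> obj C" using assms(1,2) by (simp_all add: simple_object_obj)
  have "simple_object C (S \<boxtimes>\<^sub>o T)" using assms(1,2,4) tensor_invertible_simple by blast
  then have "isomorphic C \<I> (S \<boxtimes>\<^sub>o T)"
    using simple_retract_isomorphic[OF unit_simple _ assms(3)] by blast
  then have ST: "cl S \<star> cl T = cl \<I>" using cl_eqI o by (simp flip: cl_tensor)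
  show ?thesis
    using assms(4)
  proof
    assume "invertible_object C S"
    then obtain v where v: "inverse_objects S v" by (auto simp: invertible_object_iff)
    note v' = inverse_objectsD[OF v]
    have "cl v = cl v \<star> (cl S \<star> cl T)" using ST v' o by simp
    also have "\<dots> = cl T" using v' o by simp
    finally show ?thesis using v o by (simp add: inverse_objects_def)
  next
    assume "invertible_object C T"
    then obtain v where v: "inverse_objects T v" by (auto simp: invertible_object_iff)
    note v' = inverse_objectsD[OF v]
    have "cl v = (cl S \<star> cl T) \<star> cl v" using ST v' o by simp
    also have "\<dots> = cl S" using v' o by (simp add: ct_assoc)
    finally show ?thesis using v o by (simp add: inverse_objects_def)
  qed
qed

lemma invertible_group_simps [simp]:
  "x \<otimes>\<^bsub>invertible_group C\<^esub> y = x \<star> y" "\<one>\<^bsub>invertible_group C\<^esub> = cl \<I>"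
  by (simp_all add: invertible_group_def)

lemma carrier_invertible_group: "carrier (invertible_group C) = cl ` {u. invertible_object C u}"
  using invertible_simple by (auto simp: invertible_group_def)

lemma cl_in_carrier_iff:
  assumes "X \<in> obj C" shows "cl X \<in> carrier (invertible_group C) \<longleftrightarrow> invertible_object C X"
proof
  assume "cl X \<in> carrier (invertible_group C)"
  then obtain u where "invertible_object C u" "cl X = cl u" by (auto simp: carrier_invertible_group)
  then show "invertible_object C X"
    using isomorphic_invertible_object[OF isomorphic_sym[OF cl_eqD]] invertible_object_obj assms by blast
qed (auto simp: carrier_invertible_group)

lemma invertible_group_group: "group (invertible_group C)"
proof (rule groupI; (simp only: invertible_group_simps)?)
  show "cl \<I> \<in> carrier (invertible_group C)"
    using invertible_object_unit by (simp add: carrier_invertible_group)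
next
  fix x y assume "x \<in> carrier (invertible_group C)" "y \<in> carrier (invertible_group C)"
  then show "x \<star> y \<in> carrier (invertible_group C)"
    using invertible_object_tensor invertible_object_obj
    by (auto simp: carrier_invertible_group simp flip: cl_tensor)
next
  fix x y z assume "x \<in> carrier (invertible_group C)" "y \<in> carrier (invertible_group C)"
    "z \<in> carrier (invertible_group C)"
  then show "(x \<star> y) \<star> z = x \<star> y \<star> z"
    using invertible_object_obj by (intro ct_assoc) (auto simp: carrier_invertible_group)
next
  fix x assume "x \<in> carrier (invertible_group C)"
  then obtain u where u: "x = cl u" "invertible_object C u" by (auto simp: carrier_invertible_group)
  then show "cl \<I> \<star> x = x" using invertible_object_obj by simp
  obtain v where v: "inverse_objects u v" using u by (auto simp: invertible_object_iff)
  then have "cl v \<in> carrier (invertible_group C)"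
    using inverse_objects_invertible[OF inverse_objects_sym] by (auto simp: carrier_invertible_group)
  then show "\<exists>y \<in> carrier (invertible_group C). y \<star> x = cl \<I>"
    using inverse_objectsD(4)[OF v] u by blast
qed

lemma noninvertible_Irr_eq: "noninvertible_Irr C = cl ` {X. simple_object C X \<and> \<not> invertible_object C X}"
proof -
  have "cl X \<in> carrier (invertible_group C) \<longleftrightarrow> invertible_object C X" if "simple_object C X" for X
    using that by (simp add: cl_in_carrier_iff simple_object_obj)
  then show ?thesis by (auto simp: noninvertible_Irr_def Irr_def)
qed

lemma cl_in_noninvertible_Irr_iff:
  assumes "X \<in> obj C"
  shows "cl X \<in> noninvertible_Irr C \<longleftrightarrow> simple_object C X \<and> \<not> invertible_object C X"
proof
  assume "cl X \<in> noninvertible_Irr C"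
  then obtain Y where Y: "simple_object C Y" "\<not> invertible_object C Y" "cl X = cl Y"
    by (auto simp: noninvertible_Irr_eq)
  then have "isomorphic C X Y" using assms simple_object_obj by (intro cl_eqD)
  then show "simple_object C X \<and> \<not> invertible_object C X"
    using Y(1,2) isomorphic_simple_object isomorphic_invertible_object isomorphic_sym by blast
qed (auto simp: noninvertible_Irr_eq)

lemma ct_noninvertible_Irr:
  assumes "g \<in> carrier (invertible_group C)" "x \<in> noninvertible_Irr C"
  shows "g \<star> x \<in> noninvertible_Irr C"
proof -
  obtain u X where "g = cl u" "invertible_object C u" "x = cl X" "simple_object C X"
    "\<not> invertible_object C X"
    using assms by (auto simp: carrier_invertible_group noninvertible_Irr_eq)
  then show ?thesis
    using tensor_invertible_simple(1) tensor_noninvertible(1) simple_object_obj invertible_object_obj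
    by (simp add: noninvertible_Irr_eq flip: cl_tensor)
qed

lemma noninvertible_Irr_classes: "noninvertible_Irr C \<subseteq> obj_classes" "carrier (invertible_group C) \<subseteq> obj_classes"
  using simple_object_obj invertible_object_obj
  by (auto simp: noninvertible_Irr_eq carrier_invertible_group)

text \<open>\<open>transitive_action\<close> contains the axioms of a group action, which have to be
  supplied when the subcategory is certified as a generalized near-group category.\<close>

lemma left_tensor_group_action:
  "group_action (invertible_group C) (noninvertible_Irr C) (left_tensor_action C)"
proof -
  let ?G = "invertible_group C" and ?E = "noninvertible_Irr C" and ?f = "left_tensor_action C"
  interpret G: group ?G by (rule invertible_group_group)
  have cG: "g \<in> obj_classes" if "g \<in> carrier ?G" for g using that noninvertible_Irr_classes by blast
  have cE: "x \<in> obj_classes" if "x \<in> ?E" for x using that noninvertible_Irr_classes by blast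
  have bij: "?f g \<in> carrier (BijGroup ?E)" if g: "g \<in> carrier ?G" for g
  proof -
    let ?h = "inv\<^bsub>?G\<^esub> g"
    have h: "?h \<in> carrier ?G" "g \<star> ?h = cl \<I>" "?h \<star> g = cl \<I>"
      using g G.l_inv[OF g] G.r_inv[OF g] by simp_all
    have "bij_betw (?f g) ?E ?E"
    proof (rule bij_betw_byWitness[where f' = "?f ?h"])
      show "\<forall>x \<in> ?E. ?f ?h (?f g x) = x" "\<forall>x \<in> ?E. ?f g (?f ?h x) = x"
        using ct_noninvertible_Irr g h cG cE
        by (simp_all add: left_tensor_action_def flip: ct_assoc)
      show "?f g ` ?E \<subseteq> ?E" "?f ?h ` ?E \<subseteq> ?E"
        using ct_noninvertible_Irr g h by (auto simp: left_tensor_action_def)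
    qed
    then show ?thesis by (simp add: BijGroup_def Bij_def left_tensor_action_def)
  qed
  have "?f (g \<star> h) = ?f g \<otimes>\<^bsub>BijGroup ?E\<^esub> ?f h" if "g \<in> carrier ?G" "h \<in> carrier ?G" for g h
  proof -
    have "?f g \<otimes>\<^bsub>BijGroup ?E\<^esub> ?f h = compose ?E (?f g) (?f h)"
      using bij that by (simp add: BijGroup_def)
    also have "\<dots> = ?f (g \<star> h)"
      using that ct_noninvertible_Irr cG cE
      by (intro ext) (simp add: left_tensor_action_def compose_def restrict_def ct_assoc)
    finally show ?thesis by simp
  qed
  then have "?f \<in> hom ?G (BijGroup ?E)" using bij by (auto simp: hom_def)
  then have "group_hom ?G (BijGroup ?E) ?f"
    using group_BijGroup by (intro group_hom.intro group_hom_axioms.intro invertible_group_group)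
  then show ?thesis by (rule group_action.intro)
qed

end

text \<open>The transitive action on classes, restated for representatives. As a locale it can be
  interpreted both for the given category and for its full subcategory.\<close>

locale near_group_category = fusion_category C
  for C :: "('o, 'm, 'k::{alg_closed_field, field_char_0}) lin_mon_cat" (structure) +
  assumes not_pointed: "\<not> pointed C"
    and transitive: "\<lbrakk>simple_object C X; \<not> invertible_object C X; simple_object C Y; \<not> invertible_object C Y\<rbrakk>
      \<Longrightarrow> \<exists>g. invertible_object C g \<and> isomorphic C (g \<boxtimes>\<^sub>o X) Y"

lemma generalized_near_group_iff: "generalized_near_group C \<longleftrightarrow> near_group_category C"
proof
  assume C: "generalized_near_group C"
  then interpret fusion_category C by (simp add: generalized_near_group_def)
  interpret transitive_action "invertible_group C" "noninvertible_Irr C" "left_tensor_action C"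
    using C by (simp add: generalized_near_group_def)
  show "near_group_category C"
  proof unfold_locales
    show "\<not> pointed C" using C by (simp add: generalized_near_group_def)
    fix X Y assume *: "simple_object C X" "\<not> invertible_object C X" "simple_object C Y" "\<not> invertible_object C Y"
    then have E: "cl X \<in> noninvertible_Irr C" "cl Y \<in> noninvertible_Irr C"
      by (auto simp: noninvertible_Irr_eq)
    from unique_orbit[OF E] E obtain g where "invertible_object C g" "cl g \<star> cl X = cl Y"
      by (auto simp: carrier_invertible_group left_tensor_action_def)
    then show "\<exists>g. invertible_object C g \<and> isomorphic C (g \<boxtimes>\<^sub>o\<^bsub>C\<^esub> X) Y"
      using * simple_object_obj invertible_object_obj
      by (intro exI[of _ g]) (auto intro!: cl_eqD simp: cl_tensor)
  qed
next
  assume "near_group_category C"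
  then interpret near_group_category C .
  have "transitive_action (invertible_group C) (noninvertible_Irr C) (left_tensor_action C)"
  proof (intro transitive_action.intro left_tensor_group_action transitive_action_axioms.intro)
    fix x y assume E: "x \<in> noninvertible_Irr C" "y \<in> noninvertible_Irr C"
    then obtain X Y where *: "simple_object C X" "\<not> invertible_object C X" "simple_object C Y"
      "\<not> invertible_object C Y" "x = cl X" "y = cl Y" by (auto simp: noninvertible_Irr_eq)
    from transitive[OF *(1-4)] obtain g where g: "invertible_object C g" "isomorphic C (g \<boxtimes>\<^sub>o\<^bsub>C\<^esub> X) Y"
      by blast
    then have "cl g \<star> x = y"
      using cl_eqI[OF g(2)] * simple_object_obj invertible_object_obj by (simp add: cl_tensor)
    then show "\<exists>g \<in> carrier (invertible_group C). left_tensor_action C g x = y"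
      using g E by (intro bexI[of _ "cl g"]) (auto simp: left_tensor_action_def carrier_invertible_group)
  qed
  then show "generalized_near_group C"
    using not_pointed fusion_category_axioms by (simp add: generalized_near_group_def)
qed

section \<open>Fusion subcategories\<close>

context fusion_category
begin

lemma fusion_subcategoryD:
  assumes "fusion_subcategory C A"
  shows "abelian_subcategory C A" "\<I> \<in> A" "X \<in> A \<Longrightarrow> Y \<in> A \<Longrightarrow> X \<boxtimes>\<^sub>o Y \<in> A"
    "X \<in> A \<Longrightarrow> left_dual C X Y \<Longrightarrow> Y \<in> A" "A \<subseteq> obj C" "X \<in> A \<Longrightarrow> X \<in> obj C"
    "retract C X Y \<Longrightarrow> Y \<in> A \<Longrightarrow> X \<in> A"
proof -
  show A: "abelian_subcategory C A" using assms by (simp add: fusion_subcategory_def)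
  show "\<I> \<in> A" "X \<in> A \<Longrightarrow> Y \<in> A \<Longrightarrow> X \<boxtimes>\<^sub>o Y \<in> A" "X \<in> A \<Longrightarrow> left_dual C X Y \<Longrightarrow> Y \<in> A"
    using assms by (auto simp: fusion_subcategory_def)
  show "A \<subseteq> obj C" using A by (simp add: abelian_subcategory_def)
  then show "X \<in> A \<Longrightarrow> X \<in> obj C" by blast
  show "retract C X Y \<Longrightarrow> Y \<in> A \<Longrightarrow> X \<in> A" by (rule abelian_subcategory_retract[OF A])
qed

lemma fusion_subcategory_isomorphic:
  assumes "fusion_subcategory C A" "Y \<in> A" "X \<in> obj C" "cl X = cl Y" shows "X \<in> A"
  using fusion_subcategoryD[OF assms(1)] assms(2-4) by (blast intro: isomorphic_retract cl_eqD)

text \<open>With Z a left dual of Y, the unit is a retract of Y \<otimes> Z, so u is a retract of (u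
  \<otimes> Y) \<otimes> Z.\<close>

lemma fusion_subcategory_left_factor:
  assumes "fusion_subcategory C A" "Y \<in> A" "\<not> zero_object C Y" "u \<in> obj C" "u \<boxtimes>\<^sub>o Y \<in> A"
  shows "u \<in> A"
proof -
  note A = fusion_subcategoryD[OF assms(1)]
  have Y: "Y \<in> obj C" using A(6) assms(2) .
  obtain Z where Z: "left_dual C Y Z" using left_dual_exists[OF Y] by blast
  then have ZA: "Z \<in> A" "Z \<in> obj C" using A(4)[OF assms(2)] A(6) by blast+
  have "isomorphic C u (u \<boxtimes>\<^sub>o \<I>)" using assms(4) by (intro cl_eqD) (simp_all add: cl_tensor)
  also have "retract C (u \<boxtimes>\<^sub>o \<I>) (u \<boxtimes>\<^sub>o (Y \<boxtimes>\<^sub>o Z))"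
    using retract_left_dual_unit[OF Z retract_refl[OF Y] assms(3)] assms(4) by (intro tensor_retract) simp_all
  also have "isomorphic C (u \<boxtimes>\<^sub>o (Y \<boxtimes>\<^sub>o Z)) ((u \<boxtimes>\<^sub>o Y) \<boxtimes>\<^sub>o Z)"
    using Y ZA assms(4) by (intro cl_eqD) (simp_all add: cl_tensor ct_assoc)
  finally show ?thesis using A(3)[OF assms(5) ZA(1)] A(7) by blast
qed

lemma fusion_subcategory_right_factor:
  assumes "fusion_subcategory C A" "Y \<in> A" "\<not> zero_object C Y" "u \<in> obj C" "Y \<boxtimes>\<^sub>o u \<in> A"
  shows "u \<in> A"
proof -
  note A = fusion_subcategoryD[OF assms(1)]
  have Y: "Y \<in> obj C" using A(6) assms(2) .
  obtain Z where Z: "left_dual C Y Z" using left_dual_exists[OF Y] by blast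
  then have ZA: "Z \<in> A" "Z \<in> obj C" using A(4)[OF assms(2)] A(6) by blast+
  have "isomorphic C u (\<I> \<boxtimes>\<^sub>o u)" using assms(4) by (intro cl_eqD) (simp_all add: cl_tensor)
  also have "retract C (\<I> \<boxtimes>\<^sub>o u) ((Z \<boxtimes>\<^sub>o Y) \<boxtimes>\<^sub>o u)"
    using left_dual_evaluation_unit[OF Z assms(3)] assms(4) by (intro tensor_retract) simp_all
  also have "isomorphic C ((Z \<boxtimes>\<^sub>o Y) \<boxtimes>\<^sub>o u) (Z \<boxtimes>\<^sub>o (Y \<boxtimes>\<^sub>o u))"
    using Y ZA assms(4) by (intro cl_eqD) (simp_all add: cl_tensor ct_assoc)
  finally show ?thesis using A(3)[OF ZA(1) assms(5)] A(7) by blast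
qed

lemma inverse_objects_nonzero: "inverse_objects u v \<Longrightarrow> \<not> zero_object C u"
  using invertible_simple inverse_objects_invertible simple_object_nonzero by blast

text \<open>Again by the left dual Z of Y, since only left duals are known to stay in
  \<open>A\<close>: the evaluation makes the unit a retract of Z \<otimes> Y, and u a retract of Z
  \<otimes> (Y \<otimes> u).\<close>

lemma fusion_subcategory_inverse:
  assumes "fusion_subcategory C A" "inverse_objects u v" "u \<in> A" shows "v \<in> A"
proof (rule fusion_subcategory_right_factor[OF assms(1,3)])
  note uv = inverse_objectsD[OF assms(2)]
  show "\<not> zero_object C u" by (rule inverse_objects_nonzero[OF assms(2)])
  show "v \<in> obj C" by (rule uv)
  show "u \<boxtimes>\<^sub>o v \<in> A"
    by (rule fusion_subcategory_isomorphic[OF assms(1) fusion_subcategoryD(2)[OF assms(1)]])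
      (use uv in \<open>simp_all add: cl_tensor\<close>)
qed

text \<open>Tensoring with the inverse of u exhibits that inverse as a retract of
  \<open>W\<close>.\<close>

lemma fusion_subcategory_unit_retract:
  assumes "fusion_subcategory C A" "invertible_object C u" "W \<in> A" "retract C \<I> (u \<boxtimes>\<^sub>o W)"
  shows "u \<in> A"
proof -
  note A = fusion_subcategoryD[OF assms(1)]
  obtain v where v: "inverse_objects u v" using assms(2) by (auto simp: invertible_object_iff)
  note uv = inverse_objectsD[OF v]
  have "isomorphic C v (v \<boxtimes>\<^sub>o \<I>)" using uv by (intro cl_eqD) (simp_all add: cl_tensor)
  also have "retract C (v \<boxtimes>\<^sub>o \<I>) W" by (rule retract_move_left[OF v assms(4) A(6)[OF assms(3)]])
  finally have "v \<in> A" using A(7) assms(3) by blast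
  then show ?thesis by (rule fusion_subcategory_inverse[OF assms(1) inverse_objects_sym[OF v]])
qed

text \<open>Asks for the whole product with some left dual, so it does not depend on the choice made
  by \<open>dual\<close>.\<close>

definition contains_adjoint :: "'o set \<Rightarrow> bool" where
  "contains_adjoint A \<longleftrightarrow> (\<forall>X. simple_object C X \<longrightarrow> (\<exists>Y. left_dual C X Y \<and> X \<boxtimes>\<^sub>o Y \<in> A))"

lemma left_dual_dual: "X \<in> obj C \<Longrightarrow> left_dual C X (dual C X)"
  unfolding dual_def using left_dual_exists by (rule someI_ex)

lemma left_dual_obj: "left_dual C X Y \<Longrightarrow> X \<in> obj C" "left_dual C X Y \<Longrightarrow> Y \<in> obj C"
  by (simp_all add: left_dual_def)

lemma constituentD:
  assumes "constituent C Y Z" shows "simple_object C Y" "retract C Y Z"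
  using assms is_direct_sum_retract unfolding constituent_def by blast+

lemma simple_retract_constituent:
  assumes "simple_object C S" "retract C S Z"
  obtains Y where "constituent C Y Z" "isomorphic C S Y"
proof -
  have "Z \<in> obj C" using assms(2) retract_obj by blast
  then obtain Xs where Xs: "\<forall>T \<in> set Xs. simple_object C T" "is_direct_sum C Z Xs"
    by (rule simple_sum_ex)
  then obtain Y where Y: "Y \<in> set Xs" "retract C S Y"
    using simple_retract_sum[OF assms] by blast
  show thesis
  proof (rule that)
    show "constituent C Y Z" unfolding constituent_def using Xs Y by blast
    show "isomorphic C S Y" using Xs(1) Y simple_retract_isomorphic[OF assms(1)] by blast
  qed
qed

lemma contains_adjointI:
  assumes "fusion_subcategory C A"
    "\<And>X Y. simple_object C X \<Longrightarrow> constituent C Y (X \<boxtimes>\<^sub>o dual C X) \<Longrightarrow> Y \<in> A"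
  shows "contains_adjoint A"
  unfolding contains_adjoint_def
proof (intro allI impI exI conjI)
  fix X assume X: "simple_object C X"
  then show ld: "left_dual C X (dual C X)" by (intro left_dual_dual simple_object_obj)
  show "X \<boxtimes>\<^sub>o dual C X \<in> A"
  proof (rule abelian_subcategory_simple_retracts[OF fusion_subcategoryD(1)[OF assms(1)]])
    show "X \<boxtimes>\<^sub>o dual C X \<in> obj C" using left_dual_obj[OF ld] by simp
    fix S assume "simple_object C S" "retract C S (X \<boxtimes>\<^sub>o dual C X)"
    then obtain Y where "constituent C Y (X \<boxtimes>\<^sub>o dual C X)" "isomorphic C S Y"
      by (rule simple_retract_constituent)
    then show "S \<in> A"
      using assms(2)[OF X] fusion_subcategoryD(7)[OF assms(1)] isomorphic_retract by blast
  qed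
qed

lemma fusion_subcategory_obj: "fusion_subcategory C (obj C)"
  unfolding fusion_subcategory_def
  using abelian_subcategory_of_simples[of "\<lambda>_. True"] left_dual_obj by simp

lemma abelian_subcategoryD:
  assumes "abelian_subcategory C A"
  shows "A \<subseteq> obj C" "zero_object C Z \<Longrightarrow> Z \<in> A"
    "X \<in> A \<Longrightarrow> Y \<in> A \<Longrightarrow> biproduct C Z X Y \<Longrightarrow> Z \<in> A"
proof -
  show "A \<subseteq> obj C" using assms unfolding abelian_subcategory_def by (elim conjE)
  have "\<forall>Z. zero_object C Z \<longrightarrow> Z \<in> A" using assms unfolding abelian_subcategory_def by (elim conjE)
  then show "zero_object C Z \<Longrightarrow> Z \<in> A" by blast
  have "\<forall>X \<in> A. \<forall>Y \<in> A. \<forall>Z. is_direct_sum C Z [X, Y] \<longrightarrow> Z \<in> A"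
    using assms unfolding abelian_subcategory_def by (elim conjE)
  then show "X \<in> A \<Longrightarrow> Y \<in> A \<Longrightarrow> biproduct C Z X Y \<Longrightarrow> Z \<in> A"
    unfolding is_direct_sum_two_iff by blast
qed

lemma abelian_subcategory_Inter:
  assumes "F \<noteq> {}" "\<And>A. A \<in> F \<Longrightarrow> abelian_subcategory C A"
  shows "abelian_subcategory C (\<Inter>F)"
proof (rule abelian_subcategoryI)
  obtain A where "A \<in> F" using assms(1) by blast
  then show "\<Inter>F \<subseteq> obj C" using abelian_subcategoryD(1)[OF assms(2)] Inter_lower by blast
  show "Z \<in> \<Inter>F" if "zero_object C Z" for Z
    using abelian_subcategoryD(2)[OF assms(2)] that by simp
  show "Z \<in> \<Inter>F" if "X \<in> \<Inter>F" "Y \<in> \<Inter>F" "biproduct C Z X Y" for X Y Z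
    using abelian_subcategoryD(3)[OF assms(2) _ _ that(3)] that(1,2) by simp
  show "X \<in> \<Inter>F" if "Y \<in> \<Inter>F" "retract C X Y" for X Y
    using abelian_subcategory_retract[OF assms(2) that(2)] that(1) by simp
qed

lemma fusion_subcategory_Inter:
  assumes "F \<noteq> {}" "\<And>A. A \<in> F \<Longrightarrow> fusion_subcategory C A"
  shows "fusion_subcategory C (\<Inter>F)"
  unfolding fusion_subcategory_def
proof (intro conjI ballI allI impI)
  show "abelian_subcategory C (\<Inter>F)"
    using assms(1) fusion_subcategoryD(1)[OF assms(2)] by (rule abelian_subcategory_Inter)
  show "\<I> \<in> \<Inter>F" using fusion_subcategoryD(2)[OF assms(2)] by simp
  show "X \<boxtimes>\<^sub>o Y \<in> \<Inter>F" if "X \<in> \<Inter>F" "Y \<in> \<Inter>F" for X Y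
    using fusion_subcategoryD(3)[OF assms(2)] that by simp
  show "Y \<in> \<Inter>F" if "X \<in> \<Inter>F" "left_dual C X Y" for X Y
    using fusion_subcategoryD(4)[OF assms(2) _ that(2)] that(1) by simp
qed

text \<open>The whole category belongs to the intersected family; without a member the intersection
  would be the universal set and not a set of objects.\<close>

lemma adjoint_subcategory_fusion: "fusion_subcategory C (adjoint_subcategory C)"
proof -
  have "Y \<in> obj C" if "constituent C Y Z" for Y Z
    using constituentD(1)[OF that] by (rule simple_object_obj)
  then show ?thesis
    unfolding adjoint_subcategory_def using fusion_subcategory_obj
    by (intro fusion_subcategory_Inter) blast+
qed

lemma adjoint_subcategory_constituent:
  "\<lbrakk>simple_object C X; constituent C Y (X \<boxtimes>\<^sub>o dual C X)\<rbrakk> \<Longrightarrow> Y \<in> adjoint_subcategory C"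
  unfolding adjoint_subcategory_def by blast

lemma adjoint_subcategory_least:
  assumes "fusion_subcategory C A"
    "\<And>X Y. simple_object C X \<Longrightarrow> constituent C Y (X \<boxtimes>\<^sub>o dual C X) \<Longrightarrow> Y \<in> A"
  shows "adjoint_subcategory C \<subseteq> A"
  unfolding adjoint_subcategory_def using assms by blast

lemma contains_adjoint_adjoint_subcategory: "contains_adjoint (adjoint_subcategory C)"
  by (rule contains_adjointI[OF adjoint_subcategory_fusion adjoint_subcategory_constituent])

end

section \<open>Duality and conjugation in a near-group category\<close>

context near_group_category
begin

text \<open>S \<otimes> g is again simple and non-invertible, so it lies in the left orbit of
  \<open>S\<close>. In this way a transitive left action also controls invertible factors on the
  right.\<close>

lemma noninvertible_commute:
  assumes "invertible_object C g" "simple_object C S" "\<not> invertible_object C S"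
  obtains h where "invertible_object C h" "cl S \<star> cl g = cl h \<star> cl S"
proof -
  have o: "S \<in> obj C" "g \<in> obj C"
    using assms by (simp_all add: simple_object_obj invertible_object_obj)
  obtain h where h: "invertible_object C h" "isomorphic C (h \<boxtimes>\<^sub>o S) (S \<boxtimes>\<^sub>o g)"
    using transitive[OF assms(2,3) tensor_invertible_simple(2)[OF assms(1,2)]
      tensor_noninvertible(2)[OF assms(1) o(1) assms(3)]] by blast
  show thesis
    by (rule that[OF h(1)]) (use cl_eqI[OF h(2)] o invertible_object_obj[OF h(1)] in \<open>simp add: cl_tensor\<close>)
qed

lemma transitive_cl:
  assumes "simple_object C X" "\<not> invertible_object C X" "simple_object C Y" "\<not> invertible_object C Y"
  obtains g where "invertible_object C g" "cl Y = cl g \<star> cl X"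
proof -
  obtain g where g: "invertible_object C g" "isomorphic C (g \<boxtimes>\<^sub>o X) Y" using transitive[OF assms] by blast
  show thesis
    by (rule that[OF g(1)])
      (use cl_eqI[OF g(2)] invertible_object_obj[OF g(1)] simple_object_obj[OF assms(1)] in \<open>simp add: cl_tensor\<close>)
qed

text \<open>A substitute for the fact that \<open>T\<close> is a dual of \<open>S\<close>: for non-invertible objects one has
  \<open>T = g \<otimes> S\<close> and \<open>S \<otimes> g = h \<otimes> S\<close>, so that \<open>1\<close> is a summand of \<open>h \<otimes> (S \<otimes> S)\<close>.\<close>

lemma fusion_subcategory_dual_simple:
  assumes A': "fusion_subcategory C A" and S: "simple_object C S" and T: "simple_object C T"
    and SA: "S \<in> A" and I: "retract C \<I> (S \<boxtimes>\<^sub>o T)"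
  shows "T \<in> A"
proof (cases "invertible_object C S \<or> invertible_object C T")
  case True
  then show ?thesis
    using unit_retract_invertible[OF S T I] fusion_subcategory_inverse[OF A' _ SA] by blast
next
  case False
  note A = fusion_subcategoryD[OF A']
  have o: "S \<in> obj C" "T \<in> obj C" using S T by (simp_all add: simple_object_obj)
  obtain g where g: "invertible_object C g" "cl T = cl g \<star> cl S"
    using transitive_cl[OF S _ T] False by blast
  obtain h where h: "invertible_object C h" "cl S \<star> cl g = cl h \<star> cl S"
    using noninvertible_commute[OF g(1) S] False by blast
  note gh = invertible_object_obj[OF g(1)] invertible_object_obj[OF h(1)]
  have "isomorphic C (S \<boxtimes>\<^sub>o T) (h \<boxtimes>\<^sub>o (S \<boxtimes>\<^sub>o S))"
  proof (rule cl_eqD)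
    have "cl (S \<boxtimes>\<^sub>o T) = (cl S \<star> cl g) \<star> cl S" using o gh by (simp add: cl_tensor g(2) ct_assoc)
    also have "\<dots> = cl (h \<boxtimes>\<^sub>o (S \<boxtimes>\<^sub>o S))" unfolding h(2) using o gh by (simp add: cl_tensor ct_assoc)
    finally show "cl (S \<boxtimes>\<^sub>o T) = cl (h \<boxtimes>\<^sub>o (S \<boxtimes>\<^sub>o S))" .
  qed (use o gh in simp_all)
  then have "retract C \<I> (h \<boxtimes>\<^sub>o (S \<boxtimes>\<^sub>o S))" using I by (rule retract_isomorphic(1)[rotated])
  \<comment> \<open>From here cancellation does the rest: h \<otimes> S is S \<otimes> g, so g lies
    in \<open>A\<close>, and then so does T = g \<otimes> S.\<close>
  then have "h \<in> A" using A(3)[OF SA SA] by (intro fusion_subcategory_unit_retract[OF A' h(1)])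
  then have "h \<boxtimes>\<^sub>o S \<in> A" using SA A(3) by blast
  then have "S \<boxtimes>\<^sub>o g \<in> A"
    by (rule fusion_subcategory_isomorphic[OF A']) (use o gh h(2) in \<open>simp_all add: cl_tensor\<close>)
  then have "g \<in> A"
    using fusion_subcategory_right_factor[OF A' SA simple_object_nonzero[OF S] gh(1)] by blast
  then have "g \<boxtimes>\<^sub>o S \<in> A" using SA A(3) by blast
  then show "T \<in> A"
    by (rule fusion_subcategory_isomorphic[OF A']) (use o gh g(2) in \<open>simp_all add: cl_tensor\<close>)
qed

text \<open>The hypothesis speaks of one left dual W, and \<open>T\<close> is not known to be a
  summand of it. But T = g \<otimes> T' for a simple summand T' of W, hence V \<otimes> T = h
  \<otimes> (V \<otimes> T'); the unit is a retract of this, which forces h into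
  \<open>A\<close>.\<close>

lemma contains_adjoint_tensor:
  assumes A': "fusion_subcategory C A" and "contains_adjoint A"
    and V: "simple_object C V" and T: "simple_object C T" and I: "retract C \<I> (V \<boxtimes>\<^sub>o T)"
  shows "V \<boxtimes>\<^sub>o T \<in> A"
proof (cases "invertible_object C V \<or> invertible_object C T")
  case True
  then have "inverse_objects V T" by (rule unit_retract_invertible[OF V T I])
  note VT = inverse_objectsD[OF this]
  show ?thesis
    by (rule fusion_subcategory_isomorphic[OF A' fusion_subcategoryD(2)[OF A']])
      (use VT in \<open>simp_all add: cl_tensor\<close>)
next
  case False
  note A = fusion_subcategoryD[OF A']
  have o: "V \<in> obj C" "T \<in> obj C" using V T by (simp_all add: simple_object_obj)
  obtain W where W: "left_dual C V W" "V \<boxtimes>\<^sub>o W \<in> A"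
    using assms(2) V unfolding contains_adjoint_def by blast
  have "\<not> zero_object C W"
    using retract_left_dual_unit[OF W(1) retract_refl[OF o(1)] simple_object_nonzero[OF V]]
      zero_object_tensor(2)[of W V] zero_object_retract[of \<I>] simple_object_nonzero[OF unit_simple] o by blast
  then obtain T' where T': "simple_object C T'" "retract C T' W"
    using simple_retract_ex left_dual_obj[OF W(1)] by blast
  have I': "retract C \<I> (V \<boxtimes>\<^sub>o T')"
    by (rule left_dual_retract_unit[OF W(1) T'(2) simple_object_nonzero[OF T'(1)]])
  have VT': "V \<boxtimes>\<^sub>o T' \<in> A"
    using A(7)[OF tensor_retract[OF retract_refl[OF o(1)] T'(2)] W(2)] .
  have o': "T' \<in> obj C" using T'(1) by (rule simple_object_obj)
  have "\<not> invertible_object C T'"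
    using unit_retract_invertible[OF V T'(1) I'] False inverse_objects_invertible by blast
  then obtain g where g: "invertible_object C g" "cl T = cl g \<star> cl T'"
    using transitive_cl[OF T'(1) _ T] False by blast
  obtain h where h: "invertible_object C h" "cl V \<star> cl g = cl h \<star> cl V"
    using noninvertible_commute[OF g(1) V] False by blast
  note gh = invertible_object_obj[OF g(1)] invertible_object_obj[OF h(1)]
  have e: "cl (V \<boxtimes>\<^sub>o T) = cl (h \<boxtimes>\<^sub>o (V \<boxtimes>\<^sub>o T'))"
  proof -
    have "cl (V \<boxtimes>\<^sub>o T) = (cl V \<star> cl g) \<star> cl T'" using o o' gh by (simp add: cl_tensor g(2) ct_assoc)
    also have "\<dots> = cl (h \<boxtimes>\<^sub>o (V \<boxtimes>\<^sub>o T'))" unfolding h(2) using o o' gh by (simp add: cl_tensor ct_assoc)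
    finally show ?thesis .
  qed
  then have "isomorphic C (V \<boxtimes>\<^sub>o T) (h \<boxtimes>\<^sub>o (V \<boxtimes>\<^sub>o T'))"
    by (rule cl_eqD) (use o o' gh in simp_all)
  then have "retract C \<I> (h \<boxtimes>\<^sub>o (V \<boxtimes>\<^sub>o T'))" using I by (rule retract_isomorphic(1)[rotated])
  then have "h \<in> A" using VT' by (intro fusion_subcategory_unit_retract[OF A' h(1)])
  then have "h \<boxtimes>\<^sub>o (V \<boxtimes>\<^sub>o T') \<in> A" using VT' A(3) by blast
  then show ?thesis
    by (rule fusion_subcategory_isomorphic[OF A']) (use o e in simp_all)
qed

text \<open>The objects whose conjugate lies in the adjoint subcategory form a fusion subcategory
  containing the generators, so minimality applies. Closure under duals is the delicate point, as
  conjugates of dual pairs are not shown to be dual pairs;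
  \<open>fusion_subcategory_dual_simple\<close> bridges the gap.\<close>

lemma adjoint_subcategory_conjugate:
  assumes uv': "inverse_objects u v" and "W \<in> adjoint_subcategory C"
  shows "(v \<boxtimes>\<^sub>o W) \<boxtimes>\<^sub>o u \<in> adjoint_subcategory C"
proof -
  let ?A = "adjoint_subcategory C"
  note A' = adjoint_subcategory_fusion
  note A = fusion_subcategoryD[OF A']
  note uv = inverse_objectsD[OF uv']
  have inv: "invertible_object C u" "invertible_object C v"
    using uv' inverse_objects_sym inverse_objects_invertible by blast+
  define c where "c W = (v \<boxtimes>\<^sub>o W) \<boxtimes>\<^sub>o u" for W
  have c_obj [simp]: "W \<in> obj C \<Longrightarrow> c W \<in> obj C" for W using uv by (simp add: c_def)
  have cl_c: "W \<in> obj C \<Longrightarrow> cl (c W) = cl v \<star> cl W \<star> cl u" for W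
    using uv by (simp add: c_def cl_tensor ct_assoc)
  have c_retract: "retract C (c X) (c Y)" if "retract C X Y" for X Y
    unfolding c_def using that uv by (intro tensor_retract) simp_all
  have c_simple: "simple_object C (c X)" if "simple_object C X" for X
    unfolding c_def using that inv tensor_invertible_simple by blast
  have c_tensor: "cl (c (X \<boxtimes>\<^sub>o Y)) = cl (c X \<boxtimes>\<^sub>o c Y)" if "X \<in> obj C" "Y \<in> obj C" for X Y
    using that uv by (simp add: cl_c cl_tensor ct_assoc)
  have c_unit: "cl (c \<I>) = cl \<I>" using uv by (simp add: cl_c)
  have c_unit_tensor: "retract C \<I> (c X \<boxtimes>\<^sub>o c Y)"
    if "retract C \<I> (X \<boxtimes>\<^sub>o Y)" "X \<in> obj C" "Y \<in> obj C" for X Y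
  proof -
    have "isomorphic C \<I> (c \<I>)" using c_unit by (intro cl_eqD) simp_all
    also have "retract C (c \<I>) (c (X \<boxtimes>\<^sub>o Y))" using that(1) by (rule c_retract)
    also have "isomorphic C (c (X \<boxtimes>\<^sub>o Y)) (c X \<boxtimes>\<^sub>o c Y)"
      using that c_tensor by (intro cl_eqD) simp_all
    finally show ?thesis .
  qed
  \<comment> \<open>Simple constituents of a conjugate are traced back to simple constituents of the
    original object, one tensor factor at a time.\<close>
  have c_simple_retract: "\<exists>T. simple_object C T \<and> retract C T X \<and> retract C R (c T)"
    if R: "simple_object C R" "retract C R (c X)" and X: "X \<in> obj C" for R X
  proof -
    from R obtain T where T: "simple_object C T" "retract C T (v \<boxtimes>\<^sub>o X)" "retract C R (T \<boxtimes>\<^sub>o u)"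
      unfolding c_def by (rule simple_retract_tensor_left) (use X uv in simp_all)
    from T(1,2) obtain T' where T': "simple_object C T'" "retract C T' X" "retract C T (v \<boxtimes>\<^sub>o T')"
      by (rule simple_retract_tensor_right) (use X uv in simp_all)
    have "retract C (T \<boxtimes>\<^sub>o u) (c T')" unfolding c_def using T'(3) uv by (intro tensor_retract) simp_all
    with T(3) have "retract C R (c T')" by (rule retract_trans)
    with T' show ?thesis by blast
  qed
  let ?B = "{W \<in> obj C. c W \<in> ?A}"
  have B: "fusion_subcategory C ?B"
    unfolding fusion_subcategory_def
  proof (intro conjI ballI allI impI)
    show "abelian_subcategory C ?B"
    proof (rule abelian_subcategoryI)
      fix Z assume Z: "zero_object C Z"
      then have "Z \<in> obj C" by (simp add: zero_object_def)
      moreover have "zero_object C (c Z)"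
        unfolding c_def using Z uv by (intro zero_object_tensor) simp_all
      ultimately show "Z \<in> ?B" using abelian_subcategoryD(2)[OF A(1)] by simp
    next
      fix X Y Z assume XY: "X \<in> ?B" "Y \<in> ?B" and Z: "biproduct C Z X Y"
      have cz: "biproduct C (c Z) (c X) (c Y)"
        unfolding c_def using Z uv by (intro biproduct_tensor_left biproduct_tensor_right)
      then show "Z \<in> ?B"
        using abelian_subcategoryD(3)[OF A(1) _ _ cz] XY biproduct_obj(3)[OF Z] by simp
    next
      fix X Y assume Y: "Y \<in> ?B" and XY: "retract C X Y"
      then show "X \<in> ?B" using A(7)[OF c_retract[OF XY]] retract_obj(1)[OF XY] by simp
    qed simp
    show "\<I> \<in> ?B" using fusion_subcategory_isomorphic[OF A' A(2) _ c_unit] by simp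
    show "X \<boxtimes>\<^sub>o Y \<in> ?B" if "X \<in> ?B" "Y \<in> ?B" for X Y
      using that A(3)[of "c X" "c Y"] fusion_subcategory_isomorphic[OF A' _ _ c_tensor] by simp
    fix X Y assume X: "X \<in> ?B" and XY: "left_dual C X Y"
    have Y: "Y \<in> obj C" "X \<in> obj C" using left_dual_obj[OF XY] by simp_all
    have "c Y \<in> ?A"
    proof (rule abelian_subcategory_simple_retracts[OF A(1)])
      fix R assume R: "simple_object C R" "retract C R (c Y)"
      obtain T where T: "simple_object C T" "retract C T Y" "retract C R (c T)"
        using c_simple_retract[OF R Y(1)] by blast
      have To: "T \<in> obj C" using T(1) by (rule simple_object_obj)
      \<comment> \<open>A simple summand T of the left dual is paired with a simple summand S of X
        having the unit in S \<otimes> T. Conjugation keeps the unit in the product, and c S already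
        lies in the adjoint subcategory.\<close>
      have "retract C \<I> (X \<boxtimes>\<^sub>o T)"
        by (rule left_dual_retract_unit[OF XY T(2) simple_object_nonzero[OF T(1)]])
      with unit_simple obtain S where S: "simple_object C S" "retract C S X" "retract C \<I> (S \<boxtimes>\<^sub>o T)"
        by (rule simple_retract_tensor_left) (use Y To in simp_all)
      have "c S \<in> ?A" using A(7)[OF c_retract[OF S(2)]] X by blast
      then have "c T \<in> ?A"
        using fusion_subcategory_dual_simple[OF A' c_simple[OF S(1)] c_simple[OF T(1)]]
          c_unit_tensor[OF S(3) simple_object_obj[OF S(1)] To] by blast
      then show "R \<in> ?A" using A(7)[OF T(3)] by blast
    qed (use Y in simp)
    then show "Y \<in> ?B" using Y by blast
  qed
  have "?A \<subseteq> ?B"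
  proof (rule adjoint_subcategory_least[OF B])
    fix X Y assume X: "simple_object C X" and "constituent C Y (X \<boxtimes>\<^sub>o dual C X)"
    then have Y: "simple_object C Y" "retract C Y (X \<boxtimes>\<^sub>o dual C X)" using constituentD by blast+
    have Xo: "X \<in> obj C" "left_dual C X (dual C X)" "dual C X \<in> obj C"
      using simple_object_obj[OF X] left_dual_dual left_dual_obj(2) by blast+
    have Yo: "Y \<in> obj C" using Y(1) by (rule simple_object_obj)
    from Y Xo(3,1) obtain T where T: "simple_object C T" "retract C T (dual C X)" "retract C Y (X \<boxtimes>\<^sub>o T)"
      by (rule simple_retract_tensor_right)
    have To: "T \<in> obj C" using T(1) by (rule simple_object_obj)
    \<comment> \<open>The pair c X, c T is again simple with the unit in its product, which is what
      \<open>contains_adjoint_tensor\<close> asks for in place of duality.\<close>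
    have "c X \<boxtimes>\<^sub>o c T \<in> ?A"
      using left_dual_retract_unit[OF Xo(2) T(2) simple_object_nonzero[OF T(1)]] Xo To
      by (intro contains_adjoint_tensor[OF A' contains_adjoint_adjoint_subcategory] c_simple X T(1)
        c_unit_tensor)
    then have "c (X \<boxtimes>\<^sub>o T) \<in> ?A"
      using fusion_subcategory_isomorphic[OF A' _ _ c_tensor] Xo To by simp
    then show "Y \<in> ?B" using A(7)[OF c_retract[OF T(3)]] Yo by blast
  qed
  then show ?thesis using assms(2) unfolding c_def by blast
qed

end

section \<open>Gradings\<close>

context fusion_category
begin

lemma biproduct_zero:
  assumes "zero_object C X" "zero_object C Z" shows "biproduct C X Z X"
proof -
  have "X \<in> obj C" "Z \<in> obj C" "ident C X = zero_arr C X X" "ident C Z = zero_arr C Z Z"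
    using assms by (simp_all add: zero_object_iff)
  then show ?thesis
    by (intro biproductI[of "zero_arr C Z X" _ _ "zero_arr C X X" _ "zero_arr C X Z" "zero_arr C X X"]) simp_all
qed

lemma is_direct_sum_zero:
  assumes "zero_object C X" "\<forall>Y \<in> set Xs. zero_object C Y" shows "is_direct_sum C X Xs"
  using assms(2)
proof (induction Xs)
  case Nil
  then show ?case using assms(1) by (simp add: is_direct_sum_Nil_iff)
next
  case (Cons Y Xs)
  then have "biproduct C X Y X" "is_direct_sum C X Xs" using biproduct_zero[OF assms(1)] by simp_all
  then show ?case by (rule is_direct_sum_ConsI)
qed

text \<open>Inserts one more summand into the component at index \<open>k\<close> of a graded
  decomposition; distinctness of the indices guarantees that exactly one entry changes.\<close>

lemma is_direct_sum_update:
  assumes "is_direct_sum C W (map Y hs)" "distinct hs" "k \<in> set hs" "biproduct C X S W"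
    "biproduct C Z S (Y k)"
  shows "is_direct_sum C X (map (Y(k := Z)) hs)"
  using assms(1-4)
proof (induction hs arbitrary: W X)
  case (Cons h hs)
  from Cons.prems(1) have "is_direct_sum C W (Y h # map Y hs)" by simp
  then obtain V where V: "biproduct C W (Y h) V" "is_direct_sum C V (map Y hs)"
    by (rule is_direct_sum_ConsE)
  show ?case
  proof (cases "h = k")
    case True
    have e: "map (Y(k := Z)) (h # hs) = Z # map Y hs" using Cons.prems(2) True by simp
    have "biproduct C X Z V"
      using biproduct_assoc[OF Cons.prems(4) V(1)] assms(5) True by simp
    then show ?thesis unfolding e using V(2) by (rule is_direct_sum_ConsI)
  next
    case False
    have o: "S \<in> obj C" "V \<in> obj C" "Y h \<in> obj C"
      using biproduct_obj[OF V(1)] biproduct_obj[OF Cons.prems(4)] by simp_all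
    obtain P U where PU: "biproduct C P S V" "biproduct C U S (Y h)"
      using biproduct_ex[OF o(1,2)] biproduct_ex[OF o(1,3)] by blast
    have "biproduct C X (Y h) P" by (rule biproduct_left_comm[OF Cons.prems(4) V(1) PU])
    moreover have "is_direct_sum C P (map (Y(k := Z)) hs)"
      using Cons.prems(2,3) False by (intro Cons.IH[OF V(2) _ _ PU(1)]) simp_all
    ultimately have "is_direct_sum C X (Y h # map (Y(k := Z)) hs)" by (rule is_direct_sum_ConsI)
    moreover have "map (Y(k := Z)) (h # hs) = Y h # map (Y(k := Z)) hs" using False by simp
    ultimately show ?thesis by (simp only:)
  qed
qed simp

text \<open>Only the degrees of simple retracts are inspected, so zero objects belong to every
  component, as an abelian subcategory demands.\<close>

definition component :: "('o \<Rightarrow> 'h) \<Rightarrow> 'h \<Rightarrow> 'o set" where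
  "component deg h = {X \<in> obj C. \<forall>S. simple_object C S \<and> retract C S X \<longrightarrow> deg S = h}"

lemma componentD:
  assumes "X \<in> component deg h"
  shows "X \<in> obj C" "simple_object C S \<Longrightarrow> retract C S X \<Longrightarrow> deg S = h"
  using assms by (simp_all add: component_def)

lemma componentI:
  "\<lbrakk>X \<in> obj C; \<And>S. simple_object C S \<Longrightarrow> retract C S X \<Longrightarrow> deg S = h\<rbrakk> \<Longrightarrow> X \<in> component deg h"
  by (simp add: component_def)

lemma component_abelian: "abelian_subcategory C (component deg h)"
  unfolding component_def by (rule abelian_subcategory_of_simples)

text \<open>By semisimplicity a grading amounts to a group-valued degree on simple objects that is
  multiplicative on the constituents of tensor products; faithfulness is surjectivity of the
  degree.\<close>

lemma faithful_grading_of_degree: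
  assumes H: "group H" "finite (carrier H)"
    and deg_carrier: "\<And>S. simple_object C S \<Longrightarrow> deg S \<in> carrier H"
    and deg_tensor: "\<And>R S T. simple_object C R \<Longrightarrow> simple_object C S \<Longrightarrow> simple_object C T \<Longrightarrow>
      retract C R (S \<boxtimes>\<^sub>o T) \<Longrightarrow> deg R = deg S \<otimes>\<^bsub>H\<^esub> deg T"
    and deg_onto: "\<And>h. h \<in> carrier H \<Longrightarrow> \<exists>S. simple_object C S \<and> deg S = h"
  shows "faithful_grading C H (component deg)"
proof -
  interpret H: group H by (rule H)
  have "retract C \<I> (\<I> \<boxtimes>\<^sub>o \<I>)"
    by (rule isomorphic_retract[OF isomorphic_sym[OF lunit_isomorphic]]) simp
  then have "deg \<I> = deg \<I> \<otimes>\<^bsub>H\<^esub> deg \<I>" by (rule deg_tensor[OF unit_simple unit_simple unit_simple])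
  then have deg_one: "deg \<I> = \<one>\<^bsub>H\<^esub>"
    using H.l_cancel_one[of "deg \<I>" "deg \<I>"] deg_carrier[OF unit_simple] by simp
  \<comment> \<open>Invariance under isomorphism is not a hypothesis: it is multiplicativity for S
    as a constituent of T \<otimes> 1.\<close>
  have deg_iso: "deg S = deg T" if "simple_object C S" "simple_object C T" "retract C S T" for S T
  proof -
    have "isomorphic C T (T \<boxtimes>\<^sub>o \<I>)"
      using that by (intro isomorphic_sym[OF runit_isomorphic] simple_object_obj)
    with that(3) have "retract C S (T \<boxtimes>\<^sub>o \<I>)" by (rule retract_isomorphic)
    then have "deg S = deg T \<otimes>\<^bsub>H\<^esub> deg \<I>" by (rule deg_tensor[OF that(1,2) unit_simple])
    then show ?thesis using deg_carrier[OF that(2)] by (simp add: deg_one)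
  qed
  have simple_component: "S \<in> component deg (deg S)" if "simple_object C S" for S
    using that deg_iso simple_object_obj by (intro componentI)
  have orth: "hom_set C X Y = {zero_arr C X Y}"
    if "g \<noteq> h" and X: "X \<in> component deg g" and Y: "Y \<in> component deg h" for g h X Y
  proof -
    have XY: "X \<in> obj C" "Y \<in> obj C" using componentD(1)[OF X] componentD(1)[OF Y] by simp_all
    have "f = zero_arr C X Y" if f: "f \<in> hom_set C X Y" for f
    proof (rule ccontr)
      have fa: "f \<in> arr C" "src C f = X" "tgt C f = Y" using f by (simp_all add: in_hom_iff)
      assume "f \<noteq> zero_arr C X Y"
      then have "f \<noteq> zero_arr C (src C f) (tgt C f)" using fa by simp
      with fa(1) obtain S where "simple_object C S" "retract C S (src C f)" "retract C S (tgt C f)"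
        by (rule nonzero_arr_common_retract)
      then show False
        using componentD(2)[OF X, of S] componentD(2)[OF Y, of S] fa(2,3) \<open>g \<noteq> h\<close> by simp
    qed
    then show ?thesis using zero_hom[OF XY] by blast
  qed
  have decomp: "\<exists>hs Y. distinct hs \<and> set hs = carrier H \<and> (\<forall>h \<in> carrier H. Y h \<in> component deg h) \<and>
      is_direct_sum C X (map Y hs)" if X: "X \<in> obj C" for X
  proof -
    obtain hs where hs: "distinct hs" "set hs = carrier H" using finite_distinct_list[OF H(2)] by blast
    obtain Xs where Xs: "\<forall>T \<in> set Xs. simple_object C T" "is_direct_sum C X Xs"
      by (rule simple_sum_ex[OF X])
    have "\<exists>Y. (\<forall>h \<in> carrier H. Y h \<in> component deg h) \<and> is_direct_sum C X (map Y hs)"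
      using Xs
    proof (induction Xs arbitrary: X)
      case Nil
      then have Z: "zero_object C X" by (simp add: is_direct_sum_Nil_iff)
      then have "\<forall>h \<in> carrier H. X \<in> component deg h"
        by (simp add: abelian_subcategoryD(2)[OF component_abelian])
      moreover have "is_direct_sum C X (map (\<lambda>_. X) hs)" using Z by (intro is_direct_sum_zero) simp_all
      ultimately show ?case by (intro exI[of _ "\<lambda>_. X"]) simp
    next
      case (Cons S Xs)
      obtain W where W: "biproduct C X S W" "is_direct_sum C W Xs"
        using Cons.prems(2) by (rule is_direct_sum_ConsE)
      obtain Y where Y: "\<forall>h \<in> carrier H. Y h \<in> component deg h" "is_direct_sum C W (map Y hs)"
        using Cons.IH[OF _ W(2)] Cons.prems(1) by auto
      have S: "simple_object C S" using Cons.prems(1) by simp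
      let ?k = "deg S"
      have k: "?k \<in> carrier H" using deg_carrier[OF S] .
      have Yk: "Y ?k \<in> component deg ?k" using Y(1) k by blast
      obtain Z where Z: "biproduct C Z S (Y ?k)"
        using biproduct_ex[OF simple_object_obj[OF S] componentD(1)[OF Yk]] by blast
      have "Z \<in> component deg ?k"
        by (rule abelian_subcategoryD(3)[OF component_abelian simple_component[OF S] Yk Z])
      moreover have "is_direct_sum C X (map (Y(?k := Z)) hs)"
        using is_direct_sum_update[OF Y(2) hs(1) _ W(1) Z] hs(2) k by blast
      ultimately show ?case using Y(1) by (intro exI[of _ "Y(?k := Z)"]) (simp add: fun_upd_def)
    qed
    with hs show ?thesis by blast
  qed
  have tensor: "X \<boxtimes>\<^sub>o Y \<in> component deg (g \<otimes>\<^bsub>H\<^esub> h)"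
    if X: "X \<in> component deg g" and Y: "Y \<in> component deg h" for g h X Y
  proof (rule componentI)
    have XY: "X \<in> obj C" "Y \<in> obj C" using componentD(1)[OF X] componentD(1)[OF Y] by simp_all
    then show "X \<boxtimes>\<^sub>o Y \<in> obj C" by simp
    fix R assume R: "simple_object C R" "retract C R (X \<boxtimes>\<^sub>o Y)"
    from R XY obtain S where S: "simple_object C S" "retract C S X" "retract C R (S \<boxtimes>\<^sub>o Y)"
      by (rule simple_retract_tensor_left)
    from R(1) S(3) XY(2) simple_object_obj[OF S(1)]
    obtain T where T: "simple_object C T" "retract C T Y" "retract C R (S \<boxtimes>\<^sub>o T)"
      by (rule simple_retract_tensor_right)
    show "deg R = g \<otimes>\<^bsub>H\<^esub> h"
      using deg_tensor[OF R(1) S(1) T(1,3)] componentD(2)[OF X S(1,2)] componentD(2)[OF Y T(1,2)] by simp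
  qed
  \<comment> \<open>The unit, of trivial degree, is a constituent of S \<otimes> T for a simple
    summand of one member of the dual pair and a suitable simple summand of the other, so the
    degrees are inverse. The reverse inclusion starts from an object having Y as its left
    dual.\<close>
  have dual: "{Y. \<exists>X \<in> component deg h. left_dual C X Y} = component deg (inv\<^bsub>H\<^esub> h)"
    if h: "h \<in> carrier H" for h
  proof (intro equalityI subsetI)
    fix Y assume "Y \<in> {Y. \<exists>X \<in> component deg h. left_dual C X Y}"
    then obtain X where X: "X \<in> component deg h" "left_dual C X Y" by blast
    show "Y \<in> component deg (inv\<^bsub>H\<^esub> h)"
    proof (rule componentI)
      show "Y \<in> obj C" using left_dual_obj[OF X(2)] by simp
      fix T assume T: "simple_object C T" "retract C T Y"
      have "retract C \<I> (X \<boxtimes>\<^sub>o T)"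
        by (rule left_dual_retract_unit[OF X(2) T(2) simple_object_nonzero[OF T(1)]])
      from unit_simple this componentD(1)[OF X(1)] simple_object_obj[OF T(1)]
      obtain S where S: "simple_object C S" "retract C S X" "retract C \<I> (S \<boxtimes>\<^sub>o T)"
        by (rule simple_retract_tensor_left)
      have "\<one>\<^bsub>H\<^esub> = h \<otimes>\<^bsub>H\<^esub> deg T"
        using deg_tensor[OF unit_simple S(1) T(1) S(3)] componentD(2)[OF X(1) S(1,2)] deg_one by simp
      then show "deg T = inv\<^bsub>H\<^esub> h" using H.inv_equality[of "deg T" h] H.inv_comm deg_carrier[OF T(1)] h by metis
    qed
  next
    fix Y assume Y: "Y \<in> component deg (inv\<^bsub>H\<^esub> h)"
    obtain X where X: "left_dual C X Y" using right_dual_exists[OF componentD(1)[OF Y]] by blast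
    have "X \<in> component deg h"
    proof (rule componentI)
      show "X \<in> obj C" using left_dual_obj[OF X] by simp
      fix S assume S: "simple_object C S" "retract C S X"
      have "retract C \<I> (S \<boxtimes>\<^sub>o Y)"
        by (rule retract_left_dual_unit[OF X S(2) simple_object_nonzero[OF S(1)]])
      from unit_simple this componentD(1)[OF Y] simple_object_obj[OF S(1)]
      obtain T where T: "simple_object C T" "retract C T Y" "retract C \<I> (S \<boxtimes>\<^sub>o T)"
        by (rule simple_retract_tensor_right)
      have "\<one>\<^bsub>H\<^esub> = deg S \<otimes>\<^bsub>H\<^esub> inv\<^bsub>H\<^esub> h"
        using deg_tensor[OF unit_simple S(1) T(1,3)] componentD(2)[OF Y T(1,2)] deg_one by simp
      then have "inv\<^bsub>H\<^esub> (inv\<^bsub>H\<^esub> h) = deg S" using h deg_carrier[OF S(1)] by (intro H.inv_equality) simp_all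
      then show "deg S = h" using h by simp
    qed
    then show "Y \<in> {Y. \<exists>X \<in> component deg h. left_dual C X Y}" using X by blast
  qed
  show ?thesis
    unfolding faithful_grading_def
  proof (intro conjI ballI impI H component_abelian)
    show "\<exists>X \<in> component deg h. \<not> zero_object C X" if "h \<in> carrier H" for h
      using deg_onto[OF that] simple_component simple_object_nonzero by blast
    show "hom_set C X Y = {zero_arr C X Y}"
      if "g \<noteq> h" "X \<in> component deg g" "Y \<in> component deg h" for g h X Y
      using that by (rule orth)
    show "\<exists>hs Y. distinct hs \<and> set hs = carrier H \<and> (\<forall>h \<in> carrier H. Y h \<in> component deg h) \<and>
      is_direct_sum C X (map Y hs)" if "X \<in> obj C" for X
      using that by (rule decomp)
    show "X \<boxtimes>\<^sub>o Y \<in> component deg (g \<otimes>\<^bsub>H\<^esub> h)"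
      if "X \<in> component deg g" "Y \<in> component deg h" for g h X Y
      using that by (rule tensor)
    show "{Y. \<exists>X \<in> component deg h. left_dual C X Y} = component deg (inv\<^bsub>H\<^esub> h)"
      if "h \<in> carrier H" for h
      using that by (rule dual)
  qed
qed

text \<open>A constant degree gives the one-component grading; conversely, if there is a single
  component, every object is a direct sum of objects from it.\<close>

lemma trivial_universal_grading_iff: "trivial_universal_grading C \<longleftrightarrow> adjoint_subcategory C = obj C"
proof
  assume "adjoint_subcategory C = obj C"
  define U :: "nat monoid" where "U = \<lparr>carrier = {0}, monoid.mult = \<lambda>_ _. 0, one = 0\<rparr>"
  have gU: "group U" unfolding U_def by (rule groupI) simp_all
  have U: "carrier U = {\<one>\<^bsub>U\<^esub>}" "finite (carrier U)" "0 \<otimes>\<^bsub>U\<^esub> 0 = 0" "\<one>\<^bsub>U\<^esub> = 0"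
    by (simp_all add: U_def)
  have "faithful_grading C U (component (\<lambda>_. 0))"
  proof (rule faithful_grading_of_degree[OF gU U(2)])
    show "\<exists>S. simple_object C S \<and> 0 = h" if "h \<in> carrier U" for h
      using unit_simple that U by auto
  qed (use U in simp_all)
  moreover have "component (\<lambda>_. 0) \<one>\<^bsub>U\<^esub> = adjoint_subcategory C"
    using \<open>adjoint_subcategory C = obj C\<close> U(4) by (simp add: component_def)
  ultimately show "trivial_universal_grading C"
    unfolding trivial_universal_grading_def universal_grading_def using U(1) by blast
next
  assume "trivial_universal_grading C"
  then obtain U :: "nat monoid" and Cs where U: "faithful_grading C U Cs"
    "Cs \<one>\<^bsub>U\<^esub> = adjoint_subcategory C" "carrier U = {\<one>\<^bsub>U\<^esub>}"
    unfolding trivial_universal_grading_def universal_grading_def by blast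
  have "obj C \<subseteq> Cs \<one>\<^bsub>U\<^esub>"
  proof
    fix X assume X: "X \<in> obj C"
    have A: "\<forall>h \<in> carrier U. abelian_subcategory C (Cs h)"
      using U(1) unfolding faithful_grading_def by (elim conjE)
    have "\<forall>X \<in> obj C. \<exists>hs Y. distinct hs \<and> set hs = carrier U \<and>
        (\<forall>h \<in> carrier U. Y h \<in> Cs h) \<and> is_direct_sum C X (map Y hs)"
      using U(1) unfolding faithful_grading_def by (elim conjE)
    with X obtain hs Y where "set hs = carrier U" "\<forall>h \<in> carrier U. Y h \<in> Cs h"
      "is_direct_sum C X (map Y hs)" by blast
    then show "X \<in> Cs \<one>\<^bsub>U\<^esub>"
      using A U(3) by (intro abelian_subcategory_sum[of _ X "map Y hs"]) auto
  qed
  then show "adjoint_subcategory C = obj C"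
    using U(2) fusion_subcategoryD(5)[OF adjoint_subcategory_fusion] by blast
qed

end

section \<open>The grading with the adjoint subcategory as trivial component\<close>

context near_group_category
begin

lemma grading_over_adjoint_subcategory:
  assumes X0: "simple_object C X" "\<not> invertible_object C X" "X \<in> adjoint_subcategory C"
  shows "\<exists>(H :: nat monoid) Cs. faithful_grading C H Cs \<and> Cs \<one>\<^bsub>H\<^esub> = adjoint_subcategory C"
proof -
  let ?A = "adjoint_subcategory C"
  let ?G = "invertible_group C"
  note A' = adjoint_subcategory_fusion
  note A = fusion_subcategoryD[OF A']
  interpret G: group ?G by (rule invertible_group_group)
  have inv_cl: "inv\<^bsub>?G\<^esub> (cl u) = cl v" if "inverse_objects u v" for u v
  proof (rule G.inv_equality)
    show "cl v \<otimes>\<^bsub>?G\<^esub> cl u = \<one>\<^bsub>?G\<^esub>" using inverse_objectsD(4)[OF that] by simp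
    show "cl u \<in> carrier ?G" "cl v \<in> carrier ?G"
      using inverse_objects_invertible[OF that] inverse_objects_invertible[OF inverse_objects_sym[OF that]]
      by (auto simp: carrier_invertible_group)
  qed
  have carrierE: "\<exists>u v. a = cl u \<and> inverse_objects u v" if "a \<in> carrier ?G" for a
    using that by (auto simp: carrier_invertible_group invertible_object_iff)
  \<comment> \<open>The adjoint subcategory is closed under isomorphism, so a class is contained in
    it as soon as one representative is. Normality of \<open>N\<close> is stability under
    conjugation.\<close>
  define N where "N = {a \<in> carrier ?G. a \<subseteq> ?A}"
  have cl_N: "cl u \<in> N \<longleftrightarrow> u \<in> ?A" if "inverse_objects u v" for u v
  proof -
    have u: "u \<in> obj C" "cl u \<in> carrier ?G"
      using inverse_objectsD(1)[OF that] inverse_objects_invertible[OF that]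
      by (auto simp: carrier_invertible_group)
    have "cl u \<subseteq> ?A \<longleftrightarrow> u \<in> ?A"
    proof
      show "cl u \<subseteq> ?A \<Longrightarrow> u \<in> ?A" using isomorphic_refl[OF u(1)] unfolding iso_class_def by blast
      show "u \<in> ?A \<Longrightarrow> cl u \<subseteq> ?A"
        using A(7) isomorphic_retract isomorphic_sym unfolding iso_class_def by blast
    qed
    then show ?thesis using u by (simp add: N_def)
  qed
  have N_E: "\<exists>u v. a = cl u \<and> inverse_objects u v \<and> u \<in> ?A" if a: "a \<in> N" for a
  proof -
    have "a \<in> carrier ?G" using a by (simp add: N_def)
    from carrierE[OF this] obtain u v where uv: "a = cl u" "inverse_objects u v" by blast
    then show ?thesis using a cl_N[OF uv(2)] by blast
  qed
  have N: "N \<lhd> ?G"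
  proof (rule G.normal_invI)
    show "subgroup N ?G"
    proof (rule G.subgroupI)
      show "N \<subseteq> carrier ?G" by (auto simp: N_def)
      have "inverse_objects \<I> \<I>" by (simp add: inverse_objects_def)
      then show "N \<noteq> {}" using cl_N A(2) by blast
    next
      fix a assume "a \<in> N"
      from N_E[OF this] obtain u v where uv: "a = cl u" "inverse_objects u v" "u \<in> ?A" by blast
      have "v \<in> ?A" by (rule fusion_subcategory_inverse[OF A' uv(2,3)])
      then show "inv\<^bsub>?G\<^esub> a \<in> N"
        using inv_cl[OF uv(2)] uv(1) cl_N[OF inverse_objects_sym[OF uv(2)]] by simp
    next
      fix a b assume ab: "a \<in> N" "b \<in> N"
      obtain u v where uv: "a = cl u" "inverse_objects u v" "u \<in> ?A" using N_E[OF ab(1)] by blast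
      obtain w z where wz: "b = cl w" "inverse_objects w z" "w \<in> ?A" using N_E[OF ab(2)] by blast
      have "cl (u \<boxtimes>\<^sub>o w) \<in> N"
        using cl_N[OF inverse_objects_tensor[OF uv(2) wz(2)]] A(3)[OF uv(3) wz(3)] by simp
      then show "a \<otimes>\<^bsub>?G\<^esub> b \<in> N"
        using uv(1) wz(1) inverse_objectsD(1)[OF uv(2)] inverse_objectsD(1)[OF wz(2)] by (simp add: cl_tensor)
    qed
  next
    fix x h assume xh: "x \<in> carrier ?G" "h \<in> N"
    obtain u v where uv: "x = cl u" "inverse_objects u v" using carrierE[OF xh(1)] by blast
    obtain w z where wz: "h = cl w" "inverse_objects w z" "w \<in> ?A" using N_E[OF xh(2)] by blast
    have "(u \<boxtimes>\<^sub>o w) \<boxtimes>\<^sub>o v \<in> ?A"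
      by (rule adjoint_subcategory_conjugate[OF inverse_objects_sym[OF uv(2)] wz(3)])
    then have "cl ((u \<boxtimes>\<^sub>o w) \<boxtimes>\<^sub>o v) \<in> N"
      using cl_N[OF inverse_objects_tensor[OF inverse_objects_tensor[OF uv(2) wz(2)] inverse_objects_sym[OF uv(2)]]]
      by simp
    then show "x \<otimes>\<^bsub>?G\<^esub> h \<otimes>\<^bsub>?G\<^esub> inv\<^bsub>?G\<^esub> x \<in> N"
      using uv(1) wz(1) inv_cl[OF uv(2)] inverse_objectsD(1,2)[OF uv(2)] inverse_objectsD(1)[OF wz(2)]
      by (simp add: cl_tensor)
  qed
  interpret N: normal N ?G by (rule N)
  have fin: "finite (carrier ?G)"
    by (rule finite_subset[OF _ finitely_many_simples])
      (use invertible_simple in \<open>auto simp: carrier_invertible_group Irr_def\<close>)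
  \<comment> \<open>\<open>extension_of\<close> wants a group on natural numbers. The finitely many
    cosets are numbered injectively; since \<open>f\<close> then identifies exactly the elements of
    equal cosets, \<open>image_group\<close> transports the quotient structure along it.\<close>
  obtain e :: "'o set set \<Rightarrow> nat" where e: "inj_on e (rcosets\<^bsub>?G\<^esub> N)"
    using finite_imp_inj_to_nat_seg[of "rcosets\<^bsub>?G\<^esub> N"] fin
    by (auto simp: RCOSETS_def)
  define f where "f a = e (N #>\<^bsub>?G\<^esub> a)" for a
  have f_eq: "f a = f b \<longleftrightarrow> a \<otimes>\<^bsub>?G\<^esub> inv\<^bsub>?G\<^esub> b \<in> N" if "a \<in> carrier ?G" "b \<in> carrier ?G" for a b
  proof -
    have "f a = f b \<longleftrightarrow> N #>\<^bsub>?G\<^esub> a = N #>\<^bsub>?G\<^esub> b"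
      unfolding f_def using e that G.rcosetsI[OF N.subset] by (auto dest: inj_onD)
    also have "\<dots> \<longleftrightarrow> a \<in> N #>\<^bsub>?G\<^esub> b"
      using G.repr_independence[OF _ that(2) N.subgroup_axioms] G.rcos_self[OF that(1) N.subgroup_axioms]
      by metis
    also have "\<dots> \<longleftrightarrow> a \<otimes>\<^bsub>?G\<^esub> inv\<^bsub>?G\<^esub> b \<in> N"
      using N.rcos_module[OF G.is_group that(2,1)] .
    finally show ?thesis .
  qed
  have f: "weak_group_morphism f N ?G"
    using N f_eq by (rule weak_group_morphismsI)
  define H where "H = image_group f ?G"
  interpret f: group_hom ?G H f unfolding H_def by (rule G.weak_group_morphism_group_hom[OF f])
  have H: "group H" "finite (carrier H)" "carrier H = f ` carrier ?G" "\<one>\<^bsub>H\<^esub> = f (cl \<I>)"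
    using fin f.H.is_group by (simp_all add: H_def image_group_carrier image_group_one)
  \<comment> \<open>The unit and \<open>X\<close> lie in the adjoint subcategory, and every simple
    object is an invertible multiple of one of them.\<close>
  have ex_deg: "\<exists>u v. inverse_objects u v \<and> v \<boxtimes>\<^sub>o S \<in> ?A" if S: "simple_object C S" for S
  proof (cases "invertible_object C S")
    case True
    then obtain v where v: "inverse_objects S v" by (auto simp: invertible_object_iff)
    note v' = inverse_objectsD[OF v]
    have "v \<boxtimes>\<^sub>o S \<in> ?A"
      by (rule fusion_subcategory_isomorphic[OF A' A(2)]) (use v' in \<open>simp_all add: cl_tensor\<close>)
    then show ?thesis using v by blast
  next
    case False
    obtain g where g: "invertible_object C g" "cl S = cl g \<star> cl X"
      by (rule transitive_cl[OF X0(1,2) S False])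
    obtain v where v: "inverse_objects g v" using g(1) by (auto simp: invertible_object_iff)
    note v' = inverse_objectsD[OF v]
    have "v \<boxtimes>\<^sub>o S \<in> ?A"
      by (rule fusion_subcategory_isomorphic[OF A' X0(3)])
        (use v' simple_object_obj[OF S] simple_object_obj[OF X0(1)] in \<open>simp_all add: cl_tensor g(2)\<close>)
    then show ?thesis using v by blast
  qed
  define deg where "deg S = (SOME d. \<exists>u v. inverse_objects u v \<and> v \<boxtimes>\<^sub>o S \<in> ?A \<and> d = f (cl u))" for S
  \<comment> \<open>Independence of the choice: let w, with inverse z, be another candidate.
    Cancelling v \<otimes> S from z \<otimes> S = (z \<otimes> u) \<otimes> (v \<otimes> S) puts z
    \<otimes> u into the subcategory, hence also its inverse v \<otimes> w, and conjugation by u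
    turns this into w \<otimes> v, which represents the quotient of the two classes.\<close>
  have deg: "deg S = f (cl u)" if S: "simple_object C S" and uv: "inverse_objects u v" "v \<boxtimes>\<^sub>o S \<in> ?A" for S u v
  proof -
    have So: "S \<in> obj C" using S by (rule simple_object_obj)
    have "\<exists>d u v. inverse_objects u v \<and> v \<boxtimes>\<^sub>o S \<in> ?A \<and> d = f (cl u)" using uv by blast
    then have "\<exists>u v. inverse_objects u v \<and> v \<boxtimes>\<^sub>o S \<in> ?A \<and> deg S = f (cl u)"
      unfolding deg_def by (rule someI_ex)
    then obtain w z where wz: "inverse_objects w z" "z \<boxtimes>\<^sub>o S \<in> ?A" "deg S = f (cl w)" by blast
    note u = inverse_objectsD[OF uv(1)] and w = inverse_objectsD[OF wz(1)]
    have "(z \<boxtimes>\<^sub>o u) \<boxtimes>\<^sub>o (v \<boxtimes>\<^sub>o S) \<in> ?A"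
      by (rule fusion_subcategory_isomorphic[OF A' wz(2)]) (use u w So in \<open>simp_all add: cl_tensor ct_assoc\<close>)
    moreover have "\<not> zero_object C (v \<boxtimes>\<^sub>o S)"
      using inverse_objects_invertible[OF inverse_objects_sym[OF uv(1)]] S
      by (intro simple_object_nonzero tensor_invertible_simple(1))
    ultimately have "z \<boxtimes>\<^sub>o u \<in> ?A"
      using fusion_subcategory_left_factor[OF A' uv(2)] u w by simp
    then have "v \<boxtimes>\<^sub>o w \<in> ?A"
      by (rule fusion_subcategory_inverse[OF A' inverse_objects_tensor[OF inverse_objects_sym[OF wz(1)] uv(1)]])
    then have c: "(u \<boxtimes>\<^sub>o (v \<boxtimes>\<^sub>o w)) \<boxtimes>\<^sub>o v \<in> ?A"
      by (rule adjoint_subcategory_conjugate[OF inverse_objects_sym[OF uv(1)]])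
    have "w \<boxtimes>\<^sub>o v \<in> ?A"
      by (rule fusion_subcategory_isomorphic[OF A' c]) (use u w in \<open>simp_all add: cl_tensor ct_assoc\<close>)
    then have "cl w \<otimes>\<^bsub>?G\<^esub> inv\<^bsub>?G\<^esub> (cl u) \<in> N"
      using cl_N[OF inverse_objects_tensor[OF wz(1) inverse_objects_sym[OF uv(1)]]] inv_cl[OF uv(1)] u w
      by (simp add: cl_tensor)
    then show ?thesis
      unfolding wz(3) using uv(1) wz(1) inverse_objects_invertible
      by (subst f_eq) (auto simp: carrier_invertible_group)
  qed
  have carrier_cl: "cl u \<in> carrier ?G" if "inverse_objects u v" for u v
    using inverse_objects_invertible[OF that] by (auto simp: carrier_invertible_group)
  have "faithful_grading C H (component deg)"
  proof (rule faithful_grading_of_degree[OF H(1,2)])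
    fix S assume S: "simple_object C S"
    obtain u v where "inverse_objects u v" "v \<boxtimes>\<^sub>o S \<in> ?A" using ex_deg[OF S] by blast
    then show "deg S \<in> carrier H" using deg[OF S] carrier_cl H(3) by simp
  next
    fix R S T assume R: "simple_object C R" and S: "simple_object C S" and T: "simple_object C T"
      and RST: "retract C R (S \<boxtimes>\<^sub>o T)"
    obtain u v w z where uv: "inverse_objects u v" "v \<boxtimes>\<^sub>o S \<in> ?A" and wz: "inverse_objects w z" "z \<boxtimes>\<^sub>o T \<in> ?A"
      using ex_deg[OF S] ex_deg[OF T] by blast
    note u = inverse_objectsD[OF uv(1)] and w = inverse_objectsD[OF wz(1)]
    note o = simple_object_obj[OF R] simple_object_obj[OF S] simple_object_obj[OF T]
    \<comment> \<open>Inserting w \<otimes> z between S and T splits z \<otimes> v \<otimes> S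
      \<otimes> T into a conjugate of v \<otimes> S and the object z \<otimes> T. Since z \<otimes>
      v is inverse to u \<otimes> w, the latter represents the degree of every constituent
      R.\<close>
    have "((z \<boxtimes>\<^sub>o (v \<boxtimes>\<^sub>o S)) \<boxtimes>\<^sub>o w) \<boxtimes>\<^sub>o (z \<boxtimes>\<^sub>o T) \<in> ?A"
      using adjoint_subcategory_conjugate[OF wz(1) uv(2)] wz(2) by (rule A(3))
    then have ST: "(z \<boxtimes>\<^sub>o v) \<boxtimes>\<^sub>o (S \<boxtimes>\<^sub>o T) \<in> ?A"
      by (rule fusion_subcategory_isomorphic[OF A']) (use u w o in \<open>simp_all add: cl_tensor ct_assoc\<close>)
    have "retract C ((z \<boxtimes>\<^sub>o v) \<boxtimes>\<^sub>o R) ((z \<boxtimes>\<^sub>o v) \<boxtimes>\<^sub>o (S \<boxtimes>\<^sub>o T))"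
      using RST u w by (intro tensor_retract) simp_all
    then have "(z \<boxtimes>\<^sub>o v) \<boxtimes>\<^sub>o R \<in> ?A" using ST by (rule A(7))
    then have "deg R = f (cl (u \<boxtimes>\<^sub>o w))" by (rule deg[OF R inverse_objects_tensor[OF uv(1) wz(1)]])
    also have "\<dots> = f (cl u \<otimes>\<^bsub>?G\<^esub> cl w)" using u w by (simp add: cl_tensor)
    also have "\<dots> = f (cl u) \<otimes>\<^bsub>H\<^esub> f (cl w)"
      using carrier_cl[OF uv(1)] carrier_cl[OF wz(1)] by (rule f.hom_mult)
    also have "\<dots> = deg S \<otimes>\<^bsub>H\<^esub> deg T" using deg[OF S uv] deg[OF T wz] by simp
    finally show "deg R = deg S \<otimes>\<^bsub>H\<^esub> deg T" .
  next
    fix h assume "h \<in> carrier H"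
    then obtain u v where uv: "h = f (cl u)" "inverse_objects u v" using H(3) carrierE by blast
    note u = inverse_objectsD[OF uv(2)]
    have "v \<boxtimes>\<^sub>o u \<in> ?A"
      by (rule fusion_subcategory_isomorphic[OF A' A(2)]) (use u in \<open>simp_all add: cl_tensor\<close>)
    moreover have "simple_object C u" using uv(2) inverse_objects_invertible invertible_simple by blast
    ultimately show "\<exists>S. simple_object C S \<and> deg S = h" using deg uv by blast
  qed
  moreover have "component deg \<one>\<^bsub>H\<^esub> = ?A"
  proof -
    have unit: "inverse_objects \<I> \<I>" by (simp add: inverse_objects_def)
    have "deg S = \<one>\<^bsub>H\<^esub> \<longleftrightarrow> S \<in> ?A" if S: "simple_object C S" for S
    proof
      have So: "S \<in> obj C" using S by (rule simple_object_obj)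
      assume "deg S = \<one>\<^bsub>H\<^esub>"
      moreover obtain u v where uv: "inverse_objects u v" "v \<boxtimes>\<^sub>o S \<in> ?A" using ex_deg[OF S] by blast
      note u = inverse_objectsD[OF uv(1)]
      ultimately have "f (cl u) = f (cl \<I>)" using deg[OF S uv] H(4) by simp
      then have "cl u \<otimes>\<^bsub>?G\<^esub> inv\<^bsub>?G\<^esub> (cl \<I>) \<in> N"
        using f_eq[OF carrier_cl[OF uv(1)] carrier_cl[OF unit]] by simp
      then have "u \<in> ?A" using cl_N[OF uv(1)] inv_cl[OF unit] u(1) by simp
      then have "u \<boxtimes>\<^sub>o (v \<boxtimes>\<^sub>o S) \<in> ?A" using uv(2) by (rule A(3))
      then show "S \<in> ?A"
        by (rule fusion_subcategory_isomorphic[OF A']) (use u So in \<open>simp_all add: cl_tensor\<close>)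
    next
      assume SA: "S \<in> ?A"
      then have "\<I> \<boxtimes>\<^sub>o S \<in> ?A" using A(2,3) by blast
      then show "deg S = \<one>\<^bsub>H\<^esub>" using deg[OF S unit] H(4) by simp
    qed
    then have "X \<in> component deg \<one>\<^bsub>H\<^esub> \<longleftrightarrow> X \<in> ?A" for X
      using abelian_subcategory_simple_retracts[OF A(1), of X] A(6,7) unfolding component_def by blast
    then show ?thesis by blast
  qed
  ultimately show ?thesis by blast
qed

end

section \<open>Full fusion subcategories\<close>

lemma full_sub_simps:
  "obj (full_sub C A) = obj C \<inter> A"
  "arr (full_sub C A) = {f \<in> arr C. src C f \<in> A \<and> tgt C f \<in> A}"
  "src (full_sub C A) = src C" "tgt (full_sub C A) = tgt C" "ident (full_sub C A) = ident C"
  "cmp (full_sub C A) = cmp C" "zero_arr (full_sub C A) = zero_arr C"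
  "plus_arr (full_sub C A) = plus_arr C" "scale_arr (full_sub C A) = scale_arr C"
  "tensor_obj (full_sub C A) = tensor_obj C" "tensor_arr (full_sub C A) = tensor_arr C"
  "unit_obj (full_sub C A) = unit_obj C" "assoc (full_sub C A) = assoc C"
  "lunit (full_sub C A) = lunit C" "runit (full_sub C A) = runit C"
  by (simp_all add: full_sub_def)

text \<open>The second assumption is separate because \<open>fusion_subcategory\<close> provides
  left duals, while the full subcategory has to satisfy both duality axioms of
  \<open>fusion_category\<close>.\<close>

locale full_fusion_subcategory = fusion_category C
  for C :: "('o, 'm, 'k::{alg_closed_field, field_char_0}) lin_mon_cat" (structure) +
  fixes A :: "'o set"
  assumes fusion_subcategory: "fusion_subcategory C A"
    and right_dual_closed: "Y \<in> A \<Longrightarrow> \<exists>X \<in> A. left_dual C X Y"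
begin

abbreviation D :: "('o, 'm, 'k) lin_mon_cat" where "D \<equiv> full_sub C A"

lemmas subD = fusion_subcategoryD[OF fusion_subcategory]

lemma D_simps:
  "obj D = A" "arr D = {f \<in> arr C. src C f \<in> A \<and> tgt C f \<in> A}" "src D = src C" "tgt D = tgt C"
  "ident D = ident C" "cmp D = cmp C" "zero_arr D = zero_arr C" "plus_arr D = plus_arr C"
  "scale_arr D = scale_arr C" "tensor_obj D = tensor_obj C" "tensor_arr D = tensor_arr C"
  "unit_obj D = unit_obj C" "assoc D = assoc C" "lunit D = lunit C" "runit D = runit C"
  using subD(5) by (auto simp: full_sub_simps)

lemma hom_D_iff: "f \<in> hom_set D X Y \<longleftrightarrow> f \<in> hom_set C X Y \<and> X \<in> A \<and> Y \<in> A"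
  by (auto simp: hom_set_def D_simps)

lemma hom_D_eq: "X \<in> A \<Longrightarrow> Y \<in> A \<Longrightarrow> hom_set D X Y = hom_set C X Y"
  using hom_D_iff by blast

lemma D_linear: "linear_category D"
proof (unfold_locales; unfold D_simps hom_D_iff; (elim conjE)?)
qed (use subD(2,3,6) in \<open>simp_all add: ident_hom zero_hom plus_zero scale_one cmp_ident_left
      cmp_ident_right hom_D_eq plus_inverse\<close>,
    (rule conjI cmp_hom plus_hom scale_hom cmp_assoc plus_assoc plus_comm scale_scale scale_add_left
      scale_add_right cmp_plus_left cmp_plus_right cmp_scale_left cmp_scale_right; assumption)+)

lemma inverse_arrs_D_iff:
  "inverse_arrs D f g \<longleftrightarrow> inverse_arrs C f g \<and> src C f \<in> A \<and> tgt C f \<in> A"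
  unfolding inverse_arrs_def hom_D_iff D_simps by blast

lemma iso_arr_D_iff: "iso_arr D f \<longleftrightarrow> iso_arr C f \<and> src C f \<in> A \<and> tgt C f \<in> A"
  unfolding iso_arr_def inverse_arrs_D_iff by blast

lemma inv_arr_D_eq:
  assumes "iso_arr C f" "src C f \<in> A" "tgt C f \<in> A" shows "inv_arr D f = inv_arr C f"
  using assms by (simp add: inv_arr_def inverse_arrs_D_iff)

lemma D_monoidal: "linear_monoidal_category D"
proof (rule linear_monoidal_category.intro[OF D_linear],
    unfold_locales; unfold D_simps hom_D_iff iso_arr_D_iff; (elim conjE)?)
qed (use subD(2,3,6) in \<open>simp_all add: assoc_hom assoc_iso lunit_hom runit_hom lunit_iso runit_iso
      triangle pentagon\<close>,
    (rule tensor_hom tensor_cmp[symmetric] tensor_cmp tensor_plus_left tensor_plus_right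
      tensor_scale_left tensor_scale_right assoc_natural lunit_natural runit_natural; assumption)+)

lemma zero_object_D_iff: "zero_object D Z \<longleftrightarrow> zero_object C Z \<and> Z \<in> A"
  unfolding linear_category.zero_object_iff[OF D_linear] zero_object_iff D_simps using subD(6) by blast

lemma sum_arrs_D: "sum_arrs D = sum_arrs C"
  by (intro ext) (simp add: sum_arrs_def D_simps)

lemma is_direct_sum_D_iff:
  "is_direct_sum D S Xs \<longleftrightarrow> is_direct_sum C S Xs \<and> S \<in> A \<and> set Xs \<subseteq> A"
proof
  assume "is_direct_sum D S Xs"
  then show "is_direct_sum C S Xs \<and> S \<in> A \<and> set Xs \<subseteq> A"
    unfolding is_direct_sum_def hom_D_iff sum_arrs_D D_simps using subD(5) by blast
next
  assume S: "is_direct_sum C S Xs \<and> S \<in> A \<and> set Xs \<subseteq> A"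
  then have "\<forall>i < length Xs. Xs ! i \<in> A" using nth_mem by blast
  with S show "is_direct_sum D S Xs"
    unfolding is_direct_sum_def hom_D_iff sum_arrs_D D_simps by blast
qed

text \<open>A mono of the subcategory is tested only against objects of \<open>A\<close>. The kernel
  in the ambient category is a retract of the source, so its object lies in \<open>A\<close> and the
  test applies to the kernel arrow itself, which must be zero.\<close>

lemma mono_arr_D_iff: "mono_arr D m \<longleftrightarrow> mono_arr C m \<and> src C m \<in> A \<and> tgt C m \<in> A"
proof
  assume m: "mono_arr D m"
  then have ma: "m \<in> arr C" "src C m \<in> A" "tgt C m \<in> A" by (simp_all add: mono_arr_def D_simps)
  interpret D: linear_category D by (rule D_linear)
  obtain i where i: "is_kernel C m i" using kernel_exists[OF ma(1)] by blast
  have ia: "i \<in> arr C" "tgt C i = src C m" "m \<cdot> i = zero_arr C (src C i) (tgt C m)" "mono_arr C i"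
    by (rule is_kernelE[OF i]; simp)+
  have "retract C (src C i) (src C m)" using mono_retract[OF ia(4)] ia(2) by simp
  then have iA: "src C i \<in> A" using ma(2) by (rule subD(7))
  have z: "i = zero_arr C (src C i) (src C m)"
  proof (rule D.mono_arrD[OF m, unfolded D_simps])
    show "m \<cdot> i = m \<cdot> zero_arr C (src C i) (src C m)" using ia ma by simp
  qed (use ia ma iA in simp_all)
  have "mono_arr C m" by (rule mono_if_kernel_zero[OF i z])
  then show "mono_arr C m \<and> src C m \<in> A \<and> tgt C m \<in> A" using ma by blast
next
  assume m: "mono_arr C m \<and> src C m \<in> A \<and> tgt C m \<in> A"
  then have ma: "m \<in> arr C" by (simp add: mono_arr_def)
  show "mono_arr D m"
    unfolding mono_arr_def
  proof (intro conjI ballI impI)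
    show "m \<in> arr D" using m ma by (simp add: D_simps)
    fix X f g assume "f \<in> hom_set D X (src D m)" "g \<in> hom_set D X (src D m)" "m \<cdot>\<^bsub>D\<^esub> f = m \<cdot>\<^bsub>D\<^esub> g"
    then have "f \<in> hom_set C X (src C m)" "g \<in> hom_set C X (src C m)" "m \<cdot> f = m \<cdot> g"
      by (simp_all add: hom_D_iff D_simps)
    then show "f = g" using m by (intro mono_arrD[of m f g]) (simp_all add: in_hom_iff)
  qed
qed

text \<open>Dually, the cokernel is a retract of the target and can be tested inside
  \<open>A\<close>; a difference killed by the arrow then factors through a zero cokernel.\<close>

lemma epi_arr_D_iff: "epi_arr D m \<longleftrightarrow> epi_arr C m \<and> src C m \<in> A \<and> tgt C m \<in> A"
proof
  assume m: "epi_arr D m"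
  then have ma: "m \<in> arr C" "src C m \<in> A" "tgt C m \<in> A" by (simp_all add: epi_arr_def D_simps)
  interpret D: linear_category D by (rule D_linear)
  obtain i where i: "is_cokernel C m i" using cokernel_exists[OF ma(1)] by blast
  have ia: "i \<in> arr C" "src C i = tgt C m" "i \<cdot> m = zero_arr C (src C m) (tgt C i)" "epi_arr C i"
    and fac: "\<And>h. h \<in> arr C \<Longrightarrow> src C h = tgt C m \<Longrightarrow> h \<cdot> m = zero_arr C (src C m) (tgt C h) \<Longrightarrow>
      \<exists>u. u \<in> arr C \<and> src C u = tgt C i \<and> tgt C u = tgt C h \<and> u \<cdot> i = h"
    by (rule is_cokernelE[OF i]; simp)+
  have "retract C (tgt C i) (tgt C m)" using epi_retract[OF ia(4)] ia(2) by simp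
  then have iA: "tgt C i \<in> A" using ma(3) by (rule subD(7))
  have z: "i = zero_arr C (tgt C m) (tgt C i)"
  proof (rule D.epi_arrD[OF m, unfolded D_simps])
    show "i \<cdot> m = zero_arr C (tgt C m) (tgt C i) \<cdot> m" using ia ma by simp
  qed (use ia ma iA in simp_all)
  have "epi_arr C m"
    unfolding epi_arr_def
  proof (intro conjI ballI impI ma)
    fix X g h assume "g \<in> hom_set C (tgt C m) X" "h \<in> hom_set C (tgt C m) X" and eq: "g \<cdot> m = h \<cdot> m"
    then have gh: "g \<in> arr C" "h \<in> arr C" "tgt C g = X" "tgt C h = X" "src C g = tgt C m" "src C h = tgt C m"
      by (simp_all add: in_hom_iff)
    let ?d = "g \<boxplus> (-1) \<odot>\<^sub>m h"
    have d: "?d \<in> arr C" "tgt C ?d = X" "src C ?d = tgt C m" using gh by simp_all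
    have "?d \<cdot> m = h \<cdot> m \<boxplus> (-1) \<odot>\<^sub>m (h \<cdot> m)" using gh ma eq by simp
    also have "\<dots> = zero_arr C (src C (h \<cdot> m)) (tgt C (h \<cdot> m))"
      using gh ma by (intro plus_neg) simp
    finally have "?d \<cdot> m = zero_arr C (src C m) (tgt C ?d)" using gh d ma by simp
    from fac[OF d(1,3) this] obtain u where u: "u \<in> arr C" "src C u = tgt C i" "tgt C u = X" "u \<cdot> i = ?d"
      unfolding d by blast
    have "u \<cdot> zero_arr C (tgt C m) (tgt C i) = ?d" using u(4) z by simp
    then have "?d = zero_arr C (tgt C m) X" using u(1-3) ma(1) by simp
    then show "g = h" by (rule neg_eq_zero_imp_eq) (use gh in \<open>simp_all add: in_hom_iff\<close>)
  qed
  then show "epi_arr C m \<and> src C m \<in> A \<and> tgt C m \<in> A" using ma by blast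
next
  assume m: "epi_arr C m \<and> src C m \<in> A \<and> tgt C m \<in> A"
  then have ma: "m \<in> arr C" by (simp add: epi_arr_def)
  show "epi_arr D m"
    unfolding epi_arr_def
  proof (intro conjI ballI impI)
    show "m \<in> arr D" using m ma by (simp add: D_simps)
    fix X f g assume "f \<in> hom_set D (tgt D m) X" "g \<in> hom_set D (tgt D m) X" "f \<cdot>\<^bsub>D\<^esub> m = g \<cdot>\<^bsub>D\<^esub> m"
    then have "f \<in> hom_set C (tgt C m) X" "g \<in> hom_set C (tgt C m) X" "f \<cdot> m = g \<cdot> m"
      by (simp_all add: hom_D_iff D_simps)
    then show "f = g" using m by (intro epi_arrD[of m f g]) (simp_all add: in_hom_iff)
  qed
qed

lemma is_kernel_D:
  assumes "is_kernel C f i" "src C f \<in> A" "tgt C f \<in> A" "src C i \<in> A" shows "is_kernel D f i"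
  using assms unfolding is_kernel_def D_simps hom_D_iff by simp

lemma is_cokernel_D:
  assumes "is_cokernel C f p" "src C f \<in> A" "tgt C f \<in> A" "tgt C p \<in> A" shows "is_cokernel D f p"
  using assms unfolding is_cokernel_def D_simps hom_D_iff by simp

end

section \<open>Split monos and epis as kernels and cokernels\<close>

context linear_category
begin

text \<open>The ambient category also presents a mono as a kernel, but possibly of an arrow leaving
  the subcategory. The arrow 1 - m r is an endomorphism of the target of m and stays inside.\<close>

lemma split_mono_is_kernel:
  assumes "m \<in> arr C" "r \<in> arr C" "src C r = tgt C m" "tgt C r = src C m" "r \<cdot> m = ident C (src C m)"
  shows "is_kernel C (ident C (tgt C m) \<boxplus> (-1) \<odot>\<^sub>m (m \<cdot> r)) m"
  unfolding is_kernel_def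
proof (intro conjI ballI impI)
  let ?f = "ident C (tgt C m) \<boxplus> (-1) \<odot>\<^sub>m (m \<cdot> r)"
  have f: "?f \<in> arr C" "src C ?f = tgt C m" "tgt C ?f = tgt C m" using assms(1-4) by simp_all
  show "?f \<in> arr C" "m \<in> arr C" "tgt C m = src C ?f" using f assms by simp_all
  have "?f \<cdot> m = m \<boxplus> (-1) \<odot>\<^sub>m m" using assms by simp
  also have "\<dots> = zero_arr C (src C m) (tgt C ?f)" unfolding f using plus_neg[OF assms(1)] .
  finally show "?f \<cdot> m = zero_arr C (src C m) (tgt C ?f)" .
  fix h assume h: "h \<in> arr C" "tgt C h = src C ?f \<and> ?f \<cdot> h = zero_arr C (src C h) (tgt C ?f)"
  then have th: "tgt C h = tgt C m" using f by simp
  have "h \<boxplus> (-1) \<odot>\<^sub>m (m \<cdot> r \<cdot> h) = zero_arr C (src C h) (tgt C m)"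
    using h(2) h(1) assms(1-4) th by simp
  then have mrh: "h = m \<cdot> r \<cdot> h"
    by (rule neg_eq_zero_imp_eq) (use h(1) th assms(1-4) in \<open>simp_all add: in_hom_iff\<close>)
  show "\<exists>!u. u \<in> hom_set C (src C h) (src C m) \<and> m \<cdot> u = h"
  proof (rule ex1I[of _ "r \<cdot> h"])
    show "r \<cdot> h \<in> hom_set C (src C h) (src C m) \<and> m \<cdot> r \<cdot> h = h"
      using mrh h(1) th assms(1-4) by (simp add: in_hom_iff)
    fix u assume u: "u \<in> hom_set C (src C h) (src C m) \<and> m \<cdot> u = h"
    then have u': "u \<in> arr C" "tgt C u = src C m" by (simp_all add: in_hom_iff)
    have "r \<cdot> m \<cdot> u = u" using cmp_eq_assoc[OF assms(5) assms(1,2,3) u'] u' by simp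
    then show "u = r \<cdot> h" using u by simp
  qed
qed

lemma split_epi_is_cokernel:
  assumes "e \<in> arr C" "s \<in> arr C" "src C s = tgt C e" "tgt C s = src C e" "e \<cdot> s = ident C (tgt C e)"
  shows "is_cokernel C (ident C (src C e) \<boxplus> (-1) \<odot>\<^sub>m (s \<cdot> e)) e"
  unfolding is_cokernel_def
proof (intro conjI ballI impI)
  let ?f = "ident C (src C e) \<boxplus> (-1) \<odot>\<^sub>m (s \<cdot> e)"
  have f: "?f \<in> arr C" "src C ?f = src C e" "tgt C ?f = src C e" using assms(1-4) by simp_all
  show "?f \<in> arr C" "e \<in> arr C" "src C e = tgt C ?f" using f assms by simp_all
  have ese: "e \<cdot> s \<cdot> e = e" using cmp_eq_assoc[OF assms(5) assms(2,1)] assms(1,3,4) by simp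
  have "e \<cdot> ?f = e \<boxplus> (-1) \<odot>\<^sub>m e" using assms(1-4) ese by simp
  also have "\<dots> = zero_arr C (src C ?f) (tgt C e)" unfolding f using plus_neg[OF assms(1)] .
  finally show "e \<cdot> ?f = zero_arr C (src C ?f) (tgt C e)" .
  fix h assume h: "h \<in> arr C" "src C h = tgt C ?f \<and> h \<cdot> ?f = zero_arr C (src C ?f) (tgt C h)"
  then have th: "src C h = src C e" using f by simp
  have "h \<boxplus> (-1) \<odot>\<^sub>m (h \<cdot> s \<cdot> e) = zero_arr C (src C e) (tgt C h)"
    using h(2) h(1) assms(1-4) th by simp
  then have mrh: "h = h \<cdot> s \<cdot> e"
    by (rule neg_eq_zero_imp_eq) (use h(1) th assms(1-4) in \<open>simp_all add: in_hom_iff\<close>)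
  show "\<exists>!u. u \<in> hom_set C (tgt C e) (tgt C h) \<and> u \<cdot> e = h"
  proof (rule ex1I[of _ "h \<cdot> s"])
    show "h \<cdot> s \<in> hom_set C (tgt C e) (tgt C h) \<and> (h \<cdot> s) \<cdot> e = h"
      using mrh h(1) th assms(1-4) by (simp add: in_hom_iff)
    fix u assume u: "u \<in> hom_set C (tgt C e) (tgt C h) \<and> u \<cdot> e = h"
    then have u': "u \<in> arr C" "src C u = tgt C e" by (simp_all add: in_hom_iff)
    have "(u \<cdot> e) \<cdot> s = u" using u' assms by simp
    then show "u = h \<cdot> s" using u by simp
  qed
qed

end

section \<open>The fusion category on a full fusion subcategory\<close>

context full_fusion_subcategory
begin

lemma D_abelian: "linear_abelian_category D"
proof (rule linear_abelian_category.intro[OF D_linear], unfold_locales)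
  show "\<exists>Z. zero_object D Z"
    using zero_object_exists abelian_subcategoryD(2)[OF subD(1)] unfolding zero_object_D_iff by blast
next
  fix X Y assume "X \<in> obj D" "Y \<in> obj D"
  then have XY: "X \<in> A" "Y \<in> A" by (simp_all add: D_simps)
  obtain S where S: "biproduct C S X Y" using biproduct_ex[OF XY[THEN subD(6)]] by blast
  have "S \<in> A" by (rule abelian_subcategoryD(3)[OF subD(1) XY S])
  then show "\<exists>S. is_direct_sum D S [X, Y]"
    using S XY unfolding is_direct_sum_D_iff is_direct_sum_two_iff by auto
next
  fix f assume "f \<in> arr D"
  then have f: "f \<in> arr C" "src C f \<in> A" "tgt C f \<in> A" by (simp_all add: D_simps)
  obtain i where i: "is_kernel C f i" using kernel_exists[OF f(1)] by blast
  have "retract C (src C i) (src C f)"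
    by (rule is_kernelE[OF i]) (use mono_retract[of i] in simp)
  then have "src C i \<in> A" using f(2) by (rule subD(7))
  then show "\<exists>i. is_kernel D f i" using is_kernel_D[OF i f(2,3)] by blast
  obtain p where p: "is_cokernel C f p" using cokernel_exists[OF f(1)] by blast
  have "retract C (tgt C p) (tgt C f)"
    by (rule is_cokernelE[OF p]) (use epi_retract[of p] in simp)
  then have "tgt C p \<in> A" using f(3) by (rule subD(7))
  then show "\<exists>p. is_cokernel D f p" using is_cokernel_D[OF p f(2,3)] by blast
next
  fix m assume "mono_arr D m"
  then have m: "mono_arr C m" "src C m \<in> A" "tgt C m \<in> A" by (simp_all add: mono_arr_D_iff)
  then have ma: "m \<in> arr C" by (simp add: mono_arr_def)
  obtain r where r: "r \<in> arr C" "src C r = tgt C m" "tgt C r = src C m" "r \<cdot> m = ident C (src C m)"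
    using mono_split[OF m(1)] by blast
  have "is_kernel D (ident C (tgt C m) \<boxplus> (-1) \<odot>\<^sub>m (m \<cdot> r)) m"
    by (rule is_kernel_D[OF split_mono_is_kernel[OF ma r]]) (use ma r m in simp_all)
  then show "\<exists>f. is_kernel D f m" by blast
next
  fix e assume "epi_arr D e"
  then have e: "epi_arr C e" "src C e \<in> A" "tgt C e \<in> A" by (simp_all add: epi_arr_D_iff)
  then have ea: "e \<in> arr C" by (simp add: epi_arr_def)
  obtain s where s: "s \<in> arr C" "src C s = tgt C e" "tgt C s = src C e" "e \<cdot> s = ident C (tgt C e)"
    using epi_split[OF e(1)] by blast
  have "is_cokernel D (ident C (src C e) \<boxplus> (-1) \<odot>\<^sub>m (s \<cdot> e)) e"
    by (rule is_cokernel_D[OF split_epi_is_cokernel[OF ea s]]) (use ea s e in simp_all)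
  then show "\<exists>f. is_cokernel D f e" by blast
qed

lemma simple_object_D_iff: "simple_object D X \<longleftrightarrow> simple_object C X \<and> X \<in> A"
proof
  assume X: "simple_object D X"
  then have XA: "X \<in> A" by (simp add: simple_object_def D_simps)
  have "\<not> zero_object C X" using X XA by (simp add: simple_object_def zero_object_D_iff)
  moreover have "zero_object C (src C m) \<or> iso_arr C m" if m: "mono_arr C m" "tgt C m = X" for m
  proof -
    have "src C m \<in> A" using subD(7)[OF mono_retract[OF m(1)]] m(2) XA by simp
    then have "mono_arr D m" using m XA by (simp add: mono_arr_D_iff)
    then have "zero_object D (src C m) \<or> iso_arr D m" using X m(2) by (simp add: simple_object_def D_simps)
    then show ?thesis unfolding zero_object_D_iff iso_arr_D_iff by blast
  qed
  ultimately show "simple_object C X \<and> X \<in> A"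
    using XA subD(6) by (simp add: simple_object_def)
next
  assume X: "simple_object C X \<and> X \<in> A"
  have "zero_object D (src C m) \<or> iso_arr D m" if m: "mono_arr D m" "tgt C m = X" for m
  proof -
    have m': "mono_arr C m" "src C m \<in> A" "tgt C m \<in> A" using m(1) by (simp_all add: mono_arr_D_iff)
    then have "zero_object C (src C m) \<or> iso_arr C m" using X m(2) by (simp add: simple_object_def)
    then show ?thesis unfolding zero_object_D_iff iso_arr_D_iff using m' by blast
  qed
  then show "simple_object D X"
    using X by (simp add: simple_object_def D_simps zero_object_D_iff)
qed

lemma left_dual_D_iff: "left_dual D X Y \<longleftrightarrow> left_dual C X Y \<and> X \<in> A \<and> Y \<in> A"
proof (cases "X \<in> A \<and> Y \<in> A")
  case True
  then have o: "X \<in> obj C" "Y \<in> obj C" using subD(6) by blast+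
  have inv: "inv_arr D (assoc C Y X Y) = inv_arr C (assoc C Y X Y)"
    by (rule inv_arr_D_eq[OF assoc_iso[OF o(2,1,2)]]) (use o True subD(3) in simp_all)
  have "hom_set D (Y \<boxtimes>\<^sub>o X) \<I> = hom_set C (Y \<boxtimes>\<^sub>o X) \<I>" "hom_set D \<I> (X \<boxtimes>\<^sub>o Y) = hom_set C \<I> (X \<boxtimes>\<^sub>o Y)"
    using True subD(2,3) by (simp_all add: hom_D_eq)
  then show ?thesis unfolding left_dual_def D_simps inv using True o by simp
next
  case False
  then show ?thesis by (auto simp: left_dual_def D_simps)
qed

lemma isomorphic_D_iff: "isomorphic D X Y \<longleftrightarrow> isomorphic C X Y \<and> X \<in> A \<and> Y \<in> A"
  unfolding isomorphic_def D_simps Bex_def hom_D_iff iso_arr_D_iff in_hom_iff using subD(6) by auto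

lemma retract_D_iff: "retract D X Y \<longleftrightarrow> retract C X Y \<and> X \<in> A \<and> Y \<in> A"
  unfolding retract_def D_simps Bex_def hom_D_iff by blast

lemma isomorphic_closed: "isomorphic C X Y \<Longrightarrow> X \<in> A \<longleftrightarrow> Y \<in> A"
  using subD(7) isomorphic_retract isomorphic_sym by blast

text \<open>Closure under isomorphism makes the classes equal as sets, so the set of simple classes
  of the subcategory is literally a subset of the ambient one.\<close>

lemma iso_class_D: "X \<in> A \<Longrightarrow> iso_class D X = iso_class C X"
  unfolding iso_class_def isomorphic_D_iff using isomorphic_closed by blast

lemma Irr_D: "Irr D = iso_class C ` {X. simple_object C X \<and> X \<in> A}"
  unfolding Irr_def simple_object_D_iff using iso_class_D by (intro image_cong) simp_all

lemma Irr_D_subset: "Irr D \<subseteq> Irr C"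
  unfolding Irr_D Irr_def[of C] by blast

lemma D_fusion: "fusion_category D"
proof (rule fusion_category.intro[OF D_abelian D_monoidal], unfold_locales)
  show "simple_object D \<I>\<^bsub>D\<^esub>" using unit_simple subD(2) by (simp add: simple_object_D_iff D_simps)
  show "finite (Irr D)"
    by (rule finite_subset[OF Irr_D_subset finitely_many_simples])
next
  fix X assume "X \<in> obj D"
  then have X: "X \<in> A" "X \<in> obj C" using subD(6) by (simp_all add: D_simps)
  show "\<exists>Y. left_dual D X Y"
    using left_dual_exists[OF X(2)] subD(4)[OF X(1)] X unfolding left_dual_D_iff by blast
  show "\<exists>Y. left_dual D Y X"
    using right_dual_closed[OF X(1)] X unfolding left_dual_D_iff by blast
  obtain Xs where Xs: "\<forall>T \<in> set Xs. simple_object C T" "is_direct_sum C X Xs"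
    by (rule simple_sum_ex[OF X(2)])
  have "set Xs \<subseteq> A" using subD(7)[OF is_direct_sum_retract[OF Xs(2)] X(1)] by blast
  then show "\<exists>Xs. (\<forall>Y \<in> set Xs. simple_object D Y) \<and> is_direct_sum D X Xs"
    unfolding simple_object_D_iff is_direct_sum_D_iff using Xs X(1) by blast
next
  fix X Y assume "X \<in> obj D" "Y \<in> obj D"
  then have "X \<in> A" "Y \<in> A" "X \<in> obj C" "Y \<in> obj C" using subD(6) by (simp_all add: D_simps)
  then show "finite_dim_hom D X Y"
    using hom_finite_dim[of X Y] by (simp add: finite_dim_hom_def hom_D_eq sum_arrs_D D_simps)
qed

lemma invertible_object_D_iff: "invertible_object D X \<longleftrightarrow> invertible_object C X \<and> X \<in> A"
proof
  assume "invertible_object D X"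
  then show "invertible_object C X \<and> X \<in> A"
    unfolding invertible_object_def isomorphic_D_iff D_simps using subD(6) by blast
next
  assume X: "invertible_object C X \<and> X \<in> A"
  then obtain Y where Y: "inverse_objects X Y" by (auto simp: invertible_object_iff)
  note XY = inverse_objectsD[OF Y]
  have YA: "Y \<in> A" using fusion_subcategory_inverse[OF fusion_subcategory Y] X by blast
  have "isomorphic C (X \<boxtimes>\<^sub>o Y) \<I>" "isomorphic C (Y \<boxtimes>\<^sub>o X) \<I>"
    using XY by (auto intro!: cl_eqD simp: cl_tensor)
  then show "invertible_object D X"
    unfolding invertible_object_def isomorphic_D_iff D_simps using X YA subD(2,3) by blast
qed

text \<open>Makes the adjoint subcategory of \<open>D\<close> a competitor in the intersection
  defining the adjoint subcategory of \<open>C\<close>.\<close>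

lemma fusion_subcategory_trans:
  assumes "fusion_subcategory D S" shows "fusion_subcategory C S"
proof -
  interpret D: fusion_category D by (rule D_fusion)
  note S = D.fusion_subcategoryD[OF assms]
  have SA: "S \<subseteq> A" using S(5) by (simp add: D_simps)
  have "abelian_subcategory C S"
  proof (rule abelian_subcategoryI)
    show "S \<subseteq> obj C" using SA subD(5) by blast
    show "Z \<in> S" if "zero_object C Z" for Z
      using D.abelian_subcategoryD(2)[OF S(1)] that abelian_subcategoryD(2)[OF subD(1) that]
      by (simp add: zero_object_D_iff)
    show "Z \<in> S" if XY: "X \<in> S" "Y \<in> S" and Z: "biproduct C Z X Y" for X Y Z
    proof -
      have "X \<in> A" "Y \<in> A" using XY SA by blast+
      moreover from this have "Z \<in> A" using abelian_subcategoryD(3)[OF subD(1) _ _ Z] by blast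
      ultimately have "is_direct_sum D Z [X, Y]" using Z by (simp add: is_direct_sum_D_iff is_direct_sum_two_iff)
      then show ?thesis
        using D.abelian_subcategoryD(3)[OF S(1) XY] by (simp add: D.is_direct_sum_two_iff)
    qed
    show "X \<in> S" if "Y \<in> S" "retract C X Y" for X Y
    proof -
      have "Y \<in> A" using that SA by blast
      moreover from this have "X \<in> A" by (rule subD(7)[OF that(2)])
      ultimately show ?thesis using S(7)[of X Y] that by (simp add: retract_D_iff)
    qed
  qed
  moreover have "\<I> \<in> S" "\<And>X Y. X \<in> S \<Longrightarrow> Y \<in> S \<Longrightarrow> X \<boxtimes>\<^sub>o Y \<in> S"
    using S(2,3) by (simp_all add: D_simps)
  moreover have "Y \<in> S" if "X \<in> S" "left_dual C X Y" for X Y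
  proof -
    have "X \<in> A" using that SA by blast
    moreover from this have "Y \<in> A" using that(2) by (rule subD(4))
    ultimately show ?thesis using S(4)[OF that(1), of Y] that(2) by (simp add: left_dual_D_iff)
  qed
  ultimately show ?thesis unfolding fusion_subcategory_def by blast
qed

text \<open>An object outside \<open>A\<close> has a simple retract outside \<open>A\<close>, and
  the class of that retract is missing from the subcategory.\<close>

lemma card_Irr_D:
  "card (Irr D) \<le> card (Irr C)" "A \<noteq> obj C \<Longrightarrow> card (Irr D) < card (Irr C)"
proof -
  show "card (Irr D) \<le> card (Irr C)" by (rule card_mono[OF finitely_many_simples Irr_D_subset])
  assume "A \<noteq> obj C"
  then obtain X where X: "X \<in> obj C" "X \<notin> A" using subD(5) by blast
  then obtain S where S: "simple_object C S" "S \<notin> A"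
    using abelian_subcategory_simple_retracts[OF subD(1)] by blast
  have "cl S \<notin> Irr D"
  proof
    assume "cl S \<in> Irr D"
    then obtain T where T: "simple_object C T" "T \<in> A" "cl S = cl T" by (auto simp: Irr_D)
    then have "isomorphic C S T" using S(1) simple_object_obj by (intro cl_eqD)
    then show False using isomorphic_closed T(2) S(2) by blast
  qed
  moreover have "cl S \<in> Irr C" using S(1) by (auto simp: Irr_def)
  ultimately have "Irr D \<subset> Irr C" using Irr_D_subset by blast
  then show "card (Irr D) < card (Irr C)" by (rule psubset_card_mono[OF finitely_many_simples])
qed

lemma near_group_D:
  assumes "near_group_category C" "simple_object C X" "\<not> invertible_object C X" "X \<in> A"
  shows "near_group_category D"
proof -
  interpret N: near_group_category C by (rule assms(1))
  have "\<not> pointed D"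
    unfolding pointed_def simple_object_D_iff invertible_object_D_iff using assms(2-4) by blast
  moreover have "\<exists>g. invertible_object D g \<and> isomorphic D (g \<boxtimes>\<^sub>o\<^bsub>D\<^esub> X) Y"
    if "simple_object D X" "\<not> invertible_object D X" "simple_object D Y" "\<not> invertible_object D Y" for X Y
  proof -
    have XY: "simple_object C X" "\<not> invertible_object C X" "simple_object C Y" "\<not> invertible_object C Y"
      "X \<in> A" "Y \<in> A"
      using that by (simp_all add: simple_object_D_iff invertible_object_D_iff)
    obtain g where g: "invertible_object C g" "isomorphic C (g \<boxtimes>\<^sub>o X) Y"
      using N.transitive[OF XY(1-4)] by blast
    have gX: "g \<boxtimes>\<^sub>o X \<in> A" using isomorphic_closed[OF g(2)] XY(6) by blast
    then have "g \<in> A"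
      by (rule fusion_subcategory_left_factor[OF fusion_subcategory XY(5) simple_object_nonzero[OF XY(1)]
        invertible_object_obj[OF g(1)]])
    then show ?thesis
      using g gX XY(6) by (intro exI[of _ g]) (simp add: invertible_object_D_iff isomorphic_D_iff D_simps)
  qed
  ultimately show ?thesis
    by (intro near_group_category.intro D_fusion near_group_category_axioms.intro)
qed

end

context fusion_category
begin

lemma iso_arr_ident: "X \<in> obj C \<Longrightarrow> iso_arr C (ident C X)"
  unfolding iso_arr_def by (rule exI[of _ "ident C X"]) (simp add: inverse_arrs_def in_hom_iff)

text \<open>The trivial component of the grading will be the subcategory itself, so the identity
  functor is the required equivalence.\<close>

lemma tensor_equivalent_refl: "tensor_equivalent C C"
  unfolding tensor_equivalent_def
proof (intro exI conjI ballI)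
  let ?J = "\<lambda>X Y. ident C (X \<boxtimes>\<^sub>o Y)"
  show "tensor_functor C C (\<lambda>X. X) (\<lambda>f. f) ?J (ident C \<I>)"
  proof
    fix X Y assume "X \<in> obj C" "Y \<in> obj C"
    then show "?J X Y \<in> hom_set C (X \<boxtimes>\<^sub>o Y) (X \<boxtimes>\<^sub>o Y)" "iso_arr C (?J X Y)"
      by (simp_all add: ident_hom iso_arr_ident)
  next
    fix f g X X' Y Y' assume "f \<in> hom_set C X X'" "g \<in> hom_set C Y Y'"
    then show "(f \<boxtimes>\<^sub>m g) \<cdot> ?J X Y = ?J X' Y' \<cdot> (f \<boxtimes>\<^sub>m g)" by (simp add: in_hom_iff)
  qed (simp_all add: ident_hom iso_arr_ident)
  show "bij_betw (\<lambda>f. f) (hom_set C X Y) (hom_set C X Y)" for X Y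
    using bij_betw_id unfolding id_def .
  show "\<exists>X \<in> obj C. isomorphic C X Z" if "Z \<in> obj C" for Z
    using isomorphic_refl[OF that] that by (rule bexI)
qed

end

section \<open>The extension of case (2) and the criterion for case (1)\<close>

context near_group_category
begin

lemma adjoint_subcategory_idempotent:
  assumes "full_fusion_subcategory C (adjoint_subcategory C)"
    and X0: "simple_object C X0" "\<not> invertible_object C X0" "X0 \<in> adjoint_subcategory C"
  shows "adjoint_subcategory (full_sub C (adjoint_subcategory C)) = adjoint_subcategory C"
proof -
  let ?A = "adjoint_subcategory C"
  interpret S: full_fusion_subcategory C ?A by (rule assms(1))
  interpret D: near_group_category S.D by (rule S.near_group_D[OF near_group_category_axioms X0])
  let ?B = "adjoint_subcategory S.D"
  note A' = adjoint_subcategory_fusion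
  note A = fusion_subcategoryD[OF A']
  have B': "fusion_subcategory C ?B" by (rule S.fusion_subcategory_trans[OF D.adjoint_subcategory_fusion])
  note B = fusion_subcategoryD[OF B']
  have "?A \<subseteq> ?B"
  proof (rule adjoint_subcategory_least[OF B'])
    fix X Y assume X: "simple_object C X" and "constituent C Y (X \<boxtimes>\<^sub>o dual C X)"
    then have Y: "simple_object C Y" "retract C Y (X \<boxtimes>\<^sub>o dual C X)" using constituentD by blast+
    have Xo: "X \<in> obj C" using X by (rule simple_object_obj)
    have Xd: "left_dual C X (dual C X)" using Xo by (rule left_dual_dual)
    from Y left_dual_obj(2)[OF Xd] Xo obtain T where
      T: "simple_object C T" "retract C T (dual C X)" "retract C Y (X \<boxtimes>\<^sub>o T)"
      by (rule simple_retract_tensor_right)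
    have To: "T \<in> obj C" using T(1) by (rule simple_object_obj)
    have I: "retract C \<I> (X \<boxtimes>\<^sub>o T)"
      by (rule left_dual_retract_unit[OF Xd T(2) simple_object_nonzero[OF T(1)]])
    have "X \<boxtimes>\<^sub>o T \<in> ?B"
    proof (cases "invertible_object C X")
      case True
      then have "inverse_objects X T" using unit_retract_invertible[OF X T(1) I] by blast
      note XT = inverse_objectsD[OF this]
      show ?thesis
        by (rule fusion_subcategory_isomorphic[OF B' B(2)]) (use XT in \<open>simp_all add: cl_tensor\<close>)
    next
      case False
      obtain u where u: "invertible_object C u" "cl X = cl u \<star> cl X0" by (rule transitive_cl[OF X0(1,2) X False])
      obtain v where uv: "inverse_objects u v" using u(1) by (auto simp: invertible_object_iff)
      note uv' = inverse_objectsD[OF uv]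
      have v: "invertible_object C v" using inverse_objects_sym[OF uv] by (rule inverse_objects_invertible)
      have X0o: "X0 \<in> obj C" using X0(1) by (rule simple_object_obj)
      \<comment> \<open>V is the conjugate of X0 = v \<otimes> X by u, that is, X \<otimes> v. It
        lies in the adjoint subcategory although X need not.\<close>
      define V where "V = (u \<boxtimes>\<^sub>o X0) \<boxtimes>\<^sub>o v"
      have VA: "V \<in> ?A" unfolding V_def by (rule adjoint_subcategory_conjugate[OF inverse_objects_sym[OF uv] X0(3)])
      have V: "simple_object C V" unfolding V_def
        using tensor_invertible_simple(2)[OF v tensor_invertible_simple(1)[OF u(1) X0(1)]] .
      have W: "simple_object C (u \<boxtimes>\<^sub>o T)" by (rule tensor_invertible_simple(1)[OF u(1) T(1)])
      \<comment> \<open>The factors v and u cancel in the middle. Thus u \<otimes> T plays the part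
        of the dual of V, and it lies in the adjoint subcategory by
        \<open>fusion_subcategory_dual_simple\<close>.\<close>
      have e: "cl (X \<boxtimes>\<^sub>o T) = cl (V \<boxtimes>\<^sub>o (u \<boxtimes>\<^sub>o T))"
        unfolding V_def using uv' Xo To X0o by (simp add: cl_tensor u(2) ct_assoc)
      have Vo: "V \<in> obj C" using V by (rule simple_object_obj)
      have "isomorphic C (X \<boxtimes>\<^sub>o T) (V \<boxtimes>\<^sub>o (u \<boxtimes>\<^sub>o T))"
        by (rule cl_eqD[OF e]) (use uv' Xo To Vo in simp_all)
      with I have I': "retract C \<I> (V \<boxtimes>\<^sub>o (u \<boxtimes>\<^sub>o T))" by (rule retract_isomorphic(1))
      have WA: "u \<boxtimes>\<^sub>o T \<in> ?A" by (rule fusion_subcategory_dual_simple[OF A' V W VA I'])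
      \<comment> \<open>Both factors are now objects of the subcategory, which is itself a
        near-group category, so \<open>contains_adjoint_tensor\<close> can be applied inside
        it.\<close>
      have "V \<boxtimes>\<^sub>o\<^bsub>S.D\<^esub> (u \<boxtimes>\<^sub>o T) \<in> ?B"
      proof (rule D.contains_adjoint_tensor[OF D.adjoint_subcategory_fusion
            D.contains_adjoint_adjoint_subcategory])
        show "simple_object S.D V" "simple_object S.D (u \<boxtimes>\<^sub>o T)"
          using V W VA WA by (simp_all add: S.simple_object_D_iff)
        show "retract S.D \<I>\<^bsub>S.D\<^esub> (V \<boxtimes>\<^sub>o\<^bsub>S.D\<^esub> (u \<boxtimes>\<^sub>o T))"
          using I' A(2) A(3)[OF VA WA] by (simp add: S.retract_D_iff S.D_simps)
      qed
      then have "V \<boxtimes>\<^sub>o (u \<boxtimes>\<^sub>o T) \<in> ?B" by (simp add: S.D_simps)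
      then show ?thesis
        by (rule fusion_subcategory_isomorphic[OF B']) (use e Xo To in simp_all)
    qed
    then show "Y \<in> ?B" by (rule B(7)[OF T(3)])
  qed
  moreover have "?B \<subseteq> ?A" using D.fusion_subcategoryD(5)[OF D.adjoint_subcategory_fusion] by (simp add: S.D_simps)
  ultimately show ?thesis by blast
qed

proposition extension_of_adjoint_subcategory:
  assumes X0: "simple_object C X0" "\<not> invertible_object C X0" "X0 \<in> adjoint_subcategory C"
  defines "D \<equiv> full_sub C (adjoint_subcategory C)"
  shows "generalized_near_group D" "trivial_universal_grading D" "smaller_unless_trivially_graded D C"
    "extension_of C D"
proof -
  let ?A = "adjoint_subcategory C"
  obtain H :: "nat monoid" and Cs where H: "faithful_grading C H Cs" "Cs \<one>\<^bsub>H\<^esub> = ?A"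
    using grading_over_adjoint_subcategory[OF X0] by blast
  have "group H" using H(1) unfolding faithful_grading_def by (elim conjE)
  then interpret H: group H .
  \<comment> \<open>At the identity this clause of the grading says that the left duals of objects
    of the adjoint subcategory make up all of it; this is the closure under right duals that its
    definition does not provide.\<close>
  have "\<forall>h \<in> carrier H. {Y. \<exists>X \<in> Cs h. left_dual C X Y} = Cs (inv\<^bsub>H\<^esub> h)"
    using H(1) unfolding faithful_grading_def by (elim conjE)
  then have "{Y. \<exists>X \<in> Cs \<one>\<^bsub>H\<^esub>. left_dual C X Y} = Cs (inv\<^bsub>H\<^esub> \<one>\<^bsub>H\<^esub>)" using H.one_closed by (rule bspec)
  then have rd: "{Y. \<exists>X \<in> ?A. left_dual C X Y} = ?A" by (simp add: H(2))
  interpret S: full_fusion_subcategory C ?A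
  proof
    show "fusion_subcategory C ?A" by (rule adjoint_subcategory_fusion)
    show "\<exists>X \<in> ?A. left_dual C X Y" if "Y \<in> ?A" for Y using that rd by blast
  qed
  note near = S.near_group_D[OF near_group_category_axioms X0]
  interpret D: near_group_category S.D by (rule near)
  show "generalized_near_group D" unfolding D_def generalized_near_group_iff by (rule near)
  have "adjoint_subcategory S.D = obj S.D"
    using adjoint_subcategory_idempotent[OF S.full_fusion_subcategory_axioms X0] by (simp add: S.D_simps)
  then show "trivial_universal_grading D" unfolding D_def by (simp add: D.trivial_universal_grading_iff)
  show "smaller_unless_trivially_graded D C"
    unfolding D_def smaller_unless_trivially_graded_def trivial_universal_grading_iff
    using S.card_Irr_D by blast
  show "extension_of C D"
    unfolding extension_of_def D_def
    by (intro conjI exI[of _ H] exI[of _ Cs] fusion_category_axioms S.D_fusion H(1))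
      (simp add: H(2) D.tensor_equivalent_refl)
qed

text \<open>For a simple summand T of the dual of X, every product of non-invertible simple objects
  is an invertible object times X \<otimes> T, a retract of X \<otimes> \<open>dual C X\<close>; so
  its simple constituents are invertible multiples of members of \<open>gs\<close>.\<close>

lemma generalized_Tambara_YamagamiI:
  assumes X1: "simple_object C X" "\<not> invertible_object C X"
    and gs: "is_direct_sum C (X \<boxtimes>\<^sub>o dual C X) gs" "\<forall>g \<in> set gs. invertible_object C g"
  shows "generalized_Tambara_Yamagami C"
proof -
  have Xo: "X \<in> obj C" using X1(1) by (rule simple_object_obj)
  have Xd: "left_dual C X (dual C X)" using Xo by (rule left_dual_dual)
  have do: "dual C X \<in> obj C" by (rule left_dual_obj(2)[OF Xd])
  have "retract C \<I> (X \<boxtimes>\<^sub>o dual C X)"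
    by (rule retract_left_dual_unit[OF Xd retract_refl[OF Xo] simple_object_nonzero[OF X1(1)]])
  from unit_simple this do Xo obtain T where T: "simple_object C T" "retract C T (dual C X)" "retract C \<I> (X \<boxtimes>\<^sub>o T)"
    by (rule simple_retract_tensor_right)
  have To: "T \<in> obj C" using T(1) by (rule simple_object_obj)
  have "\<not> invertible_object C T"
    using unit_retract_invertible[OF X1(1) T(1,3)] X1(2) inverse_objects_invertible by blast
  note T1 = T(1) this
  have "\<exists>Zs. (\<forall>Z \<in> set Zs. simple_object C Z \<and> invertible_object C Z) \<and> is_direct_sum C (V \<boxtimes>\<^sub>o W) Zs"
    if V: "simple_object C V" "\<not> invertible_object C V" and W: "simple_object C W" "\<not> invertible_object C W" for V W
  proof -
    have o: "V \<in> obj C" "W \<in> obj C" using V W by (simp_all add: simple_object_obj)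
    obtain g where g: "invertible_object C g" "cl V = cl g \<star> cl X" by (rule transitive_cl[OF X1 V])
    obtain h where h: "invertible_object C h" "cl W = cl h \<star> cl T" by (rule transitive_cl[OF T1 W])
    \<comment> \<open>Needed to collect the invertible factors of (g \<otimes> X) \<otimes> (h
      \<otimes> T) on the left.\<close>
    obtain k where k: "invertible_object C k" "cl X \<star> cl h = cl k \<star> cl X"
      by (rule noninvertible_commute[OF h(1) X1])
    note ghk = g(1)[THEN invertible_object_obj] h(1)[THEN invertible_object_obj] k(1)[THEN invertible_object_obj]
    have gk: "invertible_object C (g \<boxtimes>\<^sub>o k)" using g(1) k(1) by (rule invertible_object_tensor)
    then obtain w where w: "inverse_objects (g \<boxtimes>\<^sub>o k) w" by (auto simp: invertible_object_iff)
    have iw: "invertible_object C w" using inverse_objects_sym[OF w] by (rule inverse_objects_invertible)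
    have "cl (V \<boxtimes>\<^sub>o W) = cl g \<star> (cl X \<star> cl h) \<star> cl T"
      using o ghk Xo To by (simp add: cl_tensor g(2) h(2) ct_assoc)
    also have "\<dots> = cl ((g \<boxtimes>\<^sub>o k) \<boxtimes>\<^sub>o (X \<boxtimes>\<^sub>o T))"
      unfolding k(2) using ghk Xo To by (simp add: cl_tensor ct_assoc)
    finally have VW: "isomorphic C (V \<boxtimes>\<^sub>o W) ((g \<boxtimes>\<^sub>o k) \<boxtimes>\<^sub>o (X \<boxtimes>\<^sub>o T))"
      by (rule cl_eqD) (use o ghk Xo To in simp_all)
    have inv: "invertible_object C Z" if Z: "simple_object C Z" "retract C Z (V \<boxtimes>\<^sub>o W)" for Z
    proof -
      have Zo: "Z \<in> obj C" using Z(1) by (rule simple_object_obj)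
      \<comment> \<open>Removing the invertible factor g \<otimes> k with its inverse w brings the
        constituent Z into the known product; invertibility is then carried back from w \<otimes> Z
        to Z.\<close>
      have "retract C (w \<boxtimes>\<^sub>o Z) (X \<boxtimes>\<^sub>o T)"
        using retract_isomorphic(1)[OF Z(2) VW] Xo To by (intro retract_move_left[OF w]) simp_all
      also have "retract C (X \<boxtimes>\<^sub>o T) (X \<boxtimes>\<^sub>o dual C X)" using T(2) Xo by (intro tensor_retract) simp_all
      finally have r: "retract C (w \<boxtimes>\<^sub>o Z) (X \<boxtimes>\<^sub>o dual C X)" .
      have s: "simple_object C (w \<boxtimes>\<^sub>o Z)" by (rule tensor_invertible_simple(1)[OF iw Z(1)])
      obtain g' where g': "g' \<in> set gs" "retract C (w \<boxtimes>\<^sub>o Z) g'"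
        using simple_retract_sum[OF s r gs(1)] by blast
      then have "invertible_object C g'" using gs(2) by blast
      moreover from this have "isomorphic C (w \<boxtimes>\<^sub>o Z) g'"
        using simple_retract_isomorphic[OF s invertible_simple g'(2)] by blast
      ultimately have "invertible_object C (w \<boxtimes>\<^sub>o Z)"
        using isomorphic_invertible_object[OF isomorphic_sym] by blast
      then show ?thesis using tensor_noninvertible(1)[OF iw Zo] by blast
    qed
    obtain Zs where Zs: "\<forall>Z \<in> set Zs. simple_object C Z" "is_direct_sum C (V \<boxtimes>\<^sub>o W) Zs"
      by (rule simple_sum_ex[of "V \<boxtimes>\<^sub>o W"]) (use o in simp_all)
    then show ?thesis using inv is_direct_sum_retract[OF Zs(2)] by blast
  qed
  then show ?thesis
    unfolding generalized_Tambara_Yamagami_def using fusion_category_axioms not_pointed by blast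
qed

end

section \<open>From the type of the category to the two cases\<close>

lemma concat_map2_replicate_zero: "concat (map2 replicate (replicate n 0) Xs) = []"
  by (auto simp: set_zip)

lemma nth_in_concat_map2_replicate:
  assumes "i < length ks" "length ks = length Xs" "ks ! i \<noteq> 0"
  shows "Xs ! i \<in> set (concat (map2 replicate ks Xs))"
proof -
  have "(ks ! i, Xs ! i) \<in> set (zip ks Xs)" using assms(1,2) by (auto simp: set_zip)
  then show ?thesis using assms(3) by force
qed

theorem theorem3p8:
  fixes C :: "('o, 'm, 'k::{alg_closed_field, field_char_0}) lin_mon_cat"
    and G :: "'o set monoid" and \<Gamma> :: "'o set set" and ks :: "nat list"
  assumes "generalized_near_group_of_type C G \<Gamma> ks"
  shows "(ks = replicate (length ks) 0 \<longrightarrow> generalized_Tambara_Yamagami C) \<and>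
    (ks \<noteq> replicate (length ks) 0 \<longrightarrow>
      (\<exists>D :: ('o, 'm, 'k) lin_mon_cat.
         generalized_near_group D \<and> trivial_universal_grading D \<and>
         smaller_unless_trivially_graded D C \<and> extension_of C D))"
proof -
  have "near_group_category C"
    using assms unfolding generalized_near_group_of_type_def generalized_near_group_iff by blast
  then interpret near_group_category C .
  from assms obtain Xs gs where G: "G = invertible_group C"
    and Xs: "\<forall>X \<in> set Xs. simple_object C X" "iso_class C ` set Xs = noninvertible_Irr C" "length ks = length Xs"
    and \<Gamma>: "\<Gamma> = stabilizer G (left_tensor_action C) (iso_class C (hd Xs))"
    and gs: "\<forall>g \<in> set gs. simple_object C g" "iso_class C ` set gs = \<Gamma>"
    and sum: "is_direct_sum C (hd Xs \<boxtimes>\<^sub>o\<^bsub>C\<^esub> dual C (hd Xs)) (gs @ concat (map2 replicate ks Xs))"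
    unfolding generalized_near_group_of_type_def by (elim conjE exE) (rule that; assumption)
  have Xs_noninv: "\<not> invertible_object C X" if "X \<in> set Xs" for X
  proof -
    have "iso_class C X \<in> noninvertible_Irr C" using Xs(2) that by blast
    then show ?thesis using cl_in_noninvertible_Irr_iff Xs(1) that simple_object_obj by blast
  qed
  \<comment> \<open>Ensures that \<open>hd Xs\<close> really is the first listed simple object; an
    empty list would make the category pointed.\<close>
  have "Xs \<noteq> []"
  proof
    assume "Xs = []"
    then have "noninvertible_Irr C = {}" using Xs(2) by simp
    then show False using not_pointed unfolding pointed_def noninvertible_Irr_eq by blast
  qed
  then have hd: "hd Xs \<in> set Xs" by simp
  have X1: "simple_object C (hd Xs)" "\<not> invertible_object C (hd Xs)" using hd Xs(1) Xs_noninv by blast+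
  \<comment> \<open>The stabilizer is a subset of the group of invertible classes, so the
    constituents listed in \<open>gs\<close> are invertible.\<close>
  have gs_inv: "\<forall>g \<in> set gs. invertible_object C g"
  proof
    fix g assume g: "g \<in> set gs"
    then have "iso_class C g \<in> carrier (invertible_group C)"
      using gs(2) unfolding \<Gamma> stabilizer_def G by blast
    then show "invertible_object C g" using cl_in_carrier_iff gs(1) g simple_object_obj by blast
  qed
  have "generalized_Tambara_Yamagami C" if "ks = replicate (length ks) 0"
  proof (rule generalized_Tambara_YamagamiI[OF X1 _ gs_inv])
    have "concat (map2 replicate ks Xs) = []" by (subst that) (rule concat_map2_replicate_zero)
    with sum show "is_direct_sum C (hd Xs \<boxtimes>\<^sub>o\<^bsub>C\<^esub> dual C (hd Xs)) gs" by simp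
  qed
  moreover have "\<exists>D :: ('o, 'm, 'k) lin_mon_cat.
         generalized_near_group D \<and> trivial_universal_grading D \<and>
         smaller_unless_trivially_graded D C \<and> extension_of C D" if ks: "ks \<noteq> replicate (length ks) 0"
  proof -
    obtain i where i: "i < length ks" "ks ! i \<noteq> 0"
      using ks by (auto simp: list_eq_iff_nth_eq)
    let ?X = "Xs ! i"
    have X: "?X \<in> set Xs" using i(1) Xs(3) by simp
    have "\<forall>W \<in> set (gs @ concat (map2 replicate ks Xs)). simple_object C W"
      using gs(1) Xs(1) by (auto dest: set_zip_rightD)
    moreover have "?X \<in> set (gs @ concat (map2 replicate ks Xs))"
      using nth_in_concat_map2_replicate[OF i(1) Xs(3) i(2)] by simp
    \<comment> \<open>A nonzero multiplicity places a non-invertible simple object among the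
      generators of the adjoint subcategory, which is the input of the extension.\<close>
    ultimately have "constituent C ?X (hd Xs \<boxtimes>\<^sub>o\<^bsub>C\<^esub> dual C (hd Xs))"
      unfolding constituent_def using sum by blast
    then have "?X \<in> adjoint_subcategory C" by (rule adjoint_subcategory_constituent[OF X1(1)])
    moreover have "simple_object C ?X" "\<not> invertible_object C ?X" using X Xs(1) Xs_noninv by blast+
    ultimately show ?thesis using extension_of_adjoint_subcategory by blast
  qed
  ultimately show ?thesis by blast
qed

end
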